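(* Let $A$ be an artin algebra with Jacobson radical $J$, and let $S=Ae/Je$, where $e$ is a primitive idempotent in $A$. (1) If $Je/J^2e\cong \bigoplus_{i=1}^s Ae_i/Je_i$, where the $e_i$ are primitive idempotents in $A$, then $$\ell(D\mathrm{Tr}\,S)\ \ge\ (s-1)+\sum_{i=1}^s\ell(e_iJ/e_iJ^2)\ \ge\ 2s-1.$$ (2) If $eJ/eJ^2\cong\bigoplus_{i=1}^t e_iA/e_iJ$, where the $e_i$ are primitive idempotents in $A$, then $$\ell(\mathrm{Tr}D\,S)\ \ge\ (t-1)+\sum_{i=1}^t\ell(Je_i/J^2e_i)\ \ge\ 2t-1.$$
   Context: $A$ is an artin $R$-algebra, where $R$ is a commutative artinian ring. $\ell(M)$ is the composition length of a module $M$ (left or right). $D=\mathrm{Hom}_R(-,I_R)$ is the standard duality between finitely generated left and right $A$-modules, with $I_R$ a minimal injective cogenerator of $\mathrm{mod}\,R$, and $\mathrm{Tr}$ is the Auslander–Bridger transpose, so $D\mathrm{Tr}$ and $\mathrm{Tr}D$ are the Auslander–Reiten translates. *)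

theory Defs
  imports "HOL-Algebra.Module" "HOL-Algebra.Ideal_Product"
begin

section \<open>Modules over a not necessarily commutative ring\<close>

text \<open>
  The library locale \<^locale>\<open>module\<close> requires a commutative ring of scalars. The following is the
  same notion for left modules over an arbitrary ring, on the same record type \<^typ>\<open>('a, 'b) module\<close>.
  Of that record only the fields \<^const>\<open>carrier\<close>, \<^const>\<open>zero\<close>, \<^const>\<open>add\<close> and \<^const>\<open>smult\<close> matter.
\<close>

locale left_module = R?: ring R + M?: abelian_group M
  for R :: "('a, 'k) ring_scheme" (structure) and M :: "('a, 'b, 'm) module_scheme" (structure) +
  assumes smult_closed [simp, intro]:
      "\<lbrakk>a \<in> carrier R; x \<in> carrier M\<rbrakk> \<Longrightarrow> a \<odot>\<^bsub>M\<^esub> x \<in> carrier M"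
    and smult_l_distr:
      "\<lbrakk>a \<in> carrier R; b \<in> carrier R; x \<in> carrier M\<rbrakk> \<Longrightarrow>
        (a \<oplus> b) \<odot>\<^bsub>M\<^esub> x = a \<odot>\<^bsub>M\<^esub> x \<oplus>\<^bsub>M\<^esub> b \<odot>\<^bsub>M\<^esub> x"
    and smult_r_distr:
      "\<lbrakk>a \<in> carrier R; x \<in> carrier M; y \<in> carrier M\<rbrakk> \<Longrightarrow>
        a \<odot>\<^bsub>M\<^esub> (x \<oplus>\<^bsub>M\<^esub> y) = a \<odot>\<^bsub>M\<^esub> x \<oplus>\<^bsub>M\<^esub> a \<odot>\<^bsub>M\<^esub> y"
    and smult_assoc1:
      "\<lbrakk>a \<in> carrier R; b \<in> carrier R; x \<in> carrier M\<rbrakk> \<Longrightarrow>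
        (a \<otimes> b) \<odot>\<^bsub>M\<^esub> x = a \<odot>\<^bsub>M\<^esub> (b \<odot>\<^bsub>M\<^esub> x)"
    and smult_one [simp]:
      "x \<in> carrier M \<Longrightarrow> \<one> \<odot>\<^bsub>M\<^esub> x = x"

lemma left_module_iff_module: "cring R \<Longrightarrow> left_module R M \<longleftrightarrow> module R M"
  by (auto simp: left_module_def module_def left_module_axioms_def module_axioms_def cring.axioms)

text \<open>Right \<open>A\<close>-modules are left modules over the opposite ring.\<close>

definition op_ring :: "('a, 'm) ring_scheme \<Rightarrow> ('a, 'm) ring_scheme" where
  "op_ring A = A\<lparr>mult := \<lambda>x y. y \<otimes>\<^bsub>A\<^esub> x\<rparr>"

lemma op_ring_op_ring [simp]: "op_ring (op_ring A) = A"
  by (simp add: op_ring_def)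

definition regular :: "('a, 'm) ring_scheme \<Rightarrow> ('a, 'a) module" where
  "regular A = \<lparr>carrier = carrier A, mult = (\<otimes>\<^bsub>A\<^esub>), one = one A, zero = zero A, add = add A,
                smult = (\<otimes>\<^bsub>A\<^esub>)\<rparr>"

definition restrict_scalars :: "('r \<Rightarrow> 'a) \<Rightarrow> ('a, 'b) module \<Rightarrow> ('r, 'b) module" where
  "restrict_scalars \<phi> M = \<lparr>carrier = carrier M, mult = (\<otimes>\<^bsub>M\<^esub>), one = one M, zero = zero M,
                          add = add M, smult = \<lambda>r x. \<phi> r \<odot>\<^bsub>M\<^esub> x\<rparr>"

text \<open>
  The union in the scalar action is the single coset \<open>N + a x\<close> when \<open>X = N + x\<close>.
\<close>

definition quot_mod :: "('a, 'b) module \<Rightarrow> 'b set \<Rightarrow> ('a, 'b set) module" where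
  "quot_mod M N = \<lparr>carrier = a_rcosets\<^bsub>M\<^esub> N, mult = undefined, one = undefined, zero = N,
                   add = set_add M, smult = \<lambda>a X. \<Union>x\<in>X. N +>\<^bsub>M\<^esub> (a \<odot>\<^bsub>M\<^esub> x)\<rparr>"

definition direct_sum :: "'i set \<Rightarrow> ('i \<Rightarrow> ('a, 'b) module) \<Rightarrow> ('a, 'i \<Rightarrow> 'b) module" where
  "direct_sum K M = \<lparr>carrier = \<Pi>\<^sub>E i\<in>K. carrier (M i), mult = undefined, one = undefined,
                     zero = \<lambda>i\<in>K. \<zero>\<^bsub>M i\<^esub>, add = \<lambda>x y. \<lambda>i\<in>K. x i \<oplus>\<^bsub>M i\<^esub> y i,
                     smult = \<lambda>a x. \<lambda>i\<in>K. a \<odot>\<^bsub>M i\<^esub> x i\<rparr>"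

text \<open>Homomorphisms are extensional functions, so that equality of homomorphisms is equality in HOL.\<close>

definition module_Hom ::
  "('a, 'm) ring_scheme \<Rightarrow> ('a, 'b) module \<Rightarrow> ('a, 'c) module \<Rightarrow> ('b \<Rightarrow> 'c) set" where
  "module_Hom A M N = {h \<in> carrier M \<rightarrow>\<^sub>E carrier N.
     (\<forall>x\<in>carrier M. \<forall>y\<in>carrier M. h (x \<oplus>\<^bsub>M\<^esub> y) = h x \<oplus>\<^bsub>N\<^esub> h y) \<and>
     (\<forall>a\<in>carrier A. \<forall>x\<in>carrier M. h (a \<odot>\<^bsub>M\<^esub> x) = a \<odot>\<^bsub>N\<^esub> h x)}"

definition module_iso :: "('a, 'm) ring_scheme \<Rightarrow> ('a, 'b) module \<Rightarrow> ('a, 'c) module \<Rightarrow> bool" where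
  "module_iso A M N \<longleftrightarrow> (\<exists>h\<in>module_Hom A M N. bij_betw h (carrier M) (carrier N))"

definition fin_gen :: "('a, 'm) ring_scheme \<Rightarrow> ('a, 'b) module \<Rightarrow> bool" where
  "fin_gen A M \<longleftrightarrow> (\<exists>X. finite X \<and> X \<subseteq> carrier M \<and>
     (\<forall>N. submodule N A M \<longrightarrow> X \<subseteq> N \<longrightarrow> N = carrier M))"

definition fg_module :: "('a, 'm) ring_scheme \<Rightarrow> ('a, 'b) module \<Rightarrow> bool" where
  "fg_module A M \<longleftrightarrow> left_module A M \<and> fin_gen A M"

definition simple_module :: "('a, 'm) ring_scheme \<Rightarrow> ('a, 'b) module \<Rightarrow> bool" where
  "simple_module A M \<longleftrightarrow> left_module A M \<and> carrier M \<noteq> {\<zero>\<^bsub>M\<^esub>} \<and>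
     (\<forall>N. submodule N A M \<longrightarrow> N = {\<zero>\<^bsub>M\<^esub>} \<or> N = carrier M)"

definition composition_series ::
  "('a, 'm) ring_scheme \<Rightarrow> ('a, 'b) module \<Rightarrow> (nat \<Rightarrow> 'b set) \<Rightarrow> nat \<Rightarrow> bool" where
  "composition_series A M F n \<longleftrightarrow>
     F 0 = {\<zero>\<^bsub>M\<^esub>} \<and> F n = carrier M \<and> (\<forall>i\<le>n. submodule (F i) A M) \<and>
     (\<forall>i<n. F i \<subseteq> F (Suc i) \<and> simple_module A (quot_mod (M\<lparr>carrier := F (Suc i)\<rparr>) (F i)))"

text \<open>
  Well defined, by the Jordan--Hoelder theorem, on modules with a composition series; unspecified
  on all others.
\<close>

definition comp_length :: "('a, 'm) ring_scheme \<Rightarrow> ('a, 'b) module \<Rightarrow> nat" where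
  "comp_length A M = (THE n. \<exists>F. composition_series A M F n)"


section \<open>Artin algebras, the radical, primitive idempotents\<close>

definition artinian :: "('r, 'm) ring_scheme \<Rightarrow> bool" where
  "artinian R \<longleftrightarrow> (\<forall>I. (\<forall>n::nat. ideal (I n) R \<and> I (Suc n) \<subseteq> I n) \<longrightarrow> (\<exists>n. \<forall>m\<ge>n. I m = I n))"

text \<open>\<open>\<phi>\<close> is the structure map of the \<open>R\<close>-algebra \<open>A\<close>, a ring homomorphism to the center.\<close>

locale artin_algebra = R?: cring R + A?: ring A
  for R :: "('r, 'k) ring_scheme" (structure) and A :: "('a, 'l) ring_scheme" (structure) +
  fixes \<phi> :: "'r \<Rightarrow> 'a"
  assumes artinian: "artinian R"
    and structure_map: "\<phi> \<in> ring_hom R A"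
    and central: "\<lbrakk>r \<in> carrier R; a \<in> carrier A\<rbrakk> \<Longrightarrow> \<phi> r \<otimes>\<^bsub>A\<^esub> a = a \<otimes>\<^bsub>A\<^esub> \<phi> r"
    and fin_gen: "fin_gen R (restrict_scalars \<phi> (regular A))"

definition maximal_submodule :: "('a, 'm) ring_scheme \<Rightarrow> ('a, 'b) module \<Rightarrow> 'b set \<Rightarrow> bool" where
  "maximal_submodule A M L \<longleftrightarrow> submodule L A M \<and> L \<noteq> carrier M \<and>
     (\<forall>N. submodule N A M \<longrightarrow> L \<subseteq> N \<longrightarrow> N = L \<or> N = carrier M)"

definition jacobson_radical :: "('a, 'm) ring_scheme \<Rightarrow> 'a set" where
  "jacobson_radical A = carrier A \<inter> \<Inter>{L. maximal_submodule A (regular A) L}"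

definition idempotent_elt :: "('a, 'm) ring_scheme \<Rightarrow> 'a \<Rightarrow> bool" where
  "idempotent_elt A e \<longleftrightarrow> e \<in> carrier A \<and> e \<otimes>\<^bsub>A\<^esub> e = e"

definition primitive_idempotent :: "('a, 'm) ring_scheme \<Rightarrow> 'a \<Rightarrow> bool" where
  "primitive_idempotent A e \<longleftrightarrow> idempotent_elt A e \<and> e \<noteq> \<zero>\<^bsub>A\<^esub> \<and>
     (\<forall>f g. idempotent_elt A f \<and> idempotent_elt A g \<and> f \<otimes>\<^bsub>A\<^esub> g = \<zero>\<^bsub>A\<^esub> \<and> g \<otimes>\<^bsub>A\<^esub> f = \<zero>\<^bsub>A\<^esub> \<and>
            e = f \<oplus>\<^bsub>A\<^esub> g \<longrightarrow> f = \<zero>\<^bsub>A\<^esub> \<or> g = \<zero>\<^bsub>A\<^esub>)"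

text \<open>
  The left module \<open>X/Y\<close> for left ideals \<open>Y \<subseteq> X\<close>, and the right module \<open>X/Y\<close> for right ideals
  \<open>Y \<subseteq> X\<close>. Below, \<open>X #>\<^bsub>A\<^esub> e\<close> and \<open>e <#\<^bsub>A\<^esub> X\<close> are multiplicative cosets, that is \<open>X e\<close> and \<open>e X\<close>.
\<close>

definition lquot :: "('a, 'm) ring_scheme \<Rightarrow> 'a set \<Rightarrow> 'a set \<Rightarrow> ('a, 'a set) module" where
  "lquot A X Y = quot_mod ((regular A)\<lparr>carrier := X\<rparr>) Y"

definition rquot :: "('a, 'm) ring_scheme \<Rightarrow> 'a set \<Rightarrow> 'a set \<Rightarrow> ('a, 'a set) module" where
  "rquot A X Y = quot_mod ((regular (op_ring A))\<lparr>carrier := X\<rparr>) Y"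


section \<open>Projective covers and the transpose\<close>

text \<open>
  HOL cannot quantify over all types inside a definition. Every finitely generated \<open>A\<close>-module is
  isomorphic to a quotient of some \<open>A\<^sup>n\<close>, hence to one whose elements are sets of sequences in \<open>A\<close>.
  So test modules of the following type represent all of \<open>mod A\<close>, and the notions below are the usual
  ones of a projective object, an injective object and a cogenerator of \<open>mod A\<close>.
\<close>

type_synonym 'a test_module = "('a, (nat \<Rightarrow> 'a) set) module"

definition projective :: "('a, 'm) ring_scheme \<Rightarrow> ('a, 'b) module \<Rightarrow> bool" where
  "projective A P \<longleftrightarrow> fg_module A P \<and>
     (\<forall>(X :: 'a test_module) (Y :: 'a test_module) g h.
        fg_module A X \<and> fg_module A Y \<and> g \<in> module_Hom A X Y \<and> g ` carrier X = carrier Y \<and>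
        h \<in> module_Hom A P Y \<longrightarrow>
        (\<exists>k\<in>module_Hom A P X. \<forall>x\<in>carrier P. g (k x) = h x))"

definition injective :: "('a, 'm) ring_scheme \<Rightarrow> ('a, 'b) module \<Rightarrow> bool" where
  "injective A I \<longleftrightarrow> fg_module A I \<and>
     (\<forall>(X :: 'a test_module) (Y :: 'a test_module) g h.
        fg_module A X \<and> fg_module A Y \<and> g \<in> module_Hom A X Y \<and> inj_on g (carrier X) \<and>
        h \<in> module_Hom A X I \<longrightarrow>
        (\<exists>k\<in>module_Hom A Y I. \<forall>x\<in>carrier X. k (g x) = h x))"

definition cogenerator :: "('a, 'm) ring_scheme \<Rightarrow> ('a, 'b) module \<Rightarrow> bool" where
  "cogenerator A I \<longleftrightarrow> fg_module A I \<and>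
     (\<forall>X :: 'a test_module. fg_module A X \<longrightarrow>
        (\<forall>x\<in>carrier X. x \<noteq> \<zero>\<^bsub>X\<^esub> \<longrightarrow> (\<exists>h\<in>module_Hom A X I. h x \<noteq> \<zero>\<^bsub>I\<^esub>)))"

definition minimal_injective_cogenerator :: "('a, 'm) ring_scheme \<Rightarrow> ('a, 'b) module \<Rightarrow> bool" where
  "minimal_injective_cogenerator A I \<longleftrightarrow> injective A I \<and> cogenerator A I \<and>
     (\<forall>N. submodule N A I \<and> injective A (I\<lparr>carrier := N\<rparr>) \<and> cogenerator A (I\<lparr>carrier := N\<rparr>) \<longrightarrow>
          N = carrier I)"

definition projective_cover ::
  "('a, 'm) ring_scheme \<Rightarrow> ('a, 'p) module \<Rightarrow> ('p \<Rightarrow> 'b) \<Rightarrow> ('a, 'b) module \<Rightarrow> bool" where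
  "projective_cover A P p M \<longleftrightarrow> projective A P \<and> p \<in> module_Hom A P M \<and> p ` carrier P = carrier M \<and>
     (\<forall>N. submodule N A P \<and> p ` N = carrier M \<longrightarrow> N = carrier P)"

text \<open>\<open>P1 \<rightarrow> P0 \<rightarrow> M \<rightarrow> 0\<close> with maps \<open>f\<close> and \<open>p\<close>.\<close>

definition minimal_projective_presentation ::
  "('a, 'm) ring_scheme \<Rightarrow> ('a, 'p1) module \<Rightarrow> ('p1 \<Rightarrow> 'p0) \<Rightarrow> ('a, 'p0) module \<Rightarrow>
   ('p0 \<Rightarrow> 'b) \<Rightarrow> ('a, 'b) module \<Rightarrow> bool" where
  "minimal_projective_presentation A P1 f P0 p M \<longleftrightarrow>
     projective_cover A P0 p M \<and>
     projective_cover A P1 f (P0\<lparr>carrier := a_kernel P0 M p\<rparr>)"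

text \<open>The abelian group \<open>Hom\<^sub>A(M, N)\<close>, equipped with a given scalar action.\<close>

definition Hom_module ::
  "('a, 'm) ring_scheme \<Rightarrow> ('a, 'b) module \<Rightarrow> ('a, 'c) module \<Rightarrow>
   ('s \<Rightarrow> ('b \<Rightarrow> 'c) \<Rightarrow> ('b \<Rightarrow> 'c)) \<Rightarrow> ('s, 'b \<Rightarrow> 'c) module" where
  "Hom_module A M N act = \<lparr>carrier = module_Hom A M N, mult = undefined, one = undefined,
     zero = \<lambda>x\<in>carrier M. \<zero>\<^bsub>N\<^esub>, add = \<lambda>h k. \<lambda>x\<in>carrier M. h x \<oplus>\<^bsub>N\<^esub> k x, smult = act\<rparr>"

text \<open>\<open>P\<^sup>* = Hom\<^sub>A(P, A)\<close>, a right \<open>A\<close>-module by \<open>(h a)(x) = h(x) a\<close>.\<close>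

definition ring_dual :: "('a, 'm) ring_scheme \<Rightarrow> ('a, 'b) module \<Rightarrow> ('a, 'b \<Rightarrow> 'a) module" where
  "ring_dual A P = Hom_module A P (regular A) (\<lambda>a h. \<lambda>x\<in>carrier P. h x \<otimes>\<^bsub>A\<^esub> a)"

text \<open>
  The transpose computed from a minimal projective presentation \<open>P1 \<rightarrow> P0 \<rightarrow> M \<rightarrow> 0\<close> of a left
  \<open>A\<close>-module \<open>M\<close>: the right \<open>A\<close>-module \<open>Coker(P0\<^sup>* \<rightarrow> P1\<^sup>*)\<close>. Applied to \<^term>\<open>op_ring A\<close> it takes right
  modules to left modules.
\<close>

definition transpose_mod ::
  "('a, 'm) ring_scheme \<Rightarrow> ('a, 'p1) module \<Rightarrow> ('p1 \<Rightarrow> 'p0) \<Rightarrow> ('a, 'p0) module \<Rightarrow>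
   ('a, ('p1 \<Rightarrow> 'a) set) module" where
  "transpose_mod A P1 f P0 =
     quot_mod (ring_dual A P1) ((\<lambda>h. compose (carrier P1) h f) ` carrier (ring_dual A P0))"

text \<open>
  The duality \<open>D = Hom\<^sub>R(-, I)\<close>, with \<open>(a h)(x) = h(a x)\<close>. It takes modules over \<open>A\<close> to modules over
  \<^term>\<open>op_ring A\<close>, in both directions: only the action of \<open>A\<close> on \<open>M\<close> enters.
\<close>

definition D_dual ::
  "('r, 'k) ring_scheme \<Rightarrow> ('r \<Rightarrow> 'a) \<Rightarrow> ('r, 'i) module \<Rightarrow> ('a, 'b) module \<Rightarrow> ('a, 'b \<Rightarrow> 'i) module"
  where
  "D_dual R \<phi> I M =
     Hom_module R (restrict_scalars \<phi> M) I (\<lambda>a h. \<lambda>x\<in>carrier M. h (a \<odot>\<^bsub>M\<^esub> x))"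

end

theory Submission
  imports Defs
begin

text \<open>
  Let \<open>P\<^sub>0 \<cong> A e\<close> and \<open>P\<^sub>1 \<cong> \<Oplus> A e\<^sub>i\<close> be the terms of the minimal presentation of \<open>S\<close>. Lifting the classes
  of the \<open>e\<^sub>i\<close> along \<open>J e / J\<^sup>2 e \<cong> \<Oplus> A e\<^sub>i / J e\<^sub>i\<close> gives generators \<open>y\<^sub>i \<in> e\<^sub>i J e\<close> of \<open>J e\<close>, so
  \<open>Tr S\<close> is \<open>\<Oplus> e\<^sub>i A\<close> modulo the right submodule \<open>(y\<^sub>1, \<dots>, y\<^sub>s) A\<close>. That submodule lies in \<open>\<Oplus> e\<^sub>i J\<close>
  and its image modulo \<open>\<Oplus> e\<^sub>i J\<^sup>2\<close> is a quotient of the simple module \<open>e A / e J\<close>, so factoring it out costs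
  length at most one in \<open>\<Oplus> e\<^sub>i A / e\<^sub>i J\<^sup>2\<close>. No layer \<open>e\<^sub>i J / e\<^sub>i J\<^sup>2\<close> vanishes, because otherwise
  \<open>y\<^sub>i \<in> J\<^sup>2 e\<close>. The duality \<open>D\<close> does not decrease length, since \<open>I\<close> cogenerates. For the second part,
  minimality of \<open>I\<close> makes its socles one-dimensional, hence \<open>D S \<cong> e A / e J\<close>, and the first argument
  applies to the opposite algebra.
\<close>

section \<open>Left modules and linear maps\<close>

text \<open>The presentation in the statement is arbitrary and lives on arbitrary types, so its
  terms are never replaced by \<open>A e\<close> or a sum of \<open>A \<epsilon> i\<close>. Instead
  each projective cover receives a dual basis, and submodules of its dual are cut out by conditions
  on the values at that basis; all lengths become ranks inside one ambient module. In
  \<open>s - 1\<close> the \<open>s\<close> counts the simple tops \<open>e_i A / e_i J\<close>, and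
  the 1 is the loss caused by the image of the dual of \<open>P0\<close>. Two points shape the work.
  Of \<open>R\<close> only the descending chain condition is given, so finite length of
  \<open>R\<close> has to be derived before any length is meaningful. And the second half concerns
  \<open>D S\<close>, which is not literally a quotient of \<open>e A\<close>; therefore the bound
  on the transpose is proved for every module with a generator \<open>m0 = e m0\<close> whose
  annihilator in \<open>A e\<close> is \<open>J e\<close>, a form shared by \<open>S\<close> and,
  over the opposite ring, \<open>D S\<close>. For the outer \<open>D\<close> in the first half an
  inequality of lengths suffices, so annihilators of a chain do the job and no biduality is
  built.\<close>

definition cyclic :: "('a, 'm) ring_scheme \<Rightarrow> ('a, 'b, 'n) module_scheme \<Rightarrow> 'b \<Rightarrow> 'b set" where
  "cyclic A M x = (\<lambda>a. a \<odot>\<^bsub>M\<^esub> x) ` carrier A"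

lemma left_moduleI:
  fixes A (structure) and M (structure)
  assumes "ring A" "abelian_group M"
    and "\<And>a x. a \<in> carrier A \<Longrightarrow> x \<in> carrier M \<Longrightarrow> a \<odot>\<^bsub>M\<^esub> x \<in> carrier M"
    and "\<And>a b x. a \<in> carrier A \<Longrightarrow> b \<in> carrier A \<Longrightarrow> x \<in> carrier M \<Longrightarrow>
           (a \<oplus> b) \<odot>\<^bsub>M\<^esub> x = a \<odot>\<^bsub>M\<^esub> x \<oplus>\<^bsub>M\<^esub> b \<odot>\<^bsub>M\<^esub> x"
    and "\<And>a x y. a \<in> carrier A \<Longrightarrow> x \<in> carrier M \<Longrightarrow> y \<in> carrier M \<Longrightarrow>
           a \<odot>\<^bsub>M\<^esub> (x \<oplus>\<^bsub>M\<^esub> y) = a \<odot>\<^bsub>M\<^esub> x \<oplus>\<^bsub>M\<^esub> a \<odot>\<^bsub>M\<^esub> y"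
    and "\<And>a b x. a \<in> carrier A \<Longrightarrow> b \<in> carrier A \<Longrightarrow> x \<in> carrier M \<Longrightarrow>
           (a \<otimes> b) \<odot>\<^bsub>M\<^esub> x = a \<odot>\<^bsub>M\<^esub> (b \<odot>\<^bsub>M\<^esub> x)"
    and "\<And>x. x \<in> carrier M \<Longrightarrow> \<one> \<odot>\<^bsub>M\<^esub> x = x"
  shows "left_module A M"
  using assms by (auto intro!: left_module.intro left_module_axioms.intro)

context left_module
begin

lemma smult_l_null [simp]: "x \<in> carrier M \<Longrightarrow> \<zero> \<odot>\<^bsub>M\<^esub> x = \<zero>\<^bsub>M\<^esub>"
  using smult_l_distr[of \<zero> \<zero> x] M.add.l_cancel_one[of "\<zero> \<odot>\<^bsub>M\<^esub> x" "\<zero> \<odot>\<^bsub>M\<^esub> x"] by auto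

lemma smult_r_null [simp]: "a \<in> carrier R \<Longrightarrow> a \<odot>\<^bsub>M\<^esub> \<zero>\<^bsub>M\<^esub> = \<zero>\<^bsub>M\<^esub>"
  using smult_r_distr[of a "\<zero>\<^bsub>M\<^esub>" "\<zero>\<^bsub>M\<^esub>"]
    M.add.l_cancel_one[of "a \<odot>\<^bsub>M\<^esub> \<zero>\<^bsub>M\<^esub>" "a \<odot>\<^bsub>M\<^esub> \<zero>\<^bsub>M\<^esub>"] by auto

lemma smult_l_minus: "a \<in> carrier R \<Longrightarrow> x \<in> carrier M \<Longrightarrow> (\<ominus> a) \<odot>\<^bsub>M\<^esub> x = \<ominus>\<^bsub>M\<^esub> (a \<odot>\<^bsub>M\<^esub> x)"
  using smult_l_distr[of "\<ominus> a" a x] by (simp add: R.l_neg M.minus_equality)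

lemma smult_r_minus: "a \<in> carrier R \<Longrightarrow> x \<in> carrier M \<Longrightarrow> a \<odot>\<^bsub>M\<^esub> (\<ominus>\<^bsub>M\<^esub> x) = \<ominus>\<^bsub>M\<^esub> (a \<odot>\<^bsub>M\<^esub> x)"
  using smult_r_distr[of a "\<ominus>\<^bsub>M\<^esub> x" x] by (simp add: M.l_neg M.minus_equality)

lemma smult_minus_distr:
  "a \<in> carrier R \<Longrightarrow> b \<in> carrier R \<Longrightarrow> x \<in> carrier M \<Longrightarrow>
   (a \<ominus> b) \<odot>\<^bsub>M\<^esub> x = a \<odot>\<^bsub>M\<^esub> x \<ominus>\<^bsub>M\<^esub> b \<odot>\<^bsub>M\<^esub> x"
  by (simp add: R.minus_eq M.minus_eq smult_l_distr smult_l_minus)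

lemma minus_eq_zero_iff:
  "x \<in> carrier M \<Longrightarrow> y \<in> carrier M \<Longrightarrow> x \<ominus>\<^bsub>M\<^esub> y = \<zero>\<^bsub>M\<^esub> \<longleftrightarrow> x = y"
  by (metis M.minus_eq M.r_neg M.minus_equality M.minus_minus M.add.inv_closed)

lemma minus_add_cancel [simp]:
  "x \<in> carrier M \<Longrightarrow> y \<in> carrier M \<Longrightarrow> (x \<ominus>\<^bsub>M\<^esub> y) \<oplus>\<^bsub>M\<^esub> y = x"
  by (simp add: M.minus_eq M.a_assoc M.l_neg)

lemma add_minus_cancel [simp]:
  "x \<in> carrier M \<Longrightarrow> y \<in> carrier M \<Longrightarrow> y \<oplus>\<^bsub>M\<^esub> (x \<ominus>\<^bsub>M\<^esub> y) = x"
  by (simp add: M.a_comm[of y])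

lemma add_minus_cancel_right [simp]:
  "x \<in> carrier M \<Longrightarrow> y \<in> carrier M \<Longrightarrow> (x \<oplus>\<^bsub>M\<^esub> y) \<ominus>\<^bsub>M\<^esub> y = x"
  by (simp add: M.minus_eq M.a_assoc M.r_neg)

lemma minus_zero [simp]: "x \<in> carrier M \<Longrightarrow> x \<ominus>\<^bsub>M\<^esub> \<zero>\<^bsub>M\<^esub> = x"
  using add_minus_cancel_right[of x "\<zero>\<^bsub>M\<^esub>"] by simp

text \<open>Negatives come for free since \<open>- x = (- 1) x\<close>, so submodule goals reduce to
  zero, sums and scalar multiples.\<close>

lemma submodule_iff:
  "submodule N R M \<longleftrightarrow> N \<subseteq> carrier M \<and> \<zero>\<^bsub>M\<^esub> \<in> N \<and> (\<forall>x\<in>N. \<forall>y\<in>N. x \<oplus>\<^bsub>M\<^esub> y \<in> N) \<and>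
     (\<forall>a\<in>carrier R. \<forall>x\<in>N. a \<odot>\<^bsub>M\<^esub> x \<in> N)" (is "?L \<longleftrightarrow> ?R")
proof
  assume ?L
  then interpret N: submodule N R M .
  show ?R
    using N.subset N.one_closed N.m_closed N.smult_closed by auto
next
  assume r: ?R
  have "\<ominus>\<^bsub>M\<^esub> x \<in> N" if "x \<in> N" for x
  proof -
    have "(\<ominus> \<one>) \<odot>\<^bsub>M\<^esub> x \<in> N" using r that by auto
    moreover have "(\<ominus> \<one>) \<odot>\<^bsub>M\<^esub> x = \<ominus>\<^bsub>M\<^esub> x"
      using smult_l_minus[of \<one> x] r that by auto
    ultimately show ?thesis by simp
  qed
  with r show ?L
    by (auto intro!: submodule.intro subgroup.intro submodule_axioms.intro simp: a_inv_def)
qed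

lemma submoduleI:
  "N \<subseteq> carrier M \<Longrightarrow> \<zero>\<^bsub>M\<^esub> \<in> N \<Longrightarrow> (\<And>x y. x \<in> N \<Longrightarrow> y \<in> N \<Longrightarrow> x \<oplus>\<^bsub>M\<^esub> y \<in> N) \<Longrightarrow>
   (\<And>a x. a \<in> carrier R \<Longrightarrow> x \<in> N \<Longrightarrow> a \<odot>\<^bsub>M\<^esub> x \<in> N) \<Longrightarrow> submodule N R M"
  by (auto simp: submodule_iff)

lemma submoduleD:
  assumes "submodule N R M"
  shows "N \<subseteq> carrier M" "\<And>x. x \<in> N \<Longrightarrow> x \<in> carrier M" "\<zero>\<^bsub>M\<^esub> \<in> N"
    "\<And>x y. x \<in> N \<Longrightarrow> y \<in> N \<Longrightarrow> x \<oplus>\<^bsub>M\<^esub> y \<in> N"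
    "\<And>a x. a \<in> carrier R \<Longrightarrow> x \<in> N \<Longrightarrow> a \<odot>\<^bsub>M\<^esub> x \<in> N"
  using assms by (auto simp: submodule_iff)

lemma submodule_a_inv: "submodule N R M \<Longrightarrow> x \<in> N \<Longrightarrow> \<ominus>\<^bsub>M\<^esub> x \<in> N"
  using submoduleD[of N] smult_l_minus[of \<one> x] by (metis R.a_inv_closed R.one_closed smult_one)

lemma submodule_minus: "submodule N R M \<Longrightarrow> x \<in> N \<Longrightarrow> y \<in> N \<Longrightarrow> x \<ominus>\<^bsub>M\<^esub> y \<in> N"
  by (simp add: M.minus_eq submoduleD submodule_a_inv)

lemma submodule_add_cancel:
  assumes "submodule N R M" "x \<in> carrier M" "y \<in> N" "x \<oplus>\<^bsub>M\<^esub> y \<in> N"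
  shows "x \<in> N"
  using submodule_minus[OF assms(1,4,3)] assms submoduleD(2)[OF assms(1,3)] by simp

lemma submodule_zero: "submodule {\<zero>\<^bsub>M\<^esub>} R M"
  by (auto simp: submodule_iff)

lemma submodule_carrier: "submodule (carrier M) R M"
  by (auto simp: submodule_iff)

lemma submodule_Int: "submodule N R M \<Longrightarrow> submodule N' R M \<Longrightarrow> submodule (N \<inter> N') R M"
  by (auto simp: submodule_iff)

lemma set_add_iff: "z \<in> N <+>\<^bsub>M\<^esub> N' \<longleftrightarrow> (\<exists>x\<in>N. \<exists>y\<in>N'. z = x \<oplus>\<^bsub>M\<^esub> y)"
  by (auto simp: set_add_def')

lemma set_addI: "x \<in> N \<Longrightarrow> y \<in> N' \<Longrightarrow> x \<oplus>\<^bsub>M\<^esub> y \<in> N <+>\<^bsub>M\<^esub> N'"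
  by (auto simp: set_add_iff)

lemma set_addE:
  assumes "z \<in> N <+>\<^bsub>M\<^esub> N'"
  obtains x y where "x \<in> N" "y \<in> N'" "z = x \<oplus>\<^bsub>M\<^esub> y"
  using assms by (auto simp: set_add_iff)

lemma submodule_set_add:
  assumes "submodule N R M" "submodule N' R M"
  shows "submodule (N <+>\<^bsub>M\<^esub> N') R M"
proof -
  note D = submoduleD[OF assms(1)] and D' = submoduleD[OF assms(2)]
  show ?thesis
  proof (rule submoduleI)
    show "N <+>\<^bsub>M\<^esub> N' \<subseteq> carrier M" by (auto elim!: set_addE intro: D(2) D'(2))
    show "\<zero>\<^bsub>M\<^esub> \<in> N <+>\<^bsub>M\<^esub> N'" using set_addI[OF D(3) D'(3)] by simp
    show "x \<oplus>\<^bsub>M\<^esub> y \<in> N <+>\<^bsub>M\<^esub> N'" if xy: "x \<in> N <+>\<^bsub>M\<^esub> N'" "y \<in> N <+>\<^bsub>M\<^esub> N'" for x y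
    proof -
      from xy obtain a b c d
        where *: "a \<in> N" "b \<in> N'" "x = a \<oplus>\<^bsub>M\<^esub> b" and **: "c \<in> N" "d \<in> N'" "y = c \<oplus>\<^bsub>M\<^esub> d"
        by (elim set_addE)
      have "(a \<oplus>\<^bsub>M\<^esub> c) \<oplus>\<^bsub>M\<^esub> (b \<oplus>\<^bsub>M\<^esub> d) \<in> N <+>\<^bsub>M\<^esub> N'"
        by (intro set_addI D(4) D'(4) * **)
      moreover have "x \<oplus>\<^bsub>M\<^esub> y = (a \<oplus>\<^bsub>M\<^esub> c) \<oplus>\<^bsub>M\<^esub> (b \<oplus>\<^bsub>M\<^esub> d)"
        using D(2)[OF *(1)] D'(2)[OF *(2)] D(2)[OF **(1)] D'(2)[OF **(2)]
        by (simp add: *(3) **(3) M.a_ac)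
      ultimately show ?thesis by simp
    qed
    show "a \<odot>\<^bsub>M\<^esub> x \<in> N <+>\<^bsub>M\<^esub> N'" if a: "a \<in> carrier R" and x: "x \<in> N <+>\<^bsub>M\<^esub> N'" for a x
    proof -
      from x obtain b c where *: "b \<in> N" "c \<in> N'" "x = b \<oplus>\<^bsub>M\<^esub> c" by (elim set_addE)
      have "a \<odot>\<^bsub>M\<^esub> b \<oplus>\<^bsub>M\<^esub> a \<odot>\<^bsub>M\<^esub> c \<in> N <+>\<^bsub>M\<^esub> N'" by (intro set_addI D(5) D'(5) a *)
      then show ?thesis
        using smult_r_distr[OF a D(2)[OF *(1)] D'(2)[OF *(2)]] *(3) by simp
    qed
  qed
qed

lemma set_add_upper:
  assumes "submodule N R M" "submodule N' R M"
  shows "N \<subseteq> N <+>\<^bsub>M\<^esub> N'" "N' \<subseteq> N <+>\<^bsub>M\<^esub> N'"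
proof -
  show "N \<subseteq> N <+>\<^bsub>M\<^esub> N'"
    using set_addI[OF _ submoduleD(3)[OF assms(2)]] submoduleD(2)[OF assms(1)] by force
  show "N' \<subseteq> N <+>\<^bsub>M\<^esub> N'"
    using set_addI[OF submoduleD(3)[OF assms(1)]] submoduleD(2)[OF assms(2)] by force
qed

lemma set_add_least:
  assumes "submodule K R M" "N \<subseteq> K" "N' \<subseteq> K"
  shows "N <+>\<^bsub>M\<^esub> N' \<subseteq> K"
  using assms(2,3) by (auto elim!: set_addE intro!: submoduleD(4)[OF assms(1)])

lemma submodule_cyclic: "x \<in> carrier M \<Longrightarrow> submodule (cyclic R M x) R M"
  unfolding cyclic_def
proof (rule submoduleI)
  assume x: "x \<in> carrier M"
  show "(\<lambda>a. a \<odot>\<^bsub>M\<^esub> x) ` carrier R \<subseteq> carrier M" using x by auto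
  show "\<zero>\<^bsub>M\<^esub> \<in> (\<lambda>a. a \<odot>\<^bsub>M\<^esub> x) ` carrier R" using x
    by (metis R.zero_closed imageI smult_l_null)
  show "y \<oplus>\<^bsub>M\<^esub> z \<in> (\<lambda>a. a \<odot>\<^bsub>M\<^esub> x) ` carrier R"
    if "y \<in> (\<lambda>a. a \<odot>\<^bsub>M\<^esub> x) ` carrier R" "z \<in> (\<lambda>a. a \<odot>\<^bsub>M\<^esub> x) ` carrier R" for y z
    using that x by (auto simp: smult_l_distr[symmetric])
  show "a \<odot>\<^bsub>M\<^esub> y \<in> (\<lambda>a. a \<odot>\<^bsub>M\<^esub> x) ` carrier R"
    if "a \<in> carrier R" "y \<in> (\<lambda>a. a \<odot>\<^bsub>M\<^esub> x) ` carrier R" for a y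
    using that x by (auto simp: smult_assoc1[symmetric])
qed

lemma cyclic_self: "x \<in> carrier M \<Longrightarrow> x \<in> cyclic R M x"
  unfolding cyclic_def by (metis R.one_closed imageI smult_one)

lemma cyclic_least: "submodule N R M \<Longrightarrow> x \<in> N \<Longrightarrow> cyclic R M x \<subseteq> N"
  unfolding cyclic_def by (auto simp: submodule_iff)

lemma left_module_sub: "submodule N R M \<Longrightarrow> left_module R (M\<lparr>carrier := N\<rparr>)"
proof -
  assume N: "submodule N R M"
  note D = submoduleD[OF N]
  have "abelian_group (M\<lparr>carrier := N\<rparr>)"
  proof (rule abelian_groupI)
    fix x assume "x \<in> carrier (M\<lparr>carrier := N\<rparr>)"
    then show "\<exists>y\<in>carrier (M\<lparr>carrier := N\<rparr>). y \<oplus>\<^bsub>M\<lparr>carrier := N\<rparr>\<^esub> x = \<zero>\<^bsub>M\<lparr>carrier := N\<rparr>\<^esub>"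
      using submodule_a_inv[OF N] D by (auto intro!: bexI[of _ "\<ominus>\<^bsub>M\<^esub> x"] simp: M.l_neg)
  qed (use D in \<open>auto simp: M.a_ac\<close>)
  then show ?thesis
    by (intro left_moduleI R.ring_axioms)
      (use D in \<open>auto simp: smult_l_distr smult_r_distr smult_assoc1\<close>)
qed

lemma submodule_sub_iff:
  assumes N: "submodule N R M"
  shows "submodule K R (M\<lparr>carrier := N\<rparr>) \<longleftrightarrow> submodule K R M \<and> K \<subseteq> N"
proof -
  interpret N: left_module R "M\<lparr>carrier := N\<rparr>" by (rule left_module_sub[OF N])
  show ?thesis using submoduleD[OF N] unfolding submodule_iff N.submodule_iff by auto
qed

lemma finsum_smult:
  assumes "finite K" "a \<in> carrier R" "f \<in> K \<rightarrow> carrier M"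
  shows "a \<odot>\<^bsub>M\<^esub> (\<Oplus>\<^bsub>M\<^esub>i\<in>K. f i) = (\<Oplus>\<^bsub>M\<^esub>i\<in>K. a \<odot>\<^bsub>M\<^esub> f i)"
  using assms by (induct K) (auto simp: Pi_def smult_r_distr)

lemma submodule_finsum:
  assumes "submodule N R M" "finite K" "\<And>i. i \<in> K \<Longrightarrow> f i \<in> N"
  shows "(\<Oplus>\<^bsub>M\<^esub>i\<in>K. f i) \<in> N"
  using assms(2,3) submoduleD[OF assms(1)] by (induct K) (auto simp: Pi_def)

lemma finsum_single:
  assumes "finite K" "j \<in> K" "x \<in> carrier M"
  shows "(\<Oplus>\<^bsub>M\<^esub>i\<in>K. if i = j then x else \<zero>\<^bsub>M\<^esub>) = x"
  using M.add.finprod_singleton_swap[of j K "\<lambda>_. x"] assms by simp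

lemma additive_subgroup_submodule: "submodule N R M \<Longrightarrow> abelian_subgroup N M"
  by (intro abelian_subgroupI3 additive_subgroup.intro) (auto simp: submodule.axioms M.abelian_group_axioms)

end

lemma left_module_regular: "ring A \<Longrightarrow> left_module A (regular A)"
proof -
  assume A: "ring A"
  interpret ring A by fact
  have "abelian_group (regular A)"
    by (rule abelian_groupI) (auto simp: regular_def a_ac intro: bexI[of _ "\<ominus>\<^bsub>A\<^esub> _"] l_neg)
  then show ?thesis
    by (intro left_moduleI A) (auto simp: regular_def l_distr r_distr m_assoc)
qed

text \<open>Members of \<open>module_Hom\<close> are extensional, a condition that composition and
  change of carrier disturb. Here \<open>h\<close> is constrained only on the carrier;
  \<open>in_module_Hom\<close> and \<open>linear_map_of_Hom\<close> pass between the two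
  notions.\<close>

locale linear_map = dom: left_module A M + cod: left_module A N
  for A :: "('a, 'm) ring_scheme" and M :: "('a, 'b) module" and N :: "('a, 'c) module" +
  fixes h :: "'b \<Rightarrow> 'c"
  assumes closed [simp]: "x \<in> carrier M \<Longrightarrow> h x \<in> carrier N"
    and add [simp]: "x \<in> carrier M \<Longrightarrow> y \<in> carrier M \<Longrightarrow> h (x \<oplus>\<^bsub>M\<^esub> y) = h x \<oplus>\<^bsub>N\<^esub> h y"
    and smult [simp]: "a \<in> carrier A \<Longrightarrow> x \<in> carrier M \<Longrightarrow> h (a \<odot>\<^bsub>M\<^esub> x) = a \<odot>\<^bsub>N\<^esub> h x"

lemmas linear_mapI = linear_map.intro[OF _ _ linear_map_axioms.intro]

context linear_map
begin

lemma zero [simp]: "h \<zero>\<^bsub>M\<^esub> = \<zero>\<^bsub>N\<^esub>"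
  using smult[of "\<zero>\<^bsub>A\<^esub>" "\<zero>\<^bsub>M\<^esub>"] closed[of "\<zero>\<^bsub>M\<^esub>"] by simp

lemma a_inv: "x \<in> carrier M \<Longrightarrow> h (\<ominus>\<^bsub>M\<^esub> x) = \<ominus>\<^bsub>N\<^esub> h x"
  using smult[of "\<ominus>\<^bsub>A\<^esub> \<one>\<^bsub>A\<^esub>" x] by (simp add: dom.smult_l_minus cod.smult_l_minus)

lemma minus: "x \<in> carrier M \<Longrightarrow> y \<in> carrier M \<Longrightarrow> h (x \<ominus>\<^bsub>M\<^esub> y) = h x \<ominus>\<^bsub>N\<^esub> h y"
  by (simp add: dom.M.minus_eq cod.M.minus_eq a_inv)

lemma finsum:
  "finite K \<Longrightarrow> f \<in> K \<rightarrow> carrier M \<Longrightarrow> h (\<Oplus>\<^bsub>M\<^esub>i\<in>K. f i) = (\<Oplus>\<^bsub>N\<^esub>i\<in>K. h (f i))"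
  by (induct K rule: finite_induct) (auto simp: Pi_def)

lemma submodule_image: "submodule K A M \<Longrightarrow> submodule (h ` K) A N"
proof (rule cod.submoduleI)
  assume K: "submodule K A M"
  note D = dom.submoduleD[OF K]
  show "h ` K \<subseteq> carrier N" using D by auto
  show "\<zero>\<^bsub>N\<^esub> \<in> h ` K" using D(3) zero by (metis imageI)
  show "x \<oplus>\<^bsub>N\<^esub> y \<in> h ` K" if xy: "x \<in> h ` K" "y \<in> h ` K" for x y
  proof -
    obtain u v where uv: "u \<in> K" "v \<in> K" "x = h u" "y = h v" using xy by auto
    then have "x \<oplus>\<^bsub>N\<^esub> y = h (u \<oplus>\<^bsub>M\<^esub> v)" using D by simp
    then show ?thesis using D uv by blast
  qed
  show "a \<odot>\<^bsub>N\<^esub> x \<in> h ` K" if ax: "a \<in> carrier A" "x \<in> h ` K" for a x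
  proof -
    obtain u where u: "u \<in> K" "x = h u" using ax by auto
    then have "a \<odot>\<^bsub>N\<^esub> x = h (a \<odot>\<^bsub>M\<^esub> u)" using D ax by simp
    then show ?thesis using D u ax by blast
  qed
qed

lemma submodule_vimage: "submodule K A N \<Longrightarrow> submodule {x \<in> carrier M. h x \<in> K} A M"
  by (rule dom.submoduleI) (auto simp: cod.submodule_iff)

lemma kernel_eq: "a_kernel M N h = {x \<in> carrier M. h x = \<zero>\<^bsub>N\<^esub>}"
  by (rule a_kernel_def')

lemma submodule_kernel: "submodule (a_kernel M N h) A M"
  using submodule_vimage[OF cod.submodule_zero] by (simp add: kernel_eq)

lemma restrict_dom: "submodule K A M \<Longrightarrow> linear_map A (M\<lparr>carrier := K\<rparr>) N h"
  by (intro linear_mapI dom.left_module_sub cod.left_module_axioms)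
    (use dom.submoduleD(2) in auto)

lemma restrict_cod:
  assumes "submodule K A N" "h ` carrier M \<subseteq> K"
  shows "linear_map A M (N\<lparr>carrier := K\<rparr>) h"
  using assms
  by (intro linear_mapI cod.left_module_sub dom.left_module_axioms) auto

lemma in_module_Hom: "restrict h (carrier M) \<in> module_Hom A M N"
  unfolding module_Hom_def by simp

end

lemma linear_map_of_Hom:
  assumes "left_module A M" "left_module A N" "h \<in> module_Hom A M N"
  shows "linear_map A M N h"
  using assms by (intro linear_mapI) (auto simp: module_Hom_def)

lemma linear_map_comp:
  assumes "linear_map A M N h" "linear_map A N K k"
  shows "linear_map A M K (\<lambda>x. k (h x))"
proof -
  interpret h: linear_map A M N h by fact
  interpret k: linear_map A N K k by fact
  show ?thesis by unfold_locales simp_all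
qed

lemma linear_map_id: "left_module A M \<Longrightarrow> linear_map A M M (\<lambda>x. x)"
  by (intro linear_mapI) (assumption | rule refl)+

section \<open>Finite length and the rank of a submodule\<close>

text \<open>
  A strictly monotone \<open>r\<close> bounds the lengths of all chains of submodules. Such functions are easier
  to transfer along linear maps than composition series.
\<close>

definition finite_length :: "('a, 'm) ring_scheme \<Rightarrow> ('a, 'b) module \<Rightarrow> bool" where
  "finite_length A M \<longleftrightarrow> (\<exists>r :: 'b set \<Rightarrow> nat. \<forall>N N'.
     submodule N A M \<longrightarrow> submodule N' A M \<longrightarrow> N \<subset> N' \<longrightarrow> r N < r N')"

text \<open>Lattice form of \<open>Y / X\<close> being simple. Phrased without a quotient, it
  restricts to submodules and pulls back along surjections.\<close>

definition covers :: "('a, 'm) ring_scheme \<Rightarrow> ('a, 'b) module \<Rightarrow> 'b set \<Rightarrow> 'b set \<Rightarrow> bool" where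
  "covers A M X Y \<longleftrightarrow> submodule X A M \<and> submodule Y A M \<and> X \<subset> Y \<and>
     (\<forall>Z. submodule Z A M \<longrightarrow> X \<subseteq> Z \<longrightarrow> Z \<subseteq> Y \<longrightarrow> Z = X \<or> Z = Y)"

inductive chain_len :: "('a, 'm) ring_scheme \<Rightarrow> ('a, 'b) module \<Rightarrow> 'b set \<Rightarrow> nat \<Rightarrow> bool"
  for A M where
  zero: "chain_len A M {\<zero>\<^bsub>M\<^esub>} 0"
| step: "chain_len A M X n \<Longrightarrow> covers A M X Y \<Longrightarrow> chain_len A M Y (Suc n)"

text \<open>Length of the submodule \<open>X\<close>, read off in the lattice of the ambient module
  \<open>M\<close>, so that submodules of one module are compared in one place. By
  \<open>rank_sub\<close>, shrinking the ambient module to a submodule around \<open>X\<close>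
  changes nothing.\<close>

definition rank :: "('a, 'm) ring_scheme \<Rightarrow> ('a, 'b) module \<Rightarrow> 'b set \<Rightarrow> nat" where
  "rank A M X = (THE n. chain_len A M X n)"

lemma coversD:
  assumes "covers A M X Y"
  shows "submodule X A M" "submodule Y A M" "X \<subset> Y"
    "\<And>Z. submodule Z A M \<Longrightarrow> X \<subseteq> Z \<Longrightarrow> Z \<subseteq> Y \<Longrightarrow> Z = X \<or> Z = Y"
  using assms by (auto simp: covers_def)

lemma finite_lengthE:
  assumes "finite_length A M"
  obtains r :: "'b set \<Rightarrow> nat" where
    "\<And>N N'. submodule N A M \<Longrightarrow> submodule N' A M \<Longrightarrow> N \<subset> N' \<Longrightarrow> r N < r N'"
  using assms unfolding finite_length_def by blast

locale finite_length_module = left_module A M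
  for A :: "('a, 'm) ring_scheme" (structure) and M :: "('a, 'b) module" (structure) +
  assumes fl: "finite_length A M"

lemma finite_length_moduleI:
  "left_module A M \<Longrightarrow> finite_length A M \<Longrightarrow> finite_length_module A M"
  by (simp add: finite_length_module_def finite_length_module_axioms_def)

context finite_length_module
begin

text \<open>Among the submodules that contain \<open>N\<close> and lie properly in \<open>Y\<close>,
  one with the largest value of \<open>r\<close> is maximal; the values are bounded by
  \<open>r Y\<close>.\<close>

lemma ex_covers_below:
  assumes "submodule N A M" "submodule Y A M" "N \<subset> Y"
  shows "\<exists>L. covers A M L Y \<and> N \<subseteq> L"
proof -
  obtain r :: "'b set \<Rightarrow> nat" where
    r: "\<And>N N'. submodule N A M \<Longrightarrow> submodule N' A M \<Longrightarrow> N \<subset> N' \<Longrightarrow> r N < r N'"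
    using fl by (auto elim!: finite_lengthE)
  let ?P = "\<lambda>L. submodule L A M \<and> N \<subseteq> L \<and> L \<subset> Y"
  have "\<exists>L. ?P L \<and> (\<forall>L'. ?P L' \<longrightarrow> r L' \<le> r L)"
    by (rule ex_has_greatest_nat[of ?P N r "r Y"]) (use assms r in \<open>auto intro: less_imp_le\<close>)
  then obtain L where L: "?P L" "\<And>L'. ?P L' \<Longrightarrow> r L' \<le> r L" by blast
  have "Z = L \<or> Z = Y" if "submodule Z A M" "L \<subseteq> Z" "Z \<subseteq> Y" for Z
    using L(2)[of Z] L(1) that r[of L Z] by fastforce
  then show ?thesis using L(1) assms by (auto simp: covers_def)
qed

text \<open>The value of \<open>r\<close> drops at every cover, so descending from \<open>Y\<close>
  reaches zero. This replaces induction along a composition series.\<close>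

lemma submodule_induct [consumes 1, case_names zero covers]:
  assumes "submodule Y A M" "P {\<zero>\<^bsub>M\<^esub>}" "\<And>X Y. covers A M X Y \<Longrightarrow> P X \<Longrightarrow> P Y"
  shows "P Y"
proof -
  obtain r :: "'b set \<Rightarrow> nat" where
    r: "\<And>N N'. submodule N A M \<Longrightarrow> submodule N' A M \<Longrightarrow> N \<subset> N' \<Longrightarrow> r N < r N'"
    using fl by (auto elim!: finite_lengthE)
  show ?thesis using assms(1)
  proof (induct Y rule: measure_induct_rule[of r])
    case (less Y)
    show ?case
    proof (cases "Y = {\<zero>\<^bsub>M\<^esub>}")
      case False
      then have "{\<zero>\<^bsub>M\<^esub>} \<subset> Y" using submoduleD(3)[OF less(2)] by auto
      then obtain X where X: "covers A M X Y"
        using ex_covers_below[OF submodule_zero less(2)] by blast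
      then show ?thesis using assms(3) less r coversD by metis
    qed (use assms in simp)
  qed
qed

lemma chain_len_exists: "submodule Y A M \<Longrightarrow> \<exists>n. chain_len A M Y n"
  by (induct rule: submodule_induct) (auto intro: chain_len.intros)

end

lemma covers_sub_iff:
  assumes "left_module A M" and K: "submodule K A M"
  shows "covers A (M\<lparr>carrier := K\<rparr>) X Y \<longleftrightarrow> covers A M X Y \<and> Y \<subseteq> K"
proof -
  interpret left_module A M by fact
  show ?thesis
  proof
    assume "covers A (M\<lparr>carrier := K\<rparr>) X Y"
    note c = coversD[OF this, unfolded submodule_sub_iff[OF K]]
    have "Z = X \<or> Z = Y" if "submodule Z A M" "X \<subseteq> Z" "Z \<subseteq> Y" for Z
      using c(2) that by (intro c(4)) auto
    then show "covers A M X Y \<and> Y \<subseteq> K" using c(1-3) by (simp add: covers_def)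
  next
    assume "covers A M X Y \<and> Y \<subseteq> K"
    then have Y: "Y \<subseteq> K" and "covers A M X Y" by auto
    note c = coversD[OF this(2)]
    show "covers A (M\<lparr>carrier := K\<rparr>) X Y"
      unfolding covers_def submodule_sub_iff[OF K] using c Y by blast
  qed
qed

text \<open>The isomorphism \<open>Y1 / (Y1 \<inter> Y2) \<cong> X / Y2\<close> in lattice form. A
  \<open>Z\<close> between the intersection and \<open>Y1\<close> is tested by
  \<open>Z + Y2\<close>, which must be \<open>Y2\<close> or \<open>X\<close>, and the modular law
  recovers \<open>Z\<close>.\<close>

lemma covers_diamond:
  assumes "left_module R N" "covers R N Y1 X" "covers R N Y2 X" "Y1 \<noteq> Y2"
  shows "covers R N (Y1 \<inter> Y2) Y1"
proof -
  interpret N: left_module R N by fact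
  note c1 = coversD[OF assms(2)] and c2 = coversD[OF assms(3)]
  have not: "\<not> Y1 \<subseteq> Y2" using c1(4)[OF c2(1)] c2 assms(4) by blast
  have "Z = Y1 \<inter> Y2 \<or> Z = Y1" if Z: "submodule Z R N" "Y1 \<inter> Y2 \<subseteq> Z" "Z \<subseteq> Y1" for Z
  proof -
    have *: "Z <+>\<^bsub>N\<^esub> Y2 = Y2 \<or> Z <+>\<^bsub>N\<^esub> Y2 = X"
      using c2 c1 Z by (intro c2(4) N.submodule_set_add N.set_add_upper N.set_add_least) auto
    show ?thesis
    proof (cases "Z <+>\<^bsub>N\<^esub> Y2 = Y2")
      case True
      then show ?thesis using N.set_add_upper[OF Z(1) c2(1)] Z by auto
    next
      case False
      have "y \<in> Z" if y: "y \<in> Y1" for y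
      proof -
        have "y \<in> Z <+>\<^bsub>N\<^esub> Y2" using * False c1(3) y by auto
        then obtain z u where zu: "z \<in> Z" "u \<in> Y2" "y = z \<oplus>\<^bsub>N\<^esub> u" by (auto simp: N.set_add_iff)
        have mem: "z \<in> carrier N" "u \<in> carrier N"
          using zu N.submoduleD(2) Z(1) c2(1) by blast+
        have "u \<oplus>\<^bsub>N\<^esub> z \<in> Y1" using zu y mem by (simp add: N.M.a_comm)
        then have "u \<in> Y1" using N.submodule_add_cancel[OF c1(1) mem(2)] zu Z by blast
        then have "u \<in> Z" using zu Z by auto
        then show ?thesis using N.submoduleD(4)[OF Z(1)] zu by auto
      qed
      then show ?thesis using Z by blast
    qed
  qed
  moreover have "submodule (Y1 \<inter> Y2) R N" using c1(1) c2(1) by (rule N.submodule_Int)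
  moreover have "Y1 \<inter> Y2 \<subset> Y1" using not by blast
  ultimately show ?thesis using c1(1) by (simp add: covers_def)
qed

section \<open>Jordan-Hoelder and the rank function\<close>

context finite_length_module
begin

lemma not_covers_zero: "\<not> covers A M X {\<zero>\<^bsub>M\<^esub>}"
proof
  assume "covers A M X {\<zero>\<^bsub>M\<^esub>}"
  note c = coversD[OF this]
  from c(3) submoduleD(3)[OF c(1)] show False by auto
qed

text \<open>If two chains reach \<open>Y\<close> through different \<open>Y1\<close> and
  \<open>Y2\<close>, both are compared with a chain through \<open>Y1 \<inter> Y2\<close>, which the
  diamond makes available. The induction runs on \<open>r Y\<close>, hence applies to both
  \<open>Y1\<close> and \<open>Y2\<close>.\<close>

lemma chain_len_unique: "chain_len A M Y m \<Longrightarrow> chain_len A M Y n \<Longrightarrow> m = n"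
proof -
  obtain r :: "'b set \<Rightarrow> nat" where
    r: "\<And>N N'. submodule N A M \<Longrightarrow> submodule N' A M \<Longrightarrow> N \<subset> N' \<Longrightarrow> r N < r N'"
    using fl by (auto elim!: finite_lengthE)
  show "chain_len A M Y m \<Longrightarrow> chain_len A M Y n \<Longrightarrow> m = n"
  proof (induct Y arbitrary: m n rule: measure_induct_rule[of r])
    case (less Y)
    show ?case
    proof (cases m)
      case 0
      then have Y: "Y = {\<zero>\<^bsub>M\<^esub>}" using less(2) by (auto elim: chain_len.cases)
      show ?thesis using less(3) 0 Y not_covers_zero by (auto elim: chain_len.cases)
    next
      case (Suc m')
      then obtain Y1 where Y1: "chain_len A M Y1 m'" "covers A M Y1 Y"
        using less(2) by (auto elim: chain_len.cases)
      then have "Y \<noteq> {\<zero>\<^bsub>M\<^esub>}" using not_covers_zero by auto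
      then obtain Y2 n' where Y2: "chain_len A M Y2 n'" "covers A M Y2 Y" "n = Suc n'"
        using chain_len.cases[OF less(3)] by metis
      have lt: "r Y1 < r Y" "r Y2 < r Y" using r coversD Y1(2) Y2(2) by metis+
      show ?thesis
      proof (cases "Y1 = Y2")
        case True
        then show ?thesis using less(1)[OF lt(1)] Y1 Y2 Suc by auto
      next
        case False
        note c1 = covers_diamond[OF left_module_axioms Y1(2) Y2(2) False]
          and c2 = covers_diamond[OF left_module_axioms Y2(2) Y1(2) False[symmetric]]
        obtain k where k: "chain_len A M (Y1 \<inter> Y2) k"
          using chain_len_exists coversD(1)[OF c1] by blast
        have "chain_len A M Y1 (Suc k)" "chain_len A M Y2 (Suc k)"
          using chain_len.step[OF k c1] chain_len.step[of A M "Y2 \<inter> Y1" k Y2] k c2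
          by (auto simp: Int_commute)
        then show ?thesis using less(1)[OF lt(1)] less(1)[OF lt(2)] Y1 Y2 Suc by blast
      qed
    qed
  qed
qed

lemma rank_eq: "chain_len A M Y n \<Longrightarrow> rank A M Y = n"
  unfolding rank_def using chain_len_unique by blast

lemma chain_len_rank: "submodule Y A M \<Longrightarrow> chain_len A M Y (rank A M Y)"
  using chain_len_exists rank_eq by metis

lemma rank_zero [simp]: "rank A M {\<zero>\<^bsub>M\<^esub>} = 0"
  by (rule rank_eq) (rule chain_len.zero)

lemma rank_covers: "covers A M X Y \<Longrightarrow> rank A M Y = Suc (rank A M X)"
  by (meson chain_len.step chain_len_rank coversD(1) rank_eq)

lemma rank_strict_mono:
  assumes "submodule X A M" "submodule Y A M" "X \<subset> Y"
  shows "rank A M X < rank A M Y"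
  using assms(2,3)
proof (induct Y rule: measure_induct_rule[of "rank A M"])
  case (less Y)
  obtain L where L: "covers A M L Y" "X \<subseteq> L"
    using ex_covers_below[OF assms(1) less(2,3)] by blast
  have "X = L \<or> rank A M X < rank A M L"
    using less(1)[of L] rank_covers[OF L(1)] coversD[OF L(1)] L(2) by auto
  then show ?case using rank_covers[OF L(1)] by auto
qed

lemma rank_mono:
  "submodule X A M \<Longrightarrow> submodule Y A M \<Longrightarrow> X \<subseteq> Y \<Longrightarrow> rank A M X \<le> rank A M Y"
  using rank_strict_mono[of X Y] psubsetI[of X Y] by (metis less_imp_le order.refl)

lemma maximal_above:
  assumes "submodule N A M" "N \<noteq> carrier M"
  shows "\<exists>L. maximal_submodule A M L \<and> N \<subseteq> L"
proof -
  have "N \<subset> carrier M" using assms submoduleD by blast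
  from ex_covers_below[OF assms(1) submodule_carrier this] obtain L
    where L: "covers A M L (carrier M)" "N \<subseteq> L" by blast
  then have "maximal_submodule A M L"
    using coversD[OF L(1)] submoduleD(1) by (auto simp: maximal_submodule_def)
  then show ?thesis using L by blast
qed

lemma finite_length_sub: "submodule K A M \<Longrightarrow> finite_length A (M\<lparr>carrier := K\<rparr>)"
proof -
  assume K: "submodule K A M"
  obtain r :: "'b set \<Rightarrow> nat" where
    r: "\<And>N N'. submodule N A M \<Longrightarrow> submodule N' A M \<Longrightarrow> N \<subset> N' \<Longrightarrow> r N < r N'"
    using fl by (auto elim!: finite_lengthE)
  show ?thesis
    unfolding finite_length_def submodule_sub_iff[OF K] by (rule exI[of _ r]) (simp add: r)
qed

lemma finite_length_module_sub:
  "submodule K A M \<Longrightarrow> finite_length_module A (M\<lparr>carrier := K\<rparr>)"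
  by (intro finite_length_moduleI left_module_sub finite_length_sub)

lemma rank_sub:
  assumes "submodule K A M" "submodule X A M" "X \<subseteq> K"
  shows "rank A (M\<lparr>carrier := K\<rparr>) X = rank A M X"
proof -
  interpret K: finite_length_module A "M\<lparr>carrier := K\<rparr>"
    by (rule finite_length_module_sub[OF assms(1)])
  have "chain_len A M Y n" if "chain_len A (M\<lparr>carrier := K\<rparr>) Y n" for Y n
    using that by induct (auto intro: chain_len.intros[of A M, simplified] simp: covers_sub_iff[OF left_module_axioms assms(1)])
  moreover have "chain_len A (M\<lparr>carrier := K\<rparr>) X (rank A (M\<lparr>carrier := K\<rparr>) X)"
    using assms by (intro K.chain_len_rank) (simp add: submodule_sub_iff)
  ultimately show ?thesis using rank_eq by metis
qed

end

text \<open>A submodule above the preimage of \<open>X\<close> contains the kernel, so it is the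
  preimage of its own image, and that image lies between \<open>X\<close> and
  \<open>Y\<close>.\<close>

lemma (in linear_map) covers_vimage:
  assumes surj: "h ` carrier M = carrier N" and cov: "covers A N X Y"
  shows "covers A M {x \<in> carrier M. h x \<in> X} {x \<in> carrier M. h x \<in> Y}"
proof -
  note c = coversD[OF cov]
  obtain y where y: "y \<in> Y" "y \<notin> X" using c by auto
  moreover have "y \<in> carrier N" using y c cod.submoduleD by blast
  ultimately obtain x where x: "x \<in> carrier M" "h x \<in> Y" "h x \<notin> X" using surj by (metis imageE)
  have "Z = {x \<in> carrier M. h x \<in> X} \<or> Z = {x \<in> carrier M. h x \<in> Y}"
    if Z: "submodule Z A M" "{x \<in> carrier M. h x \<in> X} \<subseteq> Z" "Z \<subseteq> {x \<in> carrier M. h x \<in> Y}" for Z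
  proof -
    have "z \<in> Z" if z: "z \<in> carrier M" "h z \<in> h ` Z" for z
    proof -
      obtain u where u: "u \<in> Z" "h u = h z" using z by auto
      then have uc: "u \<in> carrier M" using Z by auto
      have "h (z \<ominus>\<^bsub>M\<^esub> u) = \<zero>\<^bsub>N\<^esub>" using u uc z by (simp add: minus cod.minus_eq_zero_iff)
      then have "z \<ominus>\<^bsub>M\<^esub> u \<in> Z" using Z(2) cod.submoduleD(3)[OF c(1)] uc z by auto
      then have "(z \<ominus>\<^bsub>M\<^esub> u) \<oplus>\<^bsub>M\<^esub> u \<in> Z" using u dom.submoduleD(4)[OF Z(1)] by blast
      then show ?thesis using uc z by simp
    qed
    then have eq: "Z = {x \<in> carrier M. h x \<in> h ` Z}" using dom.submoduleD[OF Z(1)] by auto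
    have "X \<subseteq> h ` Z"
    proof
      fix w assume w: "w \<in> X"
      then have "w \<in> carrier N" using cod.submoduleD[OF c(1)] by blast
      then obtain v where "v \<in> carrier M" "w = h v" using surj by (metis imageE)
      then show "w \<in> h ` Z" using w Z by auto
    qed
    moreover have "h ` Z \<subseteq> Y" using Z by auto
    ultimately have "h ` Z = X \<or> h ` Z = Y" using c(4)[OF submodule_image[OF Z(1)]] by blast
    then show ?thesis using eq by auto
  qed
  then show ?thesis
    using c x submodule_vimage by (auto simp: covers_def)
qed

lemma (in linear_map) covers_of_vimage:
  assumes surj: "h ` carrier M = carrier N"
    and sub: "submodule X A N" "submodule Y A N"
    and cov: "covers A M {x \<in> carrier M. h x \<in> X} {x \<in> carrier M. h x \<in> Y}"
  shows "covers A N X Y"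
proof -
  note c = coversD[OF cov]
  have img: "W = h ` {x \<in> carrier M. h x \<in> W}" if "submodule W A N" for W
  proof
    show "W \<subseteq> h ` {x \<in> carrier M. h x \<in> W}"
    proof
      fix w assume w: "w \<in> W"
      then have "w \<in> h ` carrier M" using surj cod.submoduleD[OF that] by auto
      then show "w \<in> h ` {x \<in> carrier M. h x \<in> W}" using w by auto
    qed
  qed auto
  have "X \<subseteq> Y"
  proof
    fix x assume "x \<in> X"
    then have "x \<in> h ` {x \<in> carrier M. h x \<in> X}" using img[OF sub(1)] by blast
    then show "x \<in> Y" using c(3) by auto
  qed
  then have "X \<subset> Y" using c(3) by auto
  moreover have "Z = X \<or> Z = Y" if Z: "submodule Z A N" "X \<subseteq> Z" "Z \<subseteq> Y" for Z
  proof -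
    have "{x \<in> carrier M. h x \<in> Z} = {x \<in> carrier M. h x \<in> X} \<or>
        {x \<in> carrier M. h x \<in> Z} = {x \<in> carrier M. h x \<in> Y}"
      using Z by (intro c(4) submodule_vimage) auto
    then show ?thesis
    proof
      assume "{x \<in> carrier M. h x \<in> Z} = {x \<in> carrier M. h x \<in> X}"
      then show ?thesis using img[OF sub(1)] img[OF Z(1)] by simp
    next
      assume "{x \<in> carrier M. h x \<in> Z} = {x \<in> carrier M. h x \<in> Y}"
      then show ?thesis using img[OF sub(2)] img[OF Z(1)] by simp
    qed
  qed
  ultimately show ?thesis using sub by (simp add: covers_def)
qed

lemma (in linear_map) finite_length_surj:
  assumes "h ` carrier M = carrier N" "finite_length A M"
  shows "finite_length A N"
proof -
  obtain r :: "'b set \<Rightarrow> nat" where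
    r: "\<And>N N'. submodule N A M \<Longrightarrow> submodule N' A M \<Longrightarrow> N \<subset> N' \<Longrightarrow> r N < r N'"
    using assms by (auto elim!: finite_lengthE)
  have "r {x \<in> carrier M. h x \<in> X} < r {x \<in> carrier M. h x \<in> Y}"
    if XY: "submodule X A N" "submodule Y A N" "X \<subset> Y" for X Y
  proof (intro r submodule_vimage XY(1,2))
    obtain y where y: "y \<in> Y" "y \<notin> X" using XY by auto
    then have "y \<in> h ` carrier M" using assms cod.submoduleD[OF XY(2)] by blast
    then show "{x \<in> carrier M. h x \<in> X} \<subset> {x \<in> carrier M. h x \<in> Y}" using y XY by auto
  qed
  then show ?thesis unfolding finite_length_def
    by (intro exI[of _ "\<lambda>X. r {x \<in> carrier M. h x \<in> X}"]) auto
qed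

text \<open>Pulling back a chain from zero to \<open>X\<close> gives, cover by cover, a chain from
  the kernel to the preimage of \<open>X\<close>.\<close>

lemma (in linear_map) rank_vimage:
  assumes surj: "h ` carrier M = carrier N" and fl: "finite_length A M" and X: "submodule X A N"
  shows "rank A M {x \<in> carrier M. h x \<in> X} = rank A M (a_kernel M N h) + rank A N X"
proof -
  interpret M: finite_length_module A M by unfold_locales (rule fl)
  interpret N: finite_length_module A N by unfold_locales (rule finite_length_surj[OF surj fl])
  have "rank A M {x \<in> carrier M. h x \<in> Y} = rank A M (a_kernel M N h) + n" if "chain_len A N Y n" for Y n
    using that
  proof induct
    case zero
    then show ?case by (simp add: kernel_eq)
  next
    case (step X n Y)
    then show ?case using M.rank_covers[OF covers_vimage[OF surj step(3)]] by simp
  qed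
  then show ?thesis using N.chain_len_rank[OF X] by blast
qed

lemma (in linear_map) rank_surj:
  assumes "h ` carrier M = carrier N" "finite_length A M"
  shows "rank A M (carrier M) = rank A M (a_kernel M N h) + rank A N (carrier N)"
proof -
  have "{x \<in> carrier M. h x \<in> carrier N} = carrier M" by auto
  then show ?thesis using rank_vimage[OF assms cod.submodule_carrier] by simp
qed

text \<open>For \<open>X \<subset> Y\<close> the intersections with the kernel and the images cannot
  both agree: if \<open>h y = h x\<close>, then \<open>y - x\<close> lies in the kernel and in
  \<open>Y\<close>, hence would lie in \<open>X\<close>. So the sum of the two given functions is
  strictly monotone.\<close>

lemma (in linear_map) finite_length_extension:
  assumes "finite_length A (M\<lparr>carrier := a_kernel M N h\<rparr>)" "finite_length A N"
  shows "finite_length A M"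
proof -
  let ?K = "a_kernel M N h"
  obtain r :: "'b set \<Rightarrow> nat" where
    r: "\<And>N N'. submodule N A (M\<lparr>carrier := ?K\<rparr>) \<Longrightarrow> submodule N' A (M\<lparr>carrier := ?K\<rparr>) \<Longrightarrow> N \<subset> N' \<Longrightarrow> r N < r N'"
    using assms(1) by (auto elim!: finite_lengthE)
  obtain r' :: "'c set \<Rightarrow> nat" where
    r': "\<And>X X'. submodule X A N \<Longrightarrow> submodule X' A N \<Longrightarrow> X \<subset> X' \<Longrightarrow> r' X < r' X'"
    using assms(2) by (auto elim!: finite_lengthE)
  have "r (X \<inter> ?K) + r' (h ` X) < r (Y \<inter> ?K) + r' (h ` Y)"
    if XY: "submodule X A M" "submodule Y A M" "X \<subset> Y" for X Y
  proof -
    have 1: "X \<inter> ?K = Y \<inter> ?K \<or> r (X \<inter> ?K) < r (Y \<inter> ?K)"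
    proof (cases "X \<inter> ?K = Y \<inter> ?K")
      case False
      then show ?thesis using XY
        by (intro disjI2 r) (auto simp: dom.submodule_sub_iff submodule_kernel dom.submodule_Int)
    qed simp
    have 2: "h ` X = h ` Y \<or> r' (h ` X) < r' (h ` Y)"
    proof (cases "h ` X = h ` Y")
      case False
      then show ?thesis using XY
        by (intro disjI2 r' submodule_image) auto
    qed simp
    have "\<not> (X \<inter> ?K = Y \<inter> ?K \<and> h ` X = h ` Y)"
    proof
      assume eq: "X \<inter> ?K = Y \<inter> ?K \<and> h ` X = h ` Y"
      obtain y where y: "y \<in> Y" "y \<notin> X" using XY by auto
      then have "h y \<in> h ` X" using eq by auto
      then obtain x where x: "x \<in> X" "h x = h y" by auto
      have c: "x \<in> carrier M" "y \<in> carrier M" using x y XY dom.submoduleD by blast+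
      have "y \<ominus>\<^bsub>M\<^esub> x \<in> Y" using XY x y by (intro dom.submodule_minus) auto
      moreover have "h (y \<ominus>\<^bsub>M\<^esub> x) = \<zero>\<^bsub>N\<^esub>" using x c by (simp add: minus cod.minus_eq_zero_iff)
      ultimately have "y \<ominus>\<^bsub>M\<^esub> x \<in> X" using eq c by (auto simp: kernel_eq)
      then have "(y \<ominus>\<^bsub>M\<^esub> x) \<oplus>\<^bsub>M\<^esub> x \<in> X" using x dom.submoduleD(4)[OF XY(1)] by blast
      then show False using c y by simp
    qed
    then show ?thesis using 1 2 by auto
  qed
  then show ?thesis unfolding finite_length_def
    by (intro exI[of _ "\<lambda>X. r (X \<inter> ?K) + r' (h ` X)"]) auto
qed

lemma (in linear_map) finite_length_inj:
  assumes "inj_on h (carrier M)" "finite_length A N"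
  shows "finite_length A M"
proof -
  obtain r' :: "'c set \<Rightarrow> nat" where
    r': "\<And>X X'. submodule X A N \<Longrightarrow> submodule X' A N \<Longrightarrow> X \<subset> X' \<Longrightarrow> r' X < r' X'"
    using assms(2) by (auto elim!: finite_lengthE)
  have "r' (h ` X) < r' (h ` Y)" if XY: "submodule X A M" "submodule Y A M" "X \<subset> Y" for X Y
  proof (intro r' submodule_image XY(1,2) psubsetI)
    show "h ` X \<noteq> h ` Y"
      using inj_on_image_eq_iff[OF assms(1)] XY dom.submoduleD(1) by blast
  qed (use XY in auto)
  then show ?thesis unfolding finite_length_def by (intro exI[of _ "\<lambda>X. r' (h ` X)"]) auto
qed

section \<open>Quotients and composition length\<close>

locale quotient_module = left_module A M
  for A :: "('a, 'm) ring_scheme" (structure) and M :: "('a, 'b) module" (structure) +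
  fixes N :: "'b set"
  assumes sub: "submodule N A M"
begin

sublocale N: abelian_subgroup N M
  by (rule additive_subgroup_submodule[OF sub])

abbreviation coset :: "'b \<Rightarrow> 'b set" where
  "coset x \<equiv> N +>\<^bsub>M\<^esub> x"

lemma coset_eq_iff:
  assumes "x \<in> carrier M" "y \<in> carrier M"
  shows "coset x = coset y \<longleftrightarrow> x \<ominus>\<^bsub>M\<^esub> y \<in> N"
proof
  assume "coset x = coset y"
  then have "x \<in> coset y" using N.a_rcos_self[OF assms(1)] by simp
  then obtain n where n: "n \<in> N" "x = n \<oplus>\<^bsub>M\<^esub> y" by (auto simp: a_r_coset_def')
  then show "x \<ominus>\<^bsub>M\<^esub> y \<in> N" using submoduleD(2)[OF sub n(1)] assms by simp
next
  assume "x \<ominus>\<^bsub>M\<^esub> y \<in> N"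
  moreover have "x = (x \<ominus>\<^bsub>M\<^esub> y) \<oplus>\<^bsub>M\<^esub> y" using assms by simp
  ultimately have "x \<in> coset y" unfolding a_r_coset_def' by blast
  then show "coset x = coset y" using M.a_repr_independence[OF _ assms(2) N.a_subgroup] by simp
qed

lemma carrier_quot: "carrier (quot_mod M N) = coset ` carrier M"
  by (auto simp: quot_mod_def A_RCOSETS_def')

lemma zero_quot: "\<zero>\<^bsub>quot_mod M N\<^esub> = N"
  by (simp add: quot_mod_def)

lemma coset_eq_zero_iff: "x \<in> carrier M \<Longrightarrow> coset x = N \<longleftrightarrow> x \<in> N"
  using coset_eq_iff[of x "\<zero>\<^bsub>M\<^esub>"] submoduleD(1)[OF sub] by simp

lemma add_quot:
  "x \<in> carrier M \<Longrightarrow> y \<in> carrier M \<Longrightarrow> coset x \<oplus>\<^bsub>quot_mod M N\<^esub> coset y = coset (x \<oplus>\<^bsub>M\<^esub> y)"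
  by (simp add: quot_mod_def N.a_rcos_sum)

lemma smult_quot:
  assumes "a \<in> carrier A" "x \<in> carrier M"
  shows "a \<odot>\<^bsub>quot_mod M N\<^esub> coset x = coset (a \<odot>\<^bsub>M\<^esub> x)"
proof -
  have "coset (a \<odot>\<^bsub>M\<^esub> z) = coset (a \<odot>\<^bsub>M\<^esub> x)" if z: "z \<in> coset x" for z
  proof -
    obtain n where n: "n \<in> N" "z = n \<oplus>\<^bsub>M\<^esub> x" using z by (auto simp: a_r_coset_def')
    have nc: "n \<in> carrier M" using n submoduleD(2)[OF sub] by blast
    have "a \<odot>\<^bsub>M\<^esub> z \<ominus>\<^bsub>M\<^esub> a \<odot>\<^bsub>M\<^esub> x = a \<odot>\<^bsub>M\<^esub> n"
      using assms nc by (simp add: n(2) smult_r_distr)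
    then show ?thesis
      using n nc assms submoduleD(5)[OF sub] by (simp add: coset_eq_iff n(2))
  qed
  moreover have "x \<in> coset x" by (rule N.a_rcos_self[OF assms(2)])
  ultimately have "(\<Union>z\<in>coset x. coset (a \<odot>\<^bsub>M\<^esub> z)) = coset (a \<odot>\<^bsub>M\<^esub> x)" by blast
  then show ?thesis by (simp add: quot_mod_def)
qed

lemma left_module_quot: "left_module A (quot_mod M N)"
proof -
  have z: "\<zero>\<^bsub>quot_mod M N\<^esub> = coset \<zero>\<^bsub>M\<^esub>"
    using coset_eq_zero_iff[of "\<zero>\<^bsub>M\<^esub>"] submoduleD(3)[OF sub] by (simp add: zero_quot)
  have "abelian_group (quot_mod M N)"
  proof (rule abelian_groupI)
    show "\<zero>\<^bsub>quot_mod M N\<^esub> \<in> carrier (quot_mod M N)"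
      unfolding z carrier_quot by blast
  next
    fix X assume "X \<in> carrier (quot_mod M N)"
    then obtain x where x: "x \<in> carrier M" "X = coset x" unfolding carrier_quot by auto
    then have "coset (\<ominus>\<^bsub>M\<^esub> x) \<oplus>\<^bsub>quot_mod M N\<^esub> X = \<zero>\<^bsub>quot_mod M N\<^esub>"
      unfolding z by (simp add: add_quot M.l_neg)
    then show "\<exists>Y\<in>carrier (quot_mod M N). Y \<oplus>\<^bsub>quot_mod M N\<^esub> X = \<zero>\<^bsub>quot_mod M N\<^esub>"
      unfolding carrier_quot using x by blast
  qed (auto simp: carrier_quot add_quot z M.a_ac)
  then show ?thesis
    by (intro left_moduleI R.ring_axioms)
      (auto simp: carrier_quot add_quot smult_quot smult_l_distr smult_r_distr smult_assoc1)
qed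

lemma linear_map_coset: "linear_map A M (quot_mod M N) coset"
  by (intro linear_mapI left_module_axioms left_module_quot)
    (auto simp: carrier_quot add_quot smult_quot)

lemma kernel_coset: "a_kernel M (quot_mod M N) coset = N"
  unfolding a_kernel_def' zero_quot using submoduleD(1)[OF sub] coset_eq_zero_iff by blast

end

lemma quotient_moduleI: "left_module A M \<Longrightarrow> submodule N A M \<Longrightarrow> quotient_module A M N"
  by (simp add: quotient_module_def quotient_module_axioms_def)

lemma simple_module_iff_covers:
  assumes "left_module A M"
  shows "simple_module A M \<longleftrightarrow> covers A M {\<zero>\<^bsub>M\<^esub>} (carrier M)"
proof -
  interpret left_module A M by fact
  have "{\<zero>\<^bsub>M\<^esub>} \<subset> carrier M \<longleftrightarrow> carrier M \<noteq> {\<zero>\<^bsub>M\<^esub>}" by auto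
  moreover have "(\<forall>N. submodule N A M \<longrightarrow> N = {\<zero>\<^bsub>M\<^esub>} \<or> N = carrier M) \<longleftrightarrow>
    (\<forall>N. submodule N A M \<longrightarrow> {\<zero>\<^bsub>M\<^esub>} \<subseteq> N \<longrightarrow> N \<subseteq> carrier M \<longrightarrow> N = {\<zero>\<^bsub>M\<^esub>} \<or> N = carrier M)"
    using submoduleD(1,3) by simp
  ultimately show ?thesis
    by (simp add: simple_module_def covers_def assms submodule_zero submodule_carrier)
qed

lemma (in quotient_module) simple_module_quot_iff:
  "simple_module A (quot_mod M N) \<longleftrightarrow> covers A M N (carrier M)"
proof -
  interpret c: linear_map A M "quot_mod M N" coset by (rule linear_map_coset)
  have surj: "coset ` carrier M = carrier (quot_mod M N)" by (simp add: carrier_quot)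
  have 1: "{x \<in> carrier M. coset x \<in> {\<zero>\<^bsub>quot_mod M N\<^esub>}} = N"
    using kernel_coset by (simp add: c.kernel_eq)
  have 2: "{x \<in> carrier M. coset x \<in> carrier (quot_mod M N)} = carrier M" by auto
  show ?thesis
    using c.covers_vimage[OF surj, of "{\<zero>\<^bsub>quot_mod M N\<^esub>}" "carrier (quot_mod M N)"]
      c.covers_of_vimage[OF surj c.cod.submodule_zero c.cod.submodule_carrier]
    unfolding 1 2 simple_module_iff_covers[OF left_module_quot] by blast
qed

lemma simple_module_sub_quot_iff:
  assumes "left_module A M" "submodule X A M" "submodule Y A M" "X \<subseteq> Y"
  shows "simple_module A (quot_mod (M\<lparr>carrier := Y\<rparr>) X) \<longleftrightarrow> covers A M X Y"
proof -
  interpret M: left_module A M by fact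
  interpret Y: left_module A "M\<lparr>carrier := Y\<rparr>" by (rule M.left_module_sub[OF assms(3)])
  interpret quotient_module A "M\<lparr>carrier := Y\<rparr>" X
    by (rule quotient_moduleI) (simp_all add: M.submodule_sub_iff[OF assms(3)] assms Y.left_module_axioms)
  show ?thesis
    using simple_module_quot_iff by (simp add: covers_sub_iff[OF assms(1,3)])
qed

text \<open>Turns simplicity of the quotients into covers, so that a composition series can be
  matched against \<open>chain_len\<close>.\<close>

lemma composition_series_iff:
  assumes "left_module A M"
  shows "composition_series A M F n \<longleftrightarrow> F 0 = {\<zero>\<^bsub>M\<^esub>} \<and> F n = carrier M \<and>
    (\<forall>i\<le>n. submodule (F i) A M) \<and> (\<forall>i<n. covers A M (F i) (F (Suc i)))"
proof -
  have "F i \<subseteq> F (Suc i) \<and> simple_module A (quot_mod (M\<lparr>carrier := F (Suc i)\<rparr>) (F i)) \<longleftrightarrow>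
      covers A M (F i) (F (Suc i))" if "\<forall>i\<le>n. submodule (F i) A M" "i < n" for i
  proof (cases "F i \<subseteq> F (Suc i)")
    case True
    then show ?thesis using simple_module_sub_quot_iff[OF assms, of "F i" "F (Suc i)"] that by simp
  qed (auto simp: covers_def)
  then have "(\<forall>i<n. F i \<subseteq> F (Suc i) \<and> simple_module A (quot_mod (M\<lparr>carrier := F (Suc i)\<rparr>) (F i))) \<longleftrightarrow>
      (\<forall>i<n. covers A M (F i) (F (Suc i)))" if "\<forall>i\<le>n. submodule (F i) A M"
    using that by simp
  then show ?thesis unfolding composition_series_def by (intro conj_cong refl)
qed

context finite_length_module
begin

lemma composition_series_rank:
  assumes "composition_series A M F n"
  shows "n = rank A M (carrier M)"
proof -
  note c = assms[unfolded composition_series_iff[OF left_module_axioms]]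
  have "chain_len A M (F i) i" if "i \<le> n" for i
    using that
  proof (induct i)
    case 0
    show ?case using c chain_len.zero[of A M] by simp
  next
    case (Suc i)
    then show ?case using c by (intro chain_len.step[of A M "F i"]) auto
  qed
  from this[of n] have "chain_len A M (carrier M) n" using c by simp
  then show ?thesis using rank_eq by simp
qed

lemma composition_series_exists: "\<exists>F. composition_series A M F (rank A M (carrier M))"
proof -
  have "\<exists>F. F 0 = {\<zero>\<^bsub>M\<^esub>} \<and> F n = Y \<and> (\<forall>i\<le>n. submodule (F i) A M) \<and>
      (\<forall>i<n. covers A M (F i) (F (Suc i)))" if "chain_len A M Y n" for Y n
    using that
  proof induct
    case zero
    show ?case by (rule exI[of _ "\<lambda>_. {\<zero>\<^bsub>M\<^esub>}"]) (simp add: submodule_zero)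
  next
    case (step X n Y)
    then obtain F where F: "F 0 = {\<zero>\<^bsub>M\<^esub>}" "F n = X" "\<forall>i\<le>n. submodule (F i) A M"
      "\<forall>i<n. covers A M (F i) (F (Suc i))" by blast
    show ?case
      using F step(3) coversD(2)[OF step(3)]
      by (intro exI[of _ "F(Suc n := Y)"]) (auto simp: le_Suc_eq less_Suc_eq)
  qed
  from this[OF chain_len_rank[OF submodule_carrier]]
  show ?thesis by (simp add: composition_series_iff[OF left_module_axioms])
qed

text \<open>A series exists, and every series has \<open>rank\<close> many steps; this gives meaning
  to the definite description in \<open>comp_length\<close>. From here on lengths are ranks.\<close>

lemma comp_length_eq: "comp_length A M = rank A M (carrier M)"
  unfolding comp_length_def
  using composition_series_exists composition_series_rank by (intro the_equality) auto

lemma comp_length_quot_sub: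
  assumes "submodule X A M" "submodule Y A M" "X \<subseteq> Y"
  shows "rank A M Y = rank A M X + comp_length A (quot_mod (M\<lparr>carrier := Y\<rparr>) X)"
    and "finite_length A (quot_mod (M\<lparr>carrier := Y\<rparr>) X)"
proof -
  interpret Y: finite_length_module A "M\<lparr>carrier := Y\<rparr>"
    by (rule finite_length_module_sub[OF assms(2)])
  interpret Q: quotient_module A "M\<lparr>carrier := Y\<rparr>" X
    by (rule quotient_moduleI) (simp_all add: submodule_sub_iff[OF assms(2)] assms Y.left_module_axioms)
  interpret c: linear_map A "M\<lparr>carrier := Y\<rparr>" "quot_mod (M\<lparr>carrier := Y\<rparr>) X" Q.coset
    by (rule Q.linear_map_coset)
  have surj: "Q.coset ` carrier (M\<lparr>carrier := Y\<rparr>) = carrier (quot_mod (M\<lparr>carrier := Y\<rparr>) X)"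
    by (simp add: Q.carrier_quot)
  show fl: "finite_length A (quot_mod (M\<lparr>carrier := Y\<rparr>) X)"
    by (rule c.finite_length_surj[OF surj Y.fl])
  interpret R: finite_length_module A "quot_mod (M\<lparr>carrier := Y\<rparr>) X"
    by unfold_locales (rule fl)
  show "rank A M Y = rank A M X + comp_length A (quot_mod (M\<lparr>carrier := Y\<rparr>) X)"
    using c.rank_surj[OF surj Y.fl] rank_sub[OF assms(2)] assms
    by (simp add: R.comp_length_eq Q.kernel_coset)
qed

lemma comp_length_quot:
  assumes "submodule X A M"
  shows "rank A M (carrier M) = rank A M X + comp_length A (quot_mod M X)"
    and "finite_length A (quot_mod M X)"
  using comp_length_quot_sub[OF assms submodule_carrier submoduleD(1)[OF assms]] by simp_all

end

lemma regular_simps [simp]: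
  "carrier (regular A) = carrier A" "\<zero>\<^bsub>regular A\<^esub> = \<zero>\<^bsub>A\<^esub>" "(\<oplus>\<^bsub>regular A\<^esub>) = (\<oplus>\<^bsub>A\<^esub>)"
  "(\<odot>\<^bsub>regular A\<^esub>) = (\<otimes>\<^bsub>A\<^esub>)"
  by (simp_all add: regular_def)

lemma op_ring_simps [simp]:
  "carrier (op_ring A) = carrier A" "\<zero>\<^bsub>op_ring A\<^esub> = \<zero>\<^bsub>A\<^esub>" "\<one>\<^bsub>op_ring A\<^esub> = \<one>\<^bsub>A\<^esub>"
  "x \<oplus>\<^bsub>op_ring A\<^esub> y = x \<oplus>\<^bsub>A\<^esub> y" "x \<otimes>\<^bsub>op_ring A\<^esub> y = y \<otimes>\<^bsub>A\<^esub> x"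
  by (simp_all add: op_ring_def)

lemma ring_op_ring: "ring A \<Longrightarrow> ring (op_ring A)"
proof -
  assume "ring A"
  then interpret ring A .
  show ?thesis
  proof (rule ringI)
    show "abelian_group (op_ring A)"
    proof (rule abelian_groupI)
      fix x assume "x \<in> carrier (op_ring A)"
      then show "\<exists>y\<in>carrier (op_ring A). y \<oplus>\<^bsub>op_ring A\<^esub> x = \<zero>\<^bsub>op_ring A\<^esub>"
        by (auto intro: bexI[of _ "\<ominus>\<^bsub>A\<^esub> x"] simp: l_neg)
    qed (auto simp: a_ac)
    show "monoid (op_ring A)" by (rule monoidI) (auto simp: m_assoc)
  qed (auto simp: l_distr r_distr)
qed

lemma a_inv_regular [simp]: "ring A \<Longrightarrow> x \<in> carrier A \<Longrightarrow> \<ominus>\<^bsub>regular A\<^esub> x = \<ominus>\<^bsub>A\<^esub> x"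
  by (simp add: a_inv_def m_inv_def)

lemma a_minus_regular [simp]:
  "ring A \<Longrightarrow> x \<in> carrier A \<Longrightarrow> y \<in> carrier A \<Longrightarrow> x \<ominus>\<^bsub>regular A\<^esub> y = x \<ominus>\<^bsub>A\<^esub> y"
  by (simp add: a_minus_def)

lemma a_inv_op_ring [simp]: "\<ominus>\<^bsub>op_ring A\<^esub> x = \<ominus>\<^bsub>A\<^esub> x"
  by (simp add: a_inv_def m_inv_def op_ring_def)

lemma a_minus_op_ring [simp]: "x \<ominus>\<^bsub>op_ring A\<^esub> y = x \<ominus>\<^bsub>A\<^esub> y"
  by (simp add: a_minus_def)

section \<open>The Jacobson radical\<close>

context finite_length_module
begin

lemma descending_stable:
  assumes "\<And>i. submodule (D i) A M" "\<And>i. D (Suc i) \<subseteq> D i"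
  shows "\<exists>k::nat. \<forall>m\<ge>k. D m = D k"
proof -
  obtain k where k: "\<And>m. rank A M (D k) \<le> rank A M (D m)"
    using ex_has_least_nat[of "\<lambda>_. True" 0 "\<lambda>k. rank A M (D k)"] by auto
  have sub: "D m \<subseteq> D k" if "k \<le> m" for m
    using lift_Suc_antimono_le[of D, OF assms(2) that] .
  show ?thesis using k sub rank_strict_mono[OF assms(1,1)] by (metis linorder_not_le psubsetI)
qed

lemma ascending_stable:
  assumes "\<And>i. submodule (D i) A M" "\<And>i. D i \<subseteq> D (Suc i)"
  shows "\<exists>k::nat. \<forall>m\<ge>k. D m = D k"
proof -
  have bd: "rank A M (D m) < Suc (rank A M (carrier M))" for m
    using rank_mono[OF assms(1) submodule_carrier submoduleD(1)[OF assms(1)]] by (simp add: less_Suc_eq_le)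
  obtain k where k: "\<And>m. rank A M (D m) \<le> rank A M (D k)"
    using ex_has_greatest_nat[of "\<lambda>_. True" 0 "\<lambda>k. rank A M (D k)"] bd by blast
  have sub: "D k \<subseteq> D m" if "k \<le> m" for m
    using lift_Suc_mono_le[of D, OF assms(2) that] .
  show ?thesis using k sub rank_strict_mono[OF assms(1,1)] by (metis linorder_not_le psubsetI)
qed

text \<open>A proper \<open>N\<close> would lie in some maximal submodule \<open>L\<close>, and
  \<open>x - n\<close> and \<open>n\<close> in \<open>L\<close> would force all of \<open>M\<close>
  into \<open>L\<close>. Congruence modulo every maximal submodule stands in for congruence modulo
  \<open>J M\<close>, which never has to be formed.\<close>

lemma nakayama:
  assumes "submodule N A M"
    and "\<And>x. x \<in> carrier M \<Longrightarrow> \<exists>n\<in>N. \<forall>L. maximal_submodule A M L \<longrightarrow> x \<ominus>\<^bsub>M\<^esub> n \<in> L"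
  shows "N = carrier M"
proof (rule ccontr)
  assume "N \<noteq> carrier M"
  then obtain L where L: "maximal_submodule A M L" "N \<subseteq> L"
    using maximal_above[OF assms(1)] by blast
  then have subL: "submodule L A M" and ne: "L \<noteq> carrier M" by (auto simp: maximal_submodule_def)
  have "x \<in> L" if x: "x \<in> carrier M" for x
  proof -
    obtain n where n: "n \<in> N" "x \<ominus>\<^bsub>M\<^esub> n \<in> L" using assms(2)[OF x] L by blast
    then have "(x \<ominus>\<^bsub>M\<^esub> n) \<oplus>\<^bsub>M\<^esub> n \<in> L" using submoduleD(4)[OF subL] L by blast
    then show ?thesis using x n submoduleD(2)[OF assms(1)] by simp
  qed
  then show False using ne submoduleD(1)[OF subL] by auto
qed

end

lemma (in left_module) quotient_ideal:
  assumes "submodule L R M" "x \<in> carrier M"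
  shows "submodule {a \<in> carrier R. a \<odot>\<^bsub>M\<^esub> x \<in> L} R (regular R)"
proof -
  interpret reg: left_module R "regular R" by (rule left_module_regular[OF R.ring_axioms])
  show ?thesis
    using assms(2) submoduleD[OF assms(1)]
    by (intro reg.submoduleI) (auto simp: smult_l_distr smult_assoc1)
qed

text \<open>The left ideal is the kernel of the map \<open>a \<mapsto> a x\<close> onto the simple
  module \<open>M / L\<close>. In elements: if \<open>n x\<close> is not in \<open>L\<close>, every
  \<open>a x\<close> has the form \<open>l + c n x\<close>, so \<open>a - c n\<close> lies in the
  ideal.\<close>

lemma maximal_submodule_quotient_ideal:
  assumes "left_module A M" "maximal_submodule A M L" "x \<in> carrier M" "x \<notin> L"
  shows "maximal_submodule A (regular A) {a \<in> carrier A. a \<odot>\<^bsub>M\<^esub> x \<in> L}"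
proof -
  interpret left_module A M by fact
  interpret reg: left_module A "regular A" by (rule left_module_regular[OF R.ring_axioms])
  let ?I = "{a \<in> carrier A. a \<odot>\<^bsub>M\<^esub> x \<in> L}"
  have L: "submodule L A M" "\<And>N. submodule N A M \<Longrightarrow> L \<subseteq> N \<Longrightarrow> N = L \<or> N = carrier M"
    using assms(2) by (auto simp: maximal_submodule_def)
  have I: "submodule ?I A (regular A)" by (rule quotient_ideal[OF L(1) assms(3)])
  have "N = ?I \<or> N = carrier (regular A)" if N: "submodule N A (regular A)" "?I \<subseteq> N" for N
  proof (rule disjCI)
    assume "N \<noteq> carrier (regular A)"
    note D = reg.submoduleD[OF N(1)]
    show "N = ?I"
    proof (rule ccontr)
      assume "N \<noteq> ?I"
      then obtain n where n: "n \<in> N" "n \<notin> ?I" using N by blast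
      then have nc: "n \<in> carrier A" using D by auto
      have nx: "n \<odot>\<^bsub>M\<^esub> x \<in> carrier M" "n \<odot>\<^bsub>M\<^esub> x \<notin> L" using n nc assms(3) by auto
      note C = submodule_cyclic[OF nx(1)]
      have "n \<odot>\<^bsub>M\<^esub> x \<in> L <+>\<^bsub>M\<^esub> cyclic A M (n \<odot>\<^bsub>M\<^esub> x)"
        using set_add_upper(2)[OF L(1) C] cyclic_self[OF nx(1)] by blast
      then have top: "L <+>\<^bsub>M\<^esub> cyclic A M (n \<odot>\<^bsub>M\<^esub> x) = carrier M"
        using L(2)[OF submodule_set_add[OF L(1) C] set_add_upper(1)[OF L(1) C]] nx by blast
      have "a \<in> N" if a: "a \<in> carrier A" for a
      proof -
        have "a \<odot>\<^bsub>M\<^esub> x \<in> L <+>\<^bsub>M\<^esub> cyclic A M (n \<odot>\<^bsub>M\<^esub> x)" using top a assms(3) by simp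
        then obtain l c where lc: "l \<in> L" "c \<in> carrier A" "a \<odot>\<^bsub>M\<^esub> x = l \<oplus>\<^bsub>M\<^esub> c \<odot>\<^bsub>M\<^esub> (n \<odot>\<^bsub>M\<^esub> x)"
          by (auto simp: cyclic_def elim!: set_addE)
        have "(a \<ominus>\<^bsub>A\<^esub> c \<otimes>\<^bsub>A\<^esub> n) \<odot>\<^bsub>M\<^esub> x = a \<odot>\<^bsub>M\<^esub> x \<ominus>\<^bsub>M\<^esub> c \<odot>\<^bsub>M\<^esub> (n \<odot>\<^bsub>M\<^esub> x)"
          using a lc nc assms(3) by (simp add: smult_minus_distr smult_assoc1)
        also have "\<dots> = l" using lc nx submoduleD(2)[OF L(1) lc(1)] by simp
        finally have "a \<ominus>\<^bsub>A\<^esub> c \<otimes>\<^bsub>A\<^esub> n \<in> N" using N(2) a lc nc by auto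
        moreover have "c \<otimes>\<^bsub>A\<^esub> n \<in> N" using D(5)[OF lc(2) n(1)] by simp
        ultimately have "(a \<ominus>\<^bsub>regular A\<^esub> c \<otimes>\<^bsub>A\<^esub> n) \<oplus>\<^bsub>regular A\<^esub> c \<otimes>\<^bsub>A\<^esub> n \<in> N"
          using D(4) a lc nc R.ring_axioms by simp
        then show ?thesis using reg.minus_add_cancel[of a "c \<otimes>\<^bsub>A\<^esub> n"] a lc nc by simp
      qed
      then show False using \<open>N \<noteq> carrier (regular A)\<close> D(1) by auto
    qed
  qed
  moreover have "?I \<noteq> carrier (regular A)"
  proof
    assume "?I = carrier (regular A)"
    then have "\<one>\<^bsub>A\<^esub> \<in> ?I" by simp
    then show False using assms(3,4) by simp
  qed
  ultimately show ?thesis unfolding maximal_submodule_def using I by simp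
qed

text \<open>For \<open>x\<close> outside \<open>L\<close>, the elements that carry \<open>x\<close>
  into \<open>L\<close> form a maximal left ideal, and \<open>J\<close> lies in all of
  these.\<close>

lemma jacobson_radical_smult_maximal:
  assumes "left_module A M" "maximal_submodule A M L" "x \<in> carrier M" "j \<in> jacobson_radical A"
  shows "j \<odot>\<^bsub>M\<^esub> x \<in> L"
proof (cases "x \<in> L")
  case True
  interpret left_module A M by fact
  have "submodule L A M" using assms(2) by (simp add: maximal_submodule_def)
  then show ?thesis using True assms(4) by (auto simp: jacobson_radical_def intro: submoduleD)
next
  case False
  then show ?thesis
    using maximal_submodule_quotient_ideal[OF assms(1-3)] assms(4)
    unfolding jacobson_radical_def by blast
qed

text \<open>The part of being an artin algebra that the ring-theoretic arguments draw on. The two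
  assumptions are swapped by \<open>op_ring\<close>, so each result on left ideals yields its mirror
  image for right ideals.\<close>

locale finite_length_ring = ring A for A :: "('a, 'm) ring_scheme" (structure) +
  assumes fl_left: "finite_length A (regular A)"
    and fl_right: "finite_length (op_ring A) (regular (op_ring A))"
begin

sublocale reg: finite_length_module A "regular A"
  by (intro finite_length_moduleI left_module_regular
      ring_axioms fl_left)

lemma finite_length_ring_op: "finite_length_ring (op_ring A)"
  by (intro finite_length_ring.intro finite_length_ring_axioms.intro ring_op_ring ring_axioms) (simp_all add: fl_left fl_right)

abbreviation "J \<equiv> jacobson_radical A"

lemma J_carrier: "x \<in> J \<Longrightarrow> x \<in> carrier A"
  by (simp add: jacobson_radical_def)

lemma submodule_J: "submodule J A (regular A)"
proof (rule reg.submoduleI)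
  show "x \<oplus>\<^bsub>regular A\<^esub> y \<in> J" if xy: "x \<in> J" "y \<in> J" for x y
    using that reg.submoduleD(4) by (fastforce simp: jacobson_radical_def maximal_submodule_def)
  show "a \<odot>\<^bsub>regular A\<^esub> x \<in> J" if "a \<in> carrier A" "x \<in> J" for a x
    using that reg.submoduleD(5) by (fastforce simp: jacobson_radical_def maximal_submodule_def)
qed (use reg.submoduleD(3) in \<open>auto simp: jacobson_radical_def maximal_submodule_def\<close>)

lemma J_mult_l: "a \<in> carrier A \<Longrightarrow> x \<in> J \<Longrightarrow> a \<otimes> x \<in> J"
  using reg.submoduleD(5)[OF submodule_J] by simp

lemma J_mult_r: "a \<in> carrier A \<Longrightarrow> x \<in> J \<Longrightarrow> x \<otimes> a \<in> J"
  using jacobson_radical_smult_maximal[OF reg.left_module_axioms, of _ a x] J_carrier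
  by (auto simp: jacobson_radical_def)

lemma ideal_J: "ideal J A"
proof (rule idealI[OF ring_axioms])
  show "subgroup J (add_monoid A)"
    using reg.submoduleD[OF submodule_J] reg.submodule_a_inv[OF submodule_J] ring_axioms J_carrier
    by (intro subgroup.intro) (auto simp: a_inv_def[symmetric])
qed (auto intro: J_mult_l J_mult_r)

lemma one_minus_J_left_inverse:
  assumes "x \<in> J"
  shows "\<exists>u\<in>carrier A. u \<otimes> (\<one> \<ominus> x) = \<one>"
proof -
  have x: "x \<in> carrier A" using assms by (rule J_carrier)
  let ?C = "cyclic A (regular A) (\<one> \<ominus> x)"
  have c: "\<one> \<ominus> x \<in> carrier (regular A)" using x by simp
  note C = reg.submodule_cyclic[OF c]
  have "?C = carrier (regular A)"
  proof (rule ccontr)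
    assume "?C \<noteq> carrier (regular A)"
    then obtain L where L: "maximal_submodule A (regular A) L" "?C \<subseteq> L"
      using reg.maximal_above[OF C] by blast
    then have s: "submodule L A (regular A)" "L \<noteq> carrier A" by (auto simp: maximal_submodule_def)
    have "\<one> \<ominus> x \<in> L" "x \<in> L" using L reg.cyclic_self[OF c] assms by (auto simp: jacobson_radical_def)
    then have "(\<one> \<ominus>\<^bsub>regular A\<^esub> x) \<oplus>\<^bsub>regular A\<^esub> x \<in> L"
      using reg.submoduleD(4)[OF s(1)] x ring_axioms by simp
    then have one: "\<one> \<in> L" using reg.minus_add_cancel[of \<one> x] x by simp
    have "a \<in> L" if "a \<in> carrier A" for a
      using reg.submoduleD(5)[OF s(1) that one] that by simp
    then show False using s reg.submoduleD(1)[OF s(1)] by auto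
  qed
  then have "\<one> \<in> ?C" by simp
  then obtain u where "u \<in> carrier A" "\<one> = u \<otimes> (\<one> \<ominus> x)" by (auto simp: cyclic_def)
  then show ?thesis by metis
qed

text \<open>If a maximal left ideal \<open>L\<close> missed \<open>x\<close>, then
  \<open>1 = l + a x\<close> with \<open>l\<close> in \<open>L\<close>; so
  \<open>l = 1 - a x\<close> is left invertible and \<open>L\<close> is everything.\<close>

lemma mem_J_if_left_inverses:
  assumes x: "x \<in> carrier A" and inv: "\<And>a. a \<in> carrier A \<Longrightarrow> \<exists>u\<in>carrier A. u \<otimes> (\<one> \<ominus> a \<otimes> x) = \<one>"
  shows "x \<in> J"
proof (rule ccontr)
  assume "x \<notin> J"
  then obtain L where L: "maximal_submodule A (regular A) L" "x \<notin> L"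
    using x by (auto simp: jacobson_radical_def)
  then have s: "submodule L A (regular A)" "L \<noteq> carrier A"
    "\<And>N. submodule N A (regular A) \<Longrightarrow> L \<subseteq> N \<Longrightarrow> N = L \<or> N = carrier A"
    by (auto simp: maximal_submodule_def)
  have C: "submodule (cyclic A (regular A) x) A (regular A)" using x by (simp add: reg.submodule_cyclic)
  have "x \<in> L <+>\<^bsub>regular A\<^esub> cyclic A (regular A) x"
    using reg.set_add_upper(2)[OF s(1) C] reg.cyclic_self x by auto
  then have "L <+>\<^bsub>regular A\<^esub> cyclic A (regular A) x = carrier A"
    using s(3)[OF reg.submodule_set_add[OF s(1) C] reg.set_add_upper(1)[OF s(1) C]] L(2) by auto
  then have "\<one> \<in> L <+>\<^bsub>regular A\<^esub> cyclic A (regular A) x" by simp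
  then obtain l a where la: "l \<in> L" "a \<in> carrier A" "\<one> = l \<oplus> a \<otimes> x"
    by (auto simp: cyclic_def elim!: reg.set_addE)
  have lc: "l \<in> carrier A" using reg.submoduleD(2)[OF s(1) la(1)] by simp
  have "\<one> \<ominus> a \<otimes> x = l" using reg.add_minus_cancel_right[of l "a \<otimes> x"] la x lc ring_axioms by simp
  then obtain u where "u \<in> carrier A" "u \<otimes> l = \<one>" using inv[OF la(2)] by auto
  then have one: "\<one> \<in> L" using reg.submoduleD(5)[OF s(1) _ la(1)] by fastforce
  have "a \<in> L" if "a \<in> carrier A" for a
    using reg.submoduleD(5)[OF s(1) that one] that by simp
  then show False using s reg.submoduleD(1)[OF s(1)] by auto
qed

lemma one_minus_J_unit:
  assumes "x \<in> J"
  shows "\<exists>u\<in>carrier A. u \<otimes> (\<one> \<ominus> x) = \<one> \<and> (\<one> \<ominus> x) \<otimes> u = \<one>"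
proof -
  have x: "x \<in> carrier A" using assms by (rule J_carrier)
  obtain u where u: "u \<in> carrier A" "u \<otimes> (\<one> \<ominus> x) = \<one>" using one_minus_J_left_inverse[OF assms] by auto
  have "u \<ominus> u \<otimes> x = \<one>" using u x by (simp add: minus_eq r_distr r_minus)
  \<comment> \<open>The left inverse is itself \<open>1 - j\<close> with \<open>j = - (u x)\<close>
    in \<open>J\<close>, so it has a left inverse \<open>v\<close>. Then \<open>v = 1 - x\<close>,
    which makes \<open>u\<close> a two-sided inverse.\<close>
  then have "u = \<one> \<ominus> (\<ominus> (u \<otimes> x))" using u x by (metis a_minus_def m_closed minus_minus a_inv_closed r_neg2 a_comm minus_equality add.inv_solve_right one_closed)
  moreover have "\<ominus> (u \<otimes> x) \<in> J"
    using reg.submodule_a_inv[OF submodule_J J_mult_l[OF u(1) assms]] u x ring_axioms by simp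
  ultimately obtain v where v: "v \<in> carrier A" "v \<otimes> u = \<one>"
    using one_minus_J_left_inverse by metis
  have "v = v \<otimes> (u \<otimes> (\<one> \<ominus> x))" using u v by simp
  also have "\<dots> = (v \<otimes> u) \<otimes> (\<one> \<ominus> x)" using u(1) v(1) x m_assoc[of v u "\<one> \<ominus> x"] by simp
  also have "\<dots> = \<one> \<ominus> x" using v(2) x by simp
  finally show ?thesis using u v by auto
qed

end

text \<open>Two-sided invertibility of \<open>1 - x a\<close> reads the same in both rings, so it
  supplies the left inverses that the membership criterion demands in the opposite ring.\<close>

lemma (in finite_length_ring) J_subset_J_op: "J \<subseteq> jacobson_radical (op_ring A)"
proof
  fix x assume x: "x \<in> J"
  interpret op: finite_length_ring "op_ring A" by (rule finite_length_ring_op)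
  show "x \<in> jacobson_radical (op_ring A)"
  proof (rule op.mem_J_if_left_inverses)
    fix a assume a: "a \<in> carrier (op_ring A)"
    then have "x \<otimes> a \<in> J" using J_mult_r x by simp
    from one_minus_J_unit[OF this]
    show "\<exists>u\<in>carrier (op_ring A). u \<otimes>\<^bsub>op_ring A\<^esub> (\<one>\<^bsub>op_ring A\<^esub> \<ominus>\<^bsub>op_ring A\<^esub> a \<otimes>\<^bsub>op_ring A\<^esub> x) = \<one>\<^bsub>op_ring A\<^esub>"
      by auto
  qed (use x J_carrier in simp)
qed

lemma (in finite_length_ring) jacobson_radical_op: "jacobson_radical (op_ring A) = J"
  using J_subset_J_op finite_length_ring.J_subset_J_op[OF finite_length_ring_op] by simp

lemma ideal_prod_op: "ideal_prod (op_ring A) I K = ideal_prod A K I"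
proof -
  have "x \<in> ideal_prod B K I" if "x \<in> ideal_prod (op_ring B) I K" for x I K and B :: "('a, 'b) ring_scheme"
    using that by induct (auto intro: ideal_prod.intros)
  from this[of _ A] this[of _ "op_ring A"] show ?thesis by auto
qed

section \<open>Idempotents and the unique maximal submodule of \<open>A e\<close>\<close>

context finite_length_ring
begin

lemma idempotent_mem_J:
  assumes "idempotent_elt A e" "e \<in> J"
  shows "e = \<zero>"
proof -
  have e: "e \<in> carrier A" "e \<otimes> e = e" using assms by (auto simp: idempotent_elt_def)
  obtain u where u: "u \<in> carrier A" "u \<otimes> (\<one> \<ominus> e) = \<one>" using one_minus_J_left_inverse[OF assms(2)] by auto
  have "(\<one> \<ominus> e) \<otimes> e = \<zero>" using e by (simp add: minus_eq l_distr l_minus r_neg)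
  then have "u \<otimes> (\<one> \<ominus> e) \<otimes> e = \<zero>" using u(1) e(1) m_assoc[of u "\<one> \<ominus> e" e] by simp
  then show ?thesis using u(2) e(1) by simp
qed

lemma telescope:
  assumes "n \<in> carrier A"
  shows "\<exists>u\<in>carrier A. u \<otimes> (\<one> \<ominus> n) = \<one> \<ominus> n [^] (k::nat)"
proof (induct k)
  case 0
  show ?case using assms by (intro bexI[of _ \<zero>]) (simp_all add: minus_eq r_neg)
next
  case (Suc k)
  then obtain u where u: "u \<in> carrier A" "u \<otimes> (\<one> \<ominus> n) = \<one> \<ominus> n [^] k" by auto
  have "(u \<oplus> n [^] k) \<otimes> (\<one> \<ominus> n) = (\<one> \<ominus> n [^] k) \<oplus> (n [^] k \<ominus> n [^] k \<otimes> n)"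
    using u assms by (simp add: l_distr) (simp add: minus_eq r_distr r_minus)
  also have "\<dots> = \<one> \<ominus> n [^] Suc k"
    using assms by (simp add: minus_eq a_assoc r_neg2 r_neg1)
  finally show ?case using u assms by (intro bexI[of _ "u \<oplus> n [^] k"]) auto
qed

lemma mem_left_coset_idem:
  assumes "idempotent_elt A e"
  shows "a \<in> carrier A #> e \<longleftrightarrow> a \<in> carrier A \<and> a \<otimes> e = a"
  using assms by (force simp: r_coset_def idempotent_elt_def m_assoc)

lemma mem_left_coset_idem_ideal:
  assumes "idempotent_elt A e" "ideal I A"
  shows "a \<in> I #> e \<longleftrightarrow> a \<in> I \<and> a \<otimes> e = a"
proof -
  interpret I: ideal I A by fact
  show ?thesis using assms(1) I.I_r_closed I.Icarr
    by (force simp: r_coset_def idempotent_elt_def m_assoc)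
qed

lemma submodule_left_coset:
  assumes "e \<in> carrier A" "submodule I A (regular A)"
  shows "submodule (I #> e) A (regular A)"
proof -
  interpret l: linear_map A "regular A" "regular A" "\<lambda>x. x \<otimes> e"
    using assms(1) by (intro linear_mapI reg.left_module_axioms)
      (auto simp: l_distr m_assoc)
  have "I #> e = (\<lambda>x. x \<otimes> e) ` I" by (auto simp: r_coset_def)
  then show ?thesis using l.submodule_image[OF assms(2)] by simp
qed

text \<open>Fitting: \<open>x = e n\<close> lies in \<open>e A e\<close>, and \<open>A x\<^sup>k\<close> and the left annihilator of \<open>x\<^sup>k\<close> stabilise.\<close>

lemma proper_submodule_le_J:
  assumes e: "primitive_idempotent A e" and N: "submodule N A (regular A)"
    and sub: "N \<subseteq> carrier A #> e" and ne: "N \<noteq> carrier A #> e"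
  shows "N \<subseteq> J"
proof -
  have idem: "idempotent_elt A e" and ec: "e \<in> carrier A" "e \<otimes> e = e"
    using e by (auto simp: primitive_idempotent_def idempotent_elt_def)
  note ND = reg.submoduleD[OF N, simplified]
  have e_notin: "e \<notin> N"
  proof
    assume "e \<in> N"
    then have "carrier A #> e \<subseteq> N" using ND(5) by (auto simp: r_coset_def)
    then show False using sub ne by blast
  qed
  have nil: "\<exists>k::nat. (e \<otimes> n) [^] k = \<zero>" if n: "n \<in> N" for n
  proof -
    have nc: "n \<in> carrier A" "n \<otimes> e = n" using n sub mem_left_coset_idem[OF idem] by auto
    define x where "x = e \<otimes> n"
    have xc: "x \<in> carrier A" and xe: "e \<otimes> x = x" "x \<otimes> e = x"
      using nc ec by (simp_all add: x_def m_assoc[symmetric], simp add: m_assoc)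
    have xN: "x \<in> N" using ND(5)[OF ec(1) n] by (simp add: x_def)
    define D where "D k = cyclic A (regular A) (x [^] k)" for k :: nat
    define K where "K k = {a \<in> carrier A. a \<otimes> x [^] k = \<zero>}" for k :: nat
    have D: "submodule (D k) A (regular A)" for k
      using reg.submodule_cyclic[of "x [^] k"] xc by (simp add: D_def)
    have K: "submodule (K k) A (regular A)" for k
      using reg.quotient_ideal[OF reg.submodule_zero, of "x [^] k"] xc by (simp add: K_def)
    have "D (Suc k) \<subseteq> D k" for k
    proof -
      have "x [^] Suc k = x \<otimes> x [^] k" using nat_pow_Suc2[OF xc] .
      then have "a \<otimes> x [^] Suc k = (a \<otimes> x) \<otimes> x [^] k" if "a \<in> carrier A" for a
        using that xc by (simp add: m_assoc)
      then show ?thesis using xc by (auto simp: D_def cyclic_def)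
    qed
    from reg.descending_stable[of D, OF D this] obtain k1 where k1: "\<forall>m\<ge>k1. D m = D k1" by blast
    have "K k \<subseteq> K (Suc k)" for k using xc by (auto simp: K_def m_assoc[symmetric])
    from reg.ascending_stable[of K, OF K this] obtain k2 where k2: "\<forall>m\<ge>k2. K m = K k2" by blast
    \<comment> \<open>The successor guarantees at least one factor \<open>x\<close> in the power
      \<open>y\<close>, whence \<open>e y = y = y e\<close> and \<open>y\<close> lies in
      \<open>N\<close>.\<close>
    define k where "k = Suc (k1 + k2)"
    have "k1 \<le> k" "k2 \<le> k" by (simp_all add: k_def)
    then have Dk: "D k = D (k + k)" and Kk: "K k = K (k + k)"
      using k1 k2 by (metis trans_le_add1)+
    define y where "y = x [^] k"
    have yc: "y \<in> carrier A" using xc by (simp add: y_def)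
    have yy: "x [^] (k + k) = y \<otimes> y" using xc by (simp add: y_def nat_pow_mult)
    have ye: "e \<otimes> y = y" "y \<otimes> e = y"
    proof -
      have "y = x [^] (k1 + k2) \<otimes> x" by (simp add: y_def k_def)
      then show "y \<otimes> e = y" using xc xe ec by (simp add: m_assoc)
      have "y = x \<otimes> x [^] (k1 + k2)" using nat_pow_Suc2[OF xc] by (simp add: y_def k_def)
      then show "e \<otimes> y = y" using xc xe ec by (simp add: m_assoc[symmetric])
    qed
    have yN: "y \<in> N" using ND(5)[OF _ xN, of "x [^] (k1 + k2)"] xc by (simp add: y_def k_def)
    have "y \<in> D k" using reg.cyclic_self[of y] yc by (simp add: D_def y_def)
    then have "y \<in> D (k + k)" using Dk by simp
    then obtain c where c: "c \<in> carrier A" "y = c \<otimes> (y \<otimes> y)"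
      unfolding D_def cyclic_def yy by auto
    \<comment> \<open>Since \<open>y = c y y\<close>, the element \<open>c y\<close> acts on
      \<open>y\<close> from the left as the identity; the factor \<open>e\<close> moves it into
      \<open>e A e\<close>. It is the candidate idempotent.\<close>
    define f where "f = e \<otimes> c \<otimes> y"
    have fc: "f \<in> carrier A" using ec c yc by (simp add: f_def)
    have fy: "f \<otimes> y = y"
    proof -
      have "f \<otimes> y = e \<otimes> (c \<otimes> (y \<otimes> y))" using ec c(1) yc by (simp add: f_def m_assoc)
      then show ?thesis using c ye by simp
    qed
    have ef: "e \<otimes> f = f" "f \<otimes> e = f"
      using ec c(1) yc ye by (simp_all add: f_def m_assoc[symmetric], simp add: m_assoc)
    have ff: "f \<otimes> f = f"
    proof -
      \<comment> \<open>Chosen so that \<open>w y = f f - f\<close>. A further factor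
        \<open>y\<close> on the right kills this since \<open>f y = y\<close>, and as the
        annihilators are stable, \<open>w y = 0\<close> already.\<close>
      define w where "w = f \<otimes> e \<otimes> c \<ominus> e \<otimes> c"
      have wc: "w \<in> carrier A" using fc ec c by (simp add: w_def)
      have wy: "w \<otimes> y = f \<otimes> f \<ominus> f"
        using fc ec c(1) yc by (simp add: w_def minus_eq l_distr l_minus) (simp add: f_def m_assoc)
      have "w \<otimes> y \<otimes> y = \<zero>"
        unfolding wy using fc yc fy by (simp add: minus_eq l_distr l_minus m_assoc r_neg)
      then have "w \<in> K (k + k)" using wc yc by (simp add: K_def yy m_assoc)
      then have "w \<in> K k" using Kk by simp
      then have "w \<otimes> y = \<zero>" by (simp add: K_def y_def)
      then show ?thesis using wy reg.minus_eq_zero_iff[of "f \<otimes> f" f] fc ring_axioms by simp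
    qed
    define g where "g = e \<ominus> f"
    have gc: "g \<in> carrier A" using ec fc by (simp add: g_def)
    have fg: "f \<otimes> g = \<zero>" "g \<otimes> f = \<zero>"
      using ec fc ef ff by (simp_all add: g_def minus_eq l_distr r_distr l_minus r_minus r_neg)
    have gg: "g \<otimes> g = g"
    proof -
      have "g \<otimes> g = e \<otimes> g \<ominus> f \<otimes> g" using ec fc gc by (simp add: g_def minus_eq l_distr l_minus)
      also have "\<dots> = e \<otimes> g" using fg gc ec reg.minus_zero[of "e \<otimes> g"] ring_axioms by simp
      also have "\<dots> = g" using ec fc ef by (simp add: g_def minus_eq r_distr r_minus)
      finally show ?thesis .
    qed
    have "e = f \<oplus> g" using reg.add_minus_cancel[of e f] ec fc ring_axioms by (simp add: g_def)
    then have "f = \<zero> \<or> g = \<zero>"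
      using e fc gc ff gg fg unfolding primitive_idempotent_def idempotent_elt_def by blast
    then show ?thesis
    proof
      assume "f = \<zero>"
      then have "y = \<zero>" using fy yc by simp
      then show ?thesis unfolding y_def x_def by blast
    next
      assume "g = \<zero>"
      then have "e = f" using reg.minus_eq_zero_iff[of e f] ec fc ring_axioms by (simp add: g_def)
      then have "e \<in> N" using ND(5)[OF _ yN, of "e \<otimes> c"] ec c by (simp add: f_def)
      then show ?thesis using e_notin by simp
    qed
  qed
  show ?thesis
  proof
    fix n assume n: "n \<in> N"
    have nc: "n \<in> carrier A" using n ND by auto
    show "n \<in> J"
    proof (rule mem_J_if_left_inverses[OF nc])
      fix a assume a: "a \<in> carrier A"
      define b where "b = a \<otimes> n"
      have bN: "b \<in> N" using ND(5)[OF a n] by (simp add: b_def)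
      then have bc: "b \<in> carrier A" "b \<otimes> e = b" using sub mem_left_coset_idem[OF idem] by auto
      obtain k :: nat where k: "(e \<otimes> b) [^] k = \<zero>" using nil[OF bN] by blast
      \<comment> \<open>Nilpotency is known for \<open>e b\<close>. As \<open>b e = b\<close>,
        powers of \<open>b\<close> are \<open>b\<close> times powers of \<open>e b\<close>, so
        \<open>b\<close> is nilpotent too and \<open>1 - b\<close> has a left inverse.\<close>
      have "b [^] Suc i = b \<otimes> (e \<otimes> b) [^] i" for i :: nat
      proof (induct i)
        case 0
        show ?case using bc by simp
      next
        case (Suc i)
        have "b [^] Suc i \<otimes> e = b [^] Suc i" using bc ec by (simp add: m_assoc)
        then have "b [^] Suc (Suc i) = b [^] Suc i \<otimes> (e \<otimes> b)"
          using bc(1) ec(1) m_assoc[of "b [^] Suc i" e b] nat_pow_closed by simp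
        also have "\<dots> = b \<otimes> (e \<otimes> b) [^] i \<otimes> (e \<otimes> b)" using Suc by simp
        finally show ?case using bc ec by (simp add: m_assoc)
      qed
      then have "b [^] Suc k = \<zero>" using k bc by simp
      then obtain u where "u \<in> carrier A" "u \<otimes> (\<one> \<ominus> b) = \<one> \<ominus> \<zero>"
        using telescope[OF bc(1), of "Suc k"] by metis
      then show "\<exists>u\<in>carrier A. u \<otimes> (\<one> \<ominus> a \<otimes> n) = \<one>"
        using reg.minus_zero[of \<one>] ring_axioms by (auto simp: b_def)
    qed
  qed
qed

text \<open>Since \<open>J e = J \<inter> A e\<close>, the inclusion just shown puts every proper
  submodule of \<open>A e\<close> into \<open>J e\<close>. That \<open>J e\<close> is itself proper
  holds because \<open>J\<close> contains no nonzero idempotent.\<close>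

lemma covers_primitive:
  assumes e: "primitive_idempotent A e"
  shows "covers A (regular A) (J #> e) (carrier A #> e)"
proof -
  have idem: "idempotent_elt A e" and ec: "e \<in> carrier A" "e \<otimes> e = e" and e0: "e \<noteq> \<zero>"
    using e by (auto simp: primitive_idempotent_def idempotent_elt_def)
  note Je = mem_left_coset_idem_ideal[OF idem ideal_J] and Ae = mem_left_coset_idem[OF idem]
  have "e \<in> carrier A #> e" "e \<notin> J #> e"
    using ec e0 idempotent_mem_J[OF idem] by (auto simp: Je Ae)
  moreover have "J #> e \<subseteq> carrier A #> e" using J_carrier by (auto simp: Je Ae)
  moreover have "Z = J #> e \<or> Z = carrier A #> e"
    if Z: "submodule Z A (regular A)" "J #> e \<subseteq> Z" "Z \<subseteq> carrier A #> e" for Z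
    using proper_submodule_le_J[OF e Z(1,3)] Z(2,3) Je Ae by blast
  ultimately show ?thesis
    using submodule_left_coset[OF ec(1) submodule_J]
      submodule_left_coset[OF ec(1), of "carrier A"] reg.submodule_carrier
    by (auto simp: covers_def)
qed

end

section \<open>Direct sums and finitely generated modules\<close>

lemma direct_sum_simps [simp]:
  "carrier (direct_sum K M) = (\<Pi>\<^sub>E i\<in>K. carrier (M i))"
  "\<zero>\<^bsub>direct_sum K M\<^esub> = (\<lambda>i\<in>K. \<zero>\<^bsub>M i\<^esub>)"
  "x \<oplus>\<^bsub>direct_sum K M\<^esub> y = (\<lambda>i\<in>K. x i \<oplus>\<^bsub>M i\<^esub> y i)"
  "a \<odot>\<^bsub>direct_sum K M\<^esub> x = (\<lambda>i\<in>K. a \<odot>\<^bsub>M i\<^esub> x i)"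
  by (simp_all add: direct_sum_def)

lemma left_module_direct_sum:
  assumes A: "ring A" and M: "\<And>i. i \<in> K \<Longrightarrow> left_module A (M i)"
  shows "left_module A (direct_sum K M)"
proof -
  have ag: "abelian_group (M i)" if "i \<in> K" for i
    using M[OF that] by (simp add: left_module_def)
  then have am: "abelian_monoid (M i)" if "i \<in> K" for i
    using that by (simp add: abelian_group_def)
  note closures = abelian_monoid.zero_closed[OF am] abelian_monoid.a_closed[OF am]
    left_module.smult_closed[OF M]
  have "abelian_group (direct_sum K M)"
  proof (rule abelian_groupI)
    fix x assume x: "x \<in> carrier (direct_sum K M)"
    have "(\<lambda>i\<in>K. \<ominus>\<^bsub>M i\<^esub> x i) \<in> carrier (direct_sum K M)"
      using x abelian_group.a_inv_closed[OF ag] by (auto simp: PiE_iff)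
    moreover have "(\<lambda>i\<in>K. \<ominus>\<^bsub>M i\<^esub> x i) \<oplus>\<^bsub>direct_sum K M\<^esub> x = \<zero>\<^bsub>direct_sum K M\<^esub>"
      using x abelian_group.l_neg[OF ag] by (auto simp: PiE_iff)
    ultimately show "\<exists>y\<in>carrier (direct_sum K M). y \<oplus>\<^bsub>direct_sum K M\<^esub> x = \<zero>\<^bsub>direct_sum K M\<^esub>"
      by blast
  next
    fix x assume x: "x \<in> carrier (direct_sum K M)"
    show "\<zero>\<^bsub>direct_sum K M\<^esub> \<oplus>\<^bsub>direct_sum K M\<^esub> x = x"
      using x abelian_monoid.l_zero[OF am] by (auto simp: PiE_iff extensional_def)
  next
    fix x y z
    assume *: "x \<in> carrier (direct_sum K M)" "y \<in> carrier (direct_sum K M)" "z \<in> carrier (direct_sum K M)"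
    show "x \<oplus>\<^bsub>direct_sum K M\<^esub> y \<oplus>\<^bsub>direct_sum K M\<^esub> z = x \<oplus>\<^bsub>direct_sum K M\<^esub> (y \<oplus>\<^bsub>direct_sum K M\<^esub> z)"
      using * abelian_monoid.a_assoc[OF am] by (auto simp: PiE_iff)
  next
    fix x y assume *: "x \<in> carrier (direct_sum K M)" "y \<in> carrier (direct_sum K M)"
    show "x \<oplus>\<^bsub>direct_sum K M\<^esub> y = y \<oplus>\<^bsub>direct_sum K M\<^esub> x"
      using * abelian_monoid.a_comm[OF am] by (auto simp: PiE_iff)
    show "x \<oplus>\<^bsub>direct_sum K M\<^esub> y \<in> carrier (direct_sum K M)"
      using * closures by (auto simp: PiE_iff)
  qed (use closures in \<open>auto\<close>)
  then show ?thesis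
  proof (rule left_moduleI[OF A])
    fix x assume x: "x \<in> carrier (direct_sum K M)"
    show "\<one>\<^bsub>A\<^esub> \<odot>\<^bsub>direct_sum K M\<^esub> x = x"
      using x left_module.smult_one[OF M] by (auto simp: PiE_iff extensional_def)
    fix a assume a: "a \<in> carrier A"
    show "a \<odot>\<^bsub>direct_sum K M\<^esub> x \<in> carrier (direct_sum K M)"
      using x a closures by (auto simp: PiE_iff)
    fix b assume b: "b \<in> carrier A"
    show "(a \<oplus>\<^bsub>A\<^esub> b) \<odot>\<^bsub>direct_sum K M\<^esub> x = a \<odot>\<^bsub>direct_sum K M\<^esub> x \<oplus>\<^bsub>direct_sum K M\<^esub> b \<odot>\<^bsub>direct_sum K M\<^esub> x"
      using x a b left_module.smult_l_distr[OF M] by (auto simp: PiE_iff)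
    show "a \<otimes>\<^bsub>A\<^esub> b \<odot>\<^bsub>direct_sum K M\<^esub> x = a \<odot>\<^bsub>direct_sum K M\<^esub> (b \<odot>\<^bsub>direct_sum K M\<^esub> x)"
      using x a b left_module.smult_assoc1[OF M] by (auto simp: PiE_iff)
  next
    fix a x y
    assume *: "a \<in> carrier A" "x \<in> carrier (direct_sum K M)" "y \<in> carrier (direct_sum K M)"
    show "a \<odot>\<^bsub>direct_sum K M\<^esub> (x \<oplus>\<^bsub>direct_sum K M\<^esub> y) = a \<odot>\<^bsub>direct_sum K M\<^esub> x \<oplus>\<^bsub>direct_sum K M\<^esub> a \<odot>\<^bsub>direct_sum K M\<^esub> y"
      using * left_module.smult_r_distr[OF M] by (auto simp: PiE_iff)
  qed
qed

lemma linear_map_proj: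
  assumes "ring A" "\<And>i. i \<in> K \<Longrightarrow> left_module A (M i)" "j \<in> K"
  shows "linear_map A (direct_sum K M) (M j) (\<lambda>x. x j)"
  using assms by (intro linear_mapI left_module_direct_sum) auto

lemma finite_length_trivial:
  assumes "left_module A M" "carrier M = {\<zero>\<^bsub>M\<^esub>}"
  shows "finite_length A M"
proof -
  interpret left_module A M by fact
  have "\<not> N \<subset> N'" if "submodule N A M" "submodule N' A M" for N N'
    using submoduleD(3)[OF that(1)] submoduleD(1)[OF that(2)] assms(2) by auto
  then show ?thesis by (auto simp: finite_length_def)
qed

lemma finite_length_direct_sum:
  assumes "finite K" "ring A" "\<And>i. i \<in> K \<Longrightarrow> left_module A (M i)" "\<And>i. i \<in> K \<Longrightarrow> finite_length A (M i)"
  shows "finite_length A (direct_sum K M)"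
  using assms(1,3,4)
proof (induct K rule: finite_induct)
  case empty
  have "left_module A (direct_sum {} M)" by (rule left_module_direct_sum[OF assms(2)]) simp
  then show ?case by (rule finite_length_trivial) auto
next
  case (insert j K)
  interpret p: linear_map A "direct_sum (insert j K) M" "M j" "\<lambda>x. x j"
    by (rule linear_map_proj[OF assms(2) insert(4)]) auto
  let ?K = "a_kernel (direct_sum (insert j K) M) (M j) (\<lambda>x. x j)"
  interpret d: left_module A "direct_sum (insert j K) M \<lparr>carrier := ?K\<rparr>"
    by (rule p.dom.left_module_sub[OF p.submodule_kernel])
  interpret S: left_module A "direct_sum K M"
    by (rule left_module_direct_sum[OF assms(2)]) (simp add: insert(4))
  interpret r: linear_map A "direct_sum (insert j K) M \<lparr>carrier := ?K\<rparr>" "direct_sum K M" "\<lambda>x. restrict x K"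
    by unfold_locales (auto simp: p.kernel_eq PiE_iff intro!: restrict_ext)
  have "inj_on (\<lambda>x. restrict x K) (carrier (direct_sum (insert j K) M \<lparr>carrier := ?K\<rparr>))"
  proof (rule inj_onI)
    fix x y
    assume xy: "x \<in> carrier (direct_sum (insert j K) M \<lparr>carrier := ?K\<rparr>)"
        "y \<in> carrier (direct_sum (insert j K) M \<lparr>carrier := ?K\<rparr>)"
      and eq: "restrict x K = restrict y K"
    have e: "x \<in> extensional (insert j K)" "y \<in> extensional (insert j K)" "x j = y j"
      using xy by (auto simp: p.kernel_eq PiE_iff)
    have "x i = y i" if "i \<in> insert j K" for i
      using that e(3) fun_cong[OF eq, of i] by auto
    with e show "x = y" by (intro extensionalityI) auto
  qed
  from r.finite_length_inj[OF this insert(3)] insert(4,5)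
  have "finite_length A (direct_sum (insert j K) M \<lparr>carrier := ?K\<rparr>)" by simp
  then show ?case by (rule p.finite_length_extension) (simp add: insert(5))
qed

lemma linear_map_sum:
  assumes "finite K" "ring A" "left_module A N" "\<And>i. i \<in> K \<Longrightarrow> linear_map A (M i) N (g i)"
  shows "linear_map A (direct_sum K M) N (\<lambda>x. \<Oplus>\<^bsub>N\<^esub>i\<in>K. g i (x i))"
proof -
  interpret N: left_module A N by fact
  have M: "left_module A (M i)" if "i \<in> K" for i
    using assms(4)[OF that] by (simp add: linear_map_def)
  have cl: "(\<lambda>i. g i (x i)) \<in> K \<rightarrow> carrier N" if "x \<in> carrier (direct_sum K M)" for x
    using that linear_map.closed[OF assms(4)] by (auto simp: PiE_iff)
  show ?thesis
  proof (intro linear_mapI left_module_direct_sum assms(2,3) M)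
    fix x assume x: "x \<in> carrier (direct_sum K M)"
    show "(\<Oplus>\<^bsub>N\<^esub>i\<in>K. g i (x i)) \<in> carrier N" by (rule N.M.finsum_closed[OF cl[OF x]])
    show "(\<Oplus>\<^bsub>N\<^esub>i\<in>K. g i ((x \<oplus>\<^bsub>direct_sum K M\<^esub> y) i)) = (\<Oplus>\<^bsub>N\<^esub>i\<in>K. g i (x i)) \<oplus>\<^bsub>N\<^esub> (\<Oplus>\<^bsub>N\<^esub>i\<in>K. g i (y i))"
      if y: "y \<in> carrier (direct_sum K M)" for y
    proof -
      have "(\<Oplus>\<^bsub>N\<^esub>i\<in>K. g i ((x \<oplus>\<^bsub>direct_sum K M\<^esub> y) i)) = (\<Oplus>\<^bsub>N\<^esub>i\<in>K. g i (x i) \<oplus>\<^bsub>N\<^esub> g i (y i))"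
        using x y linear_map.add[OF assms(4)] linear_map.closed[OF assms(4)]
        by (intro N.M.finsum_cong') (auto simp: PiE_iff)
      then show ?thesis using N.M.finsum_addf[OF cl[OF x] cl[OF y]] by simp
    qed
    show "(\<Oplus>\<^bsub>N\<^esub>i\<in>K. g i ((a \<odot>\<^bsub>direct_sum K M\<^esub> x) i)) = a \<odot>\<^bsub>N\<^esub> (\<Oplus>\<^bsub>N\<^esub>i\<in>K. g i (x i))"
      if a: "a \<in> carrier A" for a
    proof -
      have "(\<Oplus>\<^bsub>N\<^esub>i\<in>K. g i ((a \<odot>\<^bsub>direct_sum K M\<^esub> x) i)) = (\<Oplus>\<^bsub>N\<^esub>i\<in>K. a \<odot>\<^bsub>N\<^esub> g i (x i))"
        using x a linear_map.smult[OF assms(4)] linear_map.closed[OF assms(4)]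
        by (intro N.M.finsum_cong') (auto simp: PiE_iff)
      then show ?thesis using N.finsum_smult[OF assms(1) a cl[OF x]] by simp
    qed
  qed
qed

lemma linear_map_smult_right:
  assumes "left_module A N" "y \<in> carrier N"
  shows "linear_map A (regular A) N (\<lambda>a. a \<odot>\<^bsub>N\<^esub> y)"
proof -
  interpret left_module A N by fact
  show ?thesis using assms(2)
    by (intro linear_mapI left_module_axioms left_module_regular
        R.ring_axioms) (auto simp: smult_l_distr smult_assoc1)
qed

lemma linear_map_finsum_smult:
  assumes "finite K" "left_module A N" "\<And>i. i \<in> K \<Longrightarrow> y i \<in> carrier N"
    "\<And>i. i \<in> K \<Longrightarrow> submodule (L i) A (regular A)"
  shows "linear_map A (direct_sum K (\<lambda>i. (regular A)\<lparr>carrier := L i\<rparr>)) N (\<lambda>x. \<Oplus>\<^bsub>N\<^esub>i\<in>K. x i \<odot>\<^bsub>N\<^esub> y i)"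
proof (rule linear_map_sum)
  show "ring A" using assms(2) by (simp add: left_module_def)
  fix i assume i: "i \<in> K"
  show "linear_map A ((regular A)\<lparr>carrier := L i\<rparr>) N (\<lambda>a. a \<odot>\<^bsub>N\<^esub> y i)"
    using linear_map.restrict_dom[OF linear_map_smult_right[OF assms(2,3)] assms(4)] i by simp
qed (use assms in simp_all)

text \<open>Each cover contributes one generator: an element of \<open>Y\<close> outside
  \<open>X\<close> generates \<open>Y\<close> together with \<open>X\<close>.\<close>

lemma (in finite_length_module) finite_length_fin_gen: "fin_gen A M"
proof -
  have "\<exists>X. finite X \<and> X \<subseteq> Y \<and> (\<forall>N. submodule N A M \<longrightarrow> X \<subseteq> N \<longrightarrow> Y \<subseteq> N)" if "submodule Y A M" for Y
    using that
  proof (induct rule: submodule_induct)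
    case zero
    show ?case using submoduleD(3) by (intro exI[of _ "{}"]) auto
  next
    case (covers X Y)
    note c = coversD[OF covers(1)]
    from covers(2) obtain F where F: "finite F" "F \<subseteq> X" "\<And>N. submodule N A M \<Longrightarrow> F \<subseteq> N \<Longrightarrow> X \<subseteq> N" by blast
    obtain y where y: "y \<in> Y" "y \<notin> X" using c(3) by auto
    have "Y \<subseteq> N" if N: "submodule N A M" "insert y F \<subseteq> N" for N
    proof -
      have "X \<subseteq> N \<inter> Y" using F(3)[OF N(1)] N(2) c(3) by auto
      then have "N \<inter> Y = X \<or> N \<inter> Y = Y" using c(4)[OF submodule_Int[OF N(1) c(2)]] by auto
      then show ?thesis using y N by auto
    qed
    then show ?case using F y c(3) by (intro exI[of _ "insert y F"]) auto
  qed
  from this[OF submodule_carrier] obtain X where X: "finite X" "X \<subseteq> carrier M"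
    "\<And>N. submodule N A M \<Longrightarrow> X \<subseteq> N \<Longrightarrow> carrier M \<subseteq> N" by blast
  then show ?thesis unfolding fin_gen_def using submoduleD(1) by (metis subset_antisym)
qed

lemma (in finite_length_module) fg_module: "fg_module A M"
  by (simp add: fg_module_def left_module_axioms finite_length_fin_gen)

lemma fin_gen_span:
  assumes M: "left_module A M" and fg: "fin_gen A M"
  obtains X where "finite X" "X \<subseteq> carrier M"
    "linear_map A (direct_sum X (\<lambda>_. regular A)) M (\<lambda>t. \<Oplus>\<^bsub>M\<^esub>x\<in>X. t x \<odot>\<^bsub>M\<^esub> x)"
    "(\<lambda>t. \<Oplus>\<^bsub>M\<^esub>x\<in>X. t x \<odot>\<^bsub>M\<^esub> x) ` carrier (direct_sum X (\<lambda>_. regular A)) = carrier M"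
proof -
  interpret left_module A M by fact
  obtain X where X: "finite X" "X \<subseteq> carrier M" "\<And>N. submodule N A M \<Longrightarrow> X \<subseteq> N \<Longrightarrow> N = carrier M"
    using fg unfolding fin_gen_def by blast
  interpret reg: left_module A "regular A" by (rule left_module_regular[OF R.ring_axioms])
  let ?h = "\<lambda>t. \<Oplus>\<^bsub>M\<^esub>x\<in>X. t x \<odot>\<^bsub>M\<^esub> x"
  interpret h: linear_map A "direct_sum X (\<lambda>_. regular A)" M ?h
    by (rule linear_map_sum[OF X(1) R.ring_axioms M linear_map_smult_right[OF M]]) (use X in auto)
  have "y \<in> ?h ` carrier (direct_sum X (\<lambda>_. regular A))" if y: "y \<in> X" for y
  proof -
    let ?t = "\<lambda>x\<in>X. if x = y then \<one>\<^bsub>A\<^esub> else \<zero>\<^bsub>A\<^esub>"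
    have yc: "y \<in> carrier M" using X y by auto
    have "?h ?t = (\<Oplus>\<^bsub>M\<^esub>x\<in>X. if x = y then y else \<zero>\<^bsub>M\<^esub>)"
      using X y by (intro M.finsum_cong') (auto simp: subset_iff)
    also have "\<dots> = y" by (rule finsum_single[OF X(1) y yc])
    finally have "y = ?h ?t" by (rule sym)
    moreover have "?t \<in> carrier (direct_sum X (\<lambda>_. regular A))" by auto
    ultimately show ?thesis by (rule image_eqI[of y ?h ?t])
  qed
  then have "?h ` carrier (direct_sum X (\<lambda>_. regular A)) = carrier M"
    by (intro X(3) h.submodule_image h.dom.submodule_carrier subsetI)
  then show ?thesis using that[OF X(1,2) h.linear_map_axioms] by simp
qed

lemma fin_gen_finite_length:
  assumes "left_module A M" "fin_gen A M" "finite_length A (regular A)"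
  shows "finite_length A M"
proof -
  have A: "ring A" using assms(1) by (simp add: left_module_def)
  obtain X where X: "finite X" "X \<subseteq> carrier M"
    "linear_map A (direct_sum X (\<lambda>_. regular A)) M (\<lambda>t. \<Oplus>\<^bsub>M\<^esub>x\<in>X. t x \<odot>\<^bsub>M\<^esub> x)"
    "(\<lambda>t. \<Oplus>\<^bsub>M\<^esub>x\<in>X. t x \<odot>\<^bsub>M\<^esub> x) ` carrier (direct_sum X (\<lambda>_. regular A)) = carrier M"
    by (rule fin_gen_span[OF assms(1,2)])
  show ?thesis
    by (rule linear_map.finite_length_surj[OF X(3,4)])
      (rule finite_length_direct_sum[OF X(1) A left_module_regular[OF A] assms(3)])
qed

lemma (in linear_map) fin_gen_surj:
  assumes "h ` carrier M = carrier N" "fin_gen A M"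
  shows "fin_gen A N"
proof -
  obtain X where X: "finite X" "X \<subseteq> carrier M" "\<And>K. submodule K A M \<Longrightarrow> X \<subseteq> K \<Longrightarrow> K = carrier M"
    using assms(2) unfolding fin_gen_def by blast
  have "K = carrier N" if K: "submodule K A N" "h ` X \<subseteq> K" for K
  proof -
    have "{x \<in> carrier M. h x \<in> K} = carrier M"
      by (rule X(3)[OF submodule_vimage[OF K(1)]]) (use X(2) K(2) in auto)
    then have "h ` carrier M \<subseteq> K" by blast
    then have "carrier N \<subseteq> K" using assms(1) by simp
    then show ?thesis using cod.submoduleD(1)[OF K(1)] by auto
  qed
  then show ?thesis unfolding fin_gen_def using X by (intro exI[of _ "h ` X"]) auto
qed

text \<open>The structure of \<open>M\<close> carried along an injection \<open>c\<close>, which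
  moves a module to another element type.\<close>

definition transport :: "('b \<Rightarrow> 'c) \<Rightarrow> ('a, 'b) module \<Rightarrow> ('a, 'c) module" where
  "transport c M = \<lparr>carrier = c ` carrier M, mult = undefined, one = undefined, zero = c \<zero>\<^bsub>M\<^esub>,
     add = \<lambda>u v. c (inv_into (carrier M) c u \<oplus>\<^bsub>M\<^esub> inv_into (carrier M) c v),
     smult = \<lambda>a u. c (a \<odot>\<^bsub>M\<^esub> inv_into (carrier M) c u)\<rparr>"

lemma transport:
  assumes M: "left_module A M" and c: "inj_on c (carrier M)"
  shows "linear_map A M (transport c M) c"
    and "linear_map A (transport c M) M (inv_into (carrier M) c)"
proof -
  interpret left_module A M by fact
  note [simp] = inv_into_f_f[OF c]
  have "abelian_group (transport c M)"
  proof (rule abelian_groupI)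
    fix x assume "x \<in> carrier (transport c M)"
    then obtain y where "y \<in> carrier M" "x = c y" by (auto simp: transport_def)
    then show "\<exists>z\<in>carrier (transport c M). z \<oplus>\<^bsub>transport c M\<^esub> x = \<zero>\<^bsub>transport c M\<^esub>"
      by (intro bexI[of _ "c (\<ominus>\<^bsub>M\<^esub> y)"]) (auto simp: transport_def M.l_neg)
  qed (auto simp: transport_def M.a_ac)
  then have T: "left_module A (transport c M)"
    by (intro left_moduleI R.ring_axioms)
      (auto simp: transport_def smult_l_distr smult_r_distr smult_assoc1)
  show "linear_map A M (transport c M) c" "linear_map A (transport c M) M (inv_into (carrier M) c)"
    by (intro linear_mapI M T; auto simp: transport_def)+
qed

text \<open>An element is encoded by a chosen coefficient vector over a finite generating set,
  renumbered by naturals and wrapped in a singleton to match the element type of test modules. The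
  vector determines the element, so the encoding is injective and the structure can be
  transported.\<close>

lemma test_copy:
  fixes M :: "('a, 'b) module"
  assumes "fg_module A M"
  obtains M' :: "'a test_module" and c d where "fg_module A M'"
    "linear_map A M M' c" "linear_map A M' M d"
    "\<And>x. x \<in> carrier M \<Longrightarrow> d (c x) = x" "\<And>y. y \<in> carrier M' \<Longrightarrow> c (d y) = y"
proof -
  have M: "left_module A M" and fg: "fin_gen A M" using assms by (auto simp: fg_module_def)
  obtain X where X: "finite X" "X \<subseteq> carrier M"
    "linear_map A (direct_sum X (\<lambda>_. regular A)) M (\<lambda>t. \<Oplus>\<^bsub>M\<^esub>x\<in>X. t x \<odot>\<^bsub>M\<^esub> x)"
    "(\<lambda>t. \<Oplus>\<^bsub>M\<^esub>x\<in>X. t x \<odot>\<^bsub>M\<^esub> x) ` carrier (direct_sum X (\<lambda>_. regular A)) = carrier M"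
    by (rule fin_gen_span[OF M fg])
  obtain f :: "'b \<Rightarrow> nat" where f: "inj_on f X"
    using finite_imp_inj_to_nat_seg[OF X(1)] by blast
  define t where "t x = (SOME t. t \<in> carrier (direct_sum X (\<lambda>_. regular A)) \<and> (\<Oplus>\<^bsub>M\<^esub>y\<in>X. t y \<odot>\<^bsub>M\<^esub> y) = x)" for x
  have t: "t x \<in> extensional X" "(\<Oplus>\<^bsub>M\<^esub>y\<in>X. t x y \<odot>\<^bsub>M\<^esub> y) = x" if "x \<in> carrier M" for x
  proof -
    have "\<exists>t. t \<in> carrier (direct_sum X (\<lambda>_. regular A)) \<and> (\<Oplus>\<^bsub>M\<^esub>y\<in>X. t y \<odot>\<^bsub>M\<^esub> y) = x"
      using that unfolding X(4)[symmetric] by blast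
    from someI_ex[OF this] show "t x \<in> extensional X" "(\<Oplus>\<^bsub>M\<^esub>y\<in>X. t x y \<odot>\<^bsub>M\<^esub> y) = x"
      by (auto simp: t_def PiE_iff)
  qed
  define c :: "'b \<Rightarrow> (nat \<Rightarrow> 'a) set" where "c x = {\<lambda>n. t x (inv_into X f n)}" for x
  have c: "inj_on c (carrier M)"
  proof (rule inj_onI)
    fix x y assume xy: "x \<in> carrier M" "y \<in> carrier M" "c x = c y"
    have "t x i = t y i" if "i \<in> X" for i
      using xy(3) that fun_cong[of "\<lambda>n. t x (inv_into X f n)" "\<lambda>n. t y (inv_into X f n)" "f i"]
      by (simp add: c_def inv_into_f_f[OF f])
    then have "t x = t y" using t(1)[OF xy(1)] t(1)[OF xy(2)] by (intro extensionalityI) auto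
    then show "x = y" using t(2) xy by metis
  qed
  note T = transport[OF M c]
  have carr: "c ` carrier M = carrier (transport c M)" by (simp add: transport_def)
  interpret T1: linear_map A M "transport c M" c by (rule T(1))
  have "fg_module A (transport c M)"
    unfolding fg_module_def using T1.fin_gen_surj[OF carr fg] T1.cod.left_module_axioms by blast
  then show ?thesis
  proof (rule that[OF _ T])
    show "inv_into (carrier M) c (c x) = x" if "x \<in> carrier M" for x
      by (rule inv_into_f_f[OF c that])
    show "c (inv_into (carrier M) c y) = y" if "y \<in> carrier (transport c M)" for y
      using that unfolding carr[symmetric] by (rule f_inv_into_f)
  qed
qed

text \<open>The definition of \<open>projective\<close> tests against modules of a single type.
  Conjugating \<open>g\<close> and \<open>h\<close> with the isomorphisms of
  \<open>test_copy\<close> frees the lifting property from that type; the same device serves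
  injectives and cogenerators.\<close>

lemma projective_lift:
  assumes P: "projective A P" and X: "fg_module A X" and Y: "fg_module A Y"
    and g: "linear_map A X Y g" "g ` carrier X = carrier Y" and h: "linear_map A P Y h"
  shows "\<exists>k. linear_map A P X k \<and> (\<forall>x\<in>carrier P. g (k x) = h x)"
proof -
  obtain X' :: "'a test_module" and cX dX where X': "fg_module A X'"
    "linear_map A X X' cX" "linear_map A X' X dX" "\<And>x. x \<in> carrier X \<Longrightarrow> dX (cX x) = x"
    "\<And>y. y \<in> carrier X' \<Longrightarrow> cX (dX y) = y" by (rule test_copy[OF X]) blast
  obtain Y' :: "'a test_module" and cY dY where Y': "fg_module A Y'"
    "linear_map A Y Y' cY" "linear_map A Y' Y dY" "\<And>x. x \<in> carrier Y \<Longrightarrow> dY (cY x) = x"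
    "\<And>y. y \<in> carrier Y' \<Longrightarrow> cY (dY y) = y" by (rule test_copy[OF Y]) blast
  interpret g: linear_map A X Y g by (rule g)
  interpret h: linear_map A P Y h by (rule h)
  interpret cX: linear_map A X X' cX by (rule X')
  interpret dX: linear_map A X' X dX by (rule X')
  interpret cY: linear_map A Y Y' cY by (rule Y')
  interpret dY: linear_map A Y' Y dY by (rule Y')
  interpret gg: linear_map A X' Y' "\<lambda>x. cY (g (dX x))"
    by (rule linear_map_comp[OF linear_map_comp[OF X'(3) g(1)] Y'(2)])
  interpret hh: linear_map A P Y' "\<lambda>x. cY (h x)"
    by (rule linear_map_comp[OF h Y'(2)])
  have "restrict (\<lambda>x. cY (g (dX x))) (carrier X') ` carrier X' = carrier Y'"
  proof
    show "carrier Y' \<subseteq> restrict (\<lambda>x. cY (g (dX x))) (carrier X') ` carrier X'"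
    proof
      fix y assume y: "y \<in> carrier Y'"
      then have "dY y \<in> g ` carrier X" using g(2) by simp
      then obtain x where "x \<in> carrier X" "dY y = g x" by blast
      then have "y = restrict (\<lambda>x. cY (g (dX x))) (carrier X') (cX x)" "cX x \<in> carrier X'"
        using X'(4) Y'(5)[OF y] by simp_all
      then show "y \<in> restrict (\<lambda>x. cY (g (dX x))) (carrier X') ` carrier X'" by (rule image_eqI)
    qed
  qed (auto)
  then obtain k where k: "k \<in> module_Hom A P X'"
    "\<And>x. x \<in> carrier P \<Longrightarrow> restrict (\<lambda>x. cY (g (dX x))) (carrier X') (k x) = restrict (\<lambda>x. cY (h x)) (carrier P) x"
    using P X'(1) Y'(1) gg.in_module_Hom hh.in_module_Hom unfolding projective_def by metis
  interpret k: linear_map A P X' k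
    by (rule linear_map_of_Hom[OF h.dom.left_module_axioms cX.cod.left_module_axioms k(1)])
  have "g (dX (k x)) = h x" if x: "x \<in> carrier P" for x
  proof -
    have "cY (g (dX (k x))) = cY (h x)" using k(2)[OF x] x by simp
    then have "dY (cY (g (dX (k x)))) = dY (cY (h x))" by simp
    then show ?thesis using Y'(4) x by simp
  qed
  then show ?thesis using linear_map_comp[OF k.linear_map_axioms X'(3)] by blast
qed

lemma injective_extend:
  assumes I: "injective A I" and X: "fg_module A X" and Y: "fg_module A Y"
    and g: "linear_map A X Y g" "inj_on g (carrier X)" and h: "linear_map A X I h"
  shows "\<exists>k. linear_map A Y I k \<and> (\<forall>x\<in>carrier X. k (g x) = h x)"
proof -
  obtain X' :: "'a test_module" and cX dX where X': "fg_module A X'"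
    "linear_map A X X' cX" "linear_map A X' X dX" "\<And>x. x \<in> carrier X \<Longrightarrow> dX (cX x) = x"
    "\<And>y. y \<in> carrier X' \<Longrightarrow> cX (dX y) = y" by (rule test_copy[OF X]) blast
  obtain Y' :: "'a test_module" and cY dY where Y': "fg_module A Y'"
    "linear_map A Y Y' cY" "linear_map A Y' Y dY" "\<And>x. x \<in> carrier Y \<Longrightarrow> dY (cY x) = x"
    "\<And>y. y \<in> carrier Y' \<Longrightarrow> cY (dY y) = y" by (rule test_copy[OF Y]) blast
  interpret g: linear_map A X Y g by (rule g)
  interpret h: linear_map A X I h by (rule h)
  interpret cX: linear_map A X X' cX by (rule X')
  interpret dX: linear_map A X' X dX by (rule X')
  interpret cY: linear_map A Y Y' cY by (rule Y')
  interpret dY: linear_map A Y' Y dY by (rule Y')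
  interpret gg: linear_map A X' Y' "\<lambda>x. cY (g (dX x))"
    by (rule linear_map_comp[OF linear_map_comp[OF X'(3) g(1)] Y'(2)])
  interpret hh: linear_map A X' I "\<lambda>x. h (dX x)"
    by (rule linear_map_comp[OF X'(3) h])
  have "inj_on (restrict (\<lambda>x. cY (g (dX x))) (carrier X')) (carrier X')"
  proof (rule inj_onI)
    fix x y assume xy: "x \<in> carrier X'" "y \<in> carrier X'"
      "restrict (\<lambda>x. cY (g (dX x))) (carrier X') x = restrict (\<lambda>x. cY (g (dX x))) (carrier X') y"
    then have "dY (cY (g (dX x))) = dY (cY (g (dX y)))" by simp
    then have "g (dX x) = g (dX y)" using Y'(4) xy by simp
    then have "dX x = dX y" using g(2) xy dX.closed by (meson inj_onD)
    then show "x = y" using X'(5) xy by metis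
  qed
  then obtain k where k: "k \<in> module_Hom A Y' I"
    "\<And>x. x \<in> carrier X' \<Longrightarrow> k (restrict (\<lambda>x. cY (g (dX x))) (carrier X') x) = restrict (\<lambda>x. h (dX x)) (carrier X') x"
    using I X'(1) Y'(1) gg.in_module_Hom hh.in_module_Hom unfolding injective_def by metis
  interpret k: linear_map A Y' I k
    by (rule linear_map_of_Hom[OF cY.cod.left_module_axioms h.cod.left_module_axioms k(1)])
  have "k (cY (g x)) = h x" if x: "x \<in> carrier X" for x
    using k(2)[of "cX x"] X'(4) x by simp
  then show ?thesis using linear_map_comp[OF Y'(2) k.linear_map_axioms] by blast
qed

lemma cogenerator_separates:
  assumes I: "cogenerator A I" and X: "fg_module A X" and x: "x \<in> carrier X" "x \<noteq> \<zero>\<^bsub>X\<^esub>"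
  shows "\<exists>h. linear_map A X I h \<and> h x \<noteq> \<zero>\<^bsub>I\<^esub>"
proof -
  obtain X' :: "'a test_module" and cX dX where X': "fg_module A X'"
    "linear_map A X X' cX" "linear_map A X' X dX" "\<And>x. x \<in> carrier X \<Longrightarrow> dX (cX x) = x"
    "\<And>y. y \<in> carrier X' \<Longrightarrow> cX (dX y) = y" by (rule test_copy[OF X]) blast
  interpret cX: linear_map A X X' cX by (rule X')
  interpret dX: linear_map A X' X dX by (rule X')
  have "cX x \<noteq> \<zero>\<^bsub>X'\<^esub>" using X'(4)[OF x(1)] x(2) dX.zero by metis
  then obtain h where h: "h \<in> module_Hom A X' I" "h (cX x) \<noteq> \<zero>\<^bsub>I\<^esub>"
    using I X'(1) cX.closed[OF x(1)] unfolding cogenerator_def by blast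
  have "left_module A I" using I by (simp add: cogenerator_def fg_module_def)
  from linear_map_comp[OF X'(2) linear_map_of_Hom[OF cX.cod.left_module_axioms this h(1)]] h(2)
  show ?thesis by blast
qed

section \<open>Artinian commutative rings and artin algebras\<close>

text \<open>The union of a chain of submodules that avoid \<open>w\<close> avoids \<open>w\<close>,
  so Zorn applies. A rank argument would be circular, as one use is on the way to finite length of
  \<open>R\<close>.\<close>

lemma (in left_module) maximal_avoiding:
  assumes "submodule N R M" "w \<notin> N"
  shows "\<exists>H. submodule H R M \<and> N \<subseteq> H \<and> w \<notin> H \<and> (\<forall>K. submodule K R M \<longrightarrow> H \<subset> K \<longrightarrow> w \<in> K)"
proof -
  let ?A = "{H. submodule H R M \<and> N \<subseteq> H \<and> w \<notin> H}"
  have "\<exists>H\<in>?A. \<forall>X\<in>?A. H \<subseteq> X \<longrightarrow> X = H"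
  proof (rule subset_Zorn_nonempty)
    show "?A \<noteq> {}" using assms by blast
    fix C assume C: "C \<noteq> {}" "subset.chain ?A C"
    then have sub: "submodule H R M" "N \<subseteq> H" "w \<notin> H" if "H \<in> C" for H
      using that by (auto simp: subset.chain_def)
    have tot: "H \<subseteq> K \<or> K \<subseteq> H" if "H \<in> C" "K \<in> C" for H K
      using C(2) that by (auto simp: subset_chain_def)
    have "submodule (\<Union>C) R M"
    proof (rule submoduleI)
      show "\<Union>C \<subseteq> carrier M" using sub(1) submoduleD(1) by blast
      show "\<zero>\<^bsub>M\<^esub> \<in> \<Union>C" using sub(1) submoduleD(3) C(1) by blast
      show "x \<oplus>\<^bsub>M\<^esub> y \<in> \<Union>C" if xy: "x \<in> \<Union>C" "y \<in> \<Union>C" for x y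
      proof -
        from xy obtain H K where HK: "H \<in> C" "K \<in> C" "x \<in> H" "y \<in> K" by blast
        from tot[OF HK(1,2)] obtain L where "L \<in> C" "x \<in> L" "y \<in> L" using HK by blast
        then show ?thesis using submoduleD(4)[OF sub(1)] by blast
      qed
      show "a \<odot>\<^bsub>M\<^esub> x \<in> \<Union>C" if "a \<in> carrier R" "x \<in> \<Union>C" for a x
        using that submoduleD(5)[OF sub(1)] by blast
    qed
    then show "\<Union>C \<in> ?A" using sub C(1) by blast
  qed
  then obtain H where H: "submodule H R M" "N \<subseteq> H" "w \<notin> H" "\<forall>X\<in>?A. H \<subseteq> X \<longrightarrow> X = H"
    by (elim bexE CollectE conjE)
  have "w \<in> K" if K: "submodule K R M" "H \<subset> K" for K
  proof (rule ccontr)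
    assume w: "w \<notin> K"
    have "K \<in> ?A" using K(1) w subset_trans[OF H(2) psubset_imp_subset[OF K(2)]] by simp
    then show False using H(4) K(2) by blast
  qed
  then show ?thesis using H(1-3) by (intro exI[of _ H]) simp
qed

lemma (in cring) ideal_iff_submodule: "ideal I R \<longleftrightarrow> submodule I R (regular R)"
proof -
  interpret reg: left_module R "regular R" by (rule left_module_regular[OF ring_axioms])
  show ?thesis
  proof
    assume "ideal I R"
    then interpret ideal I R .
    show "submodule I R (regular R)"
      by (rule reg.submoduleI) (use a_subset I_l_closed in auto)
  next
    assume s: "submodule I R (regular R)"
    show "ideal I R"
    proof (rule idealI[OF ring_axioms])
      show "subgroup I (add_monoid R)"
        using reg.submoduleD[OF s] reg.submodule_a_inv[OF s] ring_axioms
        by (intro subgroup.intro) (auto simp: a_inv_def[symmetric])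
      show "x \<otimes> a \<in> I" if "a \<in> I" "x \<in> carrier R" for a x
        using reg.submoduleD(5)[OF s that(2,1)] by simp
      then show "a \<otimes> x \<in> I" if "a \<in> I" "x \<in> carrier R" for a x
        using that reg.submoduleD(2)[OF s that(1)] m_comm[of a x] by simp
    qed
  qed
qed

text \<open>The chain condition turned into the minimum condition: without a minimal member,
  dependent choice produces a strictly descending sequence.\<close>

lemma artinian_minimal_ideal:
  assumes "artinian R" "P I0" "\<And>I. P I \<Longrightarrow> ideal I R"
  shows "\<exists>I. P I \<and> (\<forall>I'. P I' \<longrightarrow> I' \<subseteq> I \<longrightarrow> I' = I)"
proof (rule ccontr)
  assume "\<not> ?thesis"
  then have step: "\<exists>I'. P I' \<and> I' \<subset> I" if "P I" for I using that by blast
  have "\<exists>f. \<forall>n::nat. P (f n) \<and> f (Suc n) \<subset> f n"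
    by (rule dependent_nat_choice) (use assms(2) step in auto)
  then obtain f where f: "\<And>n::nat. P (f n)" "\<And>n. f (Suc n) \<subset> f n" by blast
  then have "\<forall>n. ideal (f n) R \<and> f (Suc n) \<subseteq> f n" using assms(3) by blast
  then obtain n where n: "\<And>m. n \<le> m \<Longrightarrow> f m = f n" using assms(1) unfolding artinian_def by blast
  have "f (Suc n) = f n" by (rule n) simp
  then show False using f(2)[of n] by simp
qed

section \<open>Artinian commutative rings have finite length\<close>

locale artinian_cring = cring R for R :: "('a, 'm) ring_scheme" (structure) +
  assumes artinian: "artinian R"
begin

sublocale reg: left_module R "regular R"
  by (rule left_module_regular[OF ring_axioms])

abbreviation "max_ideal m \<equiv> maximal_submodule R (regular R) m"

lemma max_idealD:
  assumes "max_ideal m"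
  shows "ideal m R" "submodule m R (regular R)" "\<one> \<notin> m"
    "\<And>Z. submodule Z R (regular R) \<Longrightarrow> m \<subset> Z \<Longrightarrow> Z = carrier R"
proof -
  show m: "submodule m R (regular R)" using assms by (simp add: maximal_submodule_def)
  then show "ideal m R" by (simp add: ideal_iff_submodule)
  show "\<one> \<notin> m"
  proof
    assume one: "\<one> \<in> m"
    have "a \<in> m" if "a \<in> carrier R" for a
      using reg.submoduleD(5)[OF m that one] that by simp
    then show False using assms reg.submoduleD(1)[OF m] by (auto simp: maximal_submodule_def)
  qed
  show "\<And>Z. submodule Z R (regular R) \<Longrightarrow> m \<subset> Z \<Longrightarrow> Z = carrier R"
    using assms unfolding maximal_submodule_def regular_simps(1) by blast
qed

lemma max_ideal_above:
  assumes N: "submodule N R (regular R)" "N \<noteq> carrier R"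
  shows "\<exists>m. max_ideal m \<and> N \<subseteq> m"
proof -
  have up: "K = carrier R" if "submodule K R (regular R)" "\<one> \<in> K" for K
  proof -
    have "a \<in> K" if "a \<in> carrier R" for a
      using reg.submoduleD(5)[OF \<open>submodule K R (regular R)\<close> that \<open>\<one> \<in> K\<close>] that by simp
    then show ?thesis using reg.submoduleD(1)[OF that(1)] by auto
  qed
  then have "\<one> \<notin> N" using N by blast
  from reg.maximal_avoiding[OF N(1) this] obtain H where
    H: "submodule H R (regular R)" "N \<subseteq> H" "\<one> \<notin> H" "\<And>K. submodule K R (regular R) \<Longrightarrow> H \<subset> K \<Longrightarrow> \<one> \<in> K"
    by blast
  have "H \<noteq> carrier R" using H(3) by auto
  then have "max_ideal H" unfolding maximal_submodule_def using H(1,4) up by auto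
  then show ?thesis using H(2) by blast
qed

lemma max_ideal_inverse:
  assumes "max_ideal m" "r \<in> carrier R" "r \<notin> m"
  shows "\<exists>s\<in>carrier R. \<one> \<ominus> s \<otimes> r \<in> m"
proof -
  note m = max_idealD[OF assms(1)]
  have C: "submodule (cyclic R (regular R) r) R (regular R)" using assms by (simp add: reg.submodule_cyclic)
  have "r \<in> m <+>\<^bsub>regular R\<^esub> cyclic R (regular R) r"
    using reg.set_add_upper(2)[OF m(2) C] reg.cyclic_self assms by auto
  then have "m <+>\<^bsub>regular R\<^esub> cyclic R (regular R) r = carrier R"
    using reg.set_add_upper(1)[OF m(2) C] assms(3)
    by (intro m(4) reg.submodule_set_add m(2) C) auto
  then have "\<one> \<in> m <+>\<^bsub>regular R\<^esub> cyclic R (regular R) r" by simp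
  then obtain a s where as: "a \<in> m" "s \<in> carrier R" "\<one> = a \<oplus> s \<otimes> r"
    by (auto simp: cyclic_def elim!: reg.set_addE)
  have ac: "a \<in> carrier R" using reg.submoduleD(2)[OF m(2) as(1)] by simp
  have "\<one> \<ominus> s \<otimes> r = a"
    using reg.add_minus_cancel_right[of a "s \<otimes> r"] as ac assms ring_axioms by simp
  then have "\<one> \<ominus> s \<otimes> r \<in> m" using as(1) by (rule ssubst)
  then show ?thesis using as(2) by blast
qed

text \<open>Ideals that multiplication by a maximal ideal never makes smaller. Showing that only
  zero is of this kind takes the place of the vanishing of a product of maximal ideals, and with it
  of the finiteness of the set of maximal ideals.\<close>

definition divisible :: "'a set \<Rightarrow> bool" where
  "divisible X \<longleftrightarrow> ideal X R \<and> (\<forall>m. max_ideal m \<longrightarrow> X \<cdot> m = X)"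

text \<open>
  The ideal \<open>P\<close> of the proof stands for a product of maximal ideals that is too long to shrink further.
\<close>

lemma divisible_zero:
  assumes "divisible X"
  shows "X = {\<zero>}"
proof -
  let ?Q = "\<lambda>P. ideal P R \<and> (\<forall>X. divisible X \<longrightarrow> X \<cdot> P = X)"
  have "?Q (carrier R)" by (auto simp: divisible_def ideal_prod_one oneideal)
  from artinian_minimal_ideal[where P = ?Q, OF artinian this] obtain P
    where P: "ideal P R" "\<And>X. divisible X \<Longrightarrow> X \<cdot> P = X" and min: "\<And>P'. ?Q P' \<Longrightarrow> P' \<subseteq> P \<Longrightarrow> P' = P"
    by blast
  \<comment> \<open>A further factor \<open>m\<close> still leaves every divisible ideal fixed, so
    minimality gives \<open>P m = P\<close>. Hence \<open>P\<close> is itself divisible and fixes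
    itself, \<open>P P = P\<close>.\<close>
  have Pm: "P \<cdot> m = P" if m: "max_ideal m" for m
  proof (rule min)
    note mi = max_idealD(1)[OF m]
    show "P \<cdot> m \<subseteq> P" using ideal_prod_inter[OF P(1) mi] by blast
    have "X \<cdot> (P \<cdot> m) = X" if X: "divisible X" for X
    proof -
      have "X \<cdot> (P \<cdot> m) = (X \<cdot> P) \<cdot> m"
        using X P(1) mi by (simp add: divisible_def ideal_prod_assoc)
      then show ?thesis using X m P(2)[OF X] by (simp add: divisible_def)
    qed
    then show "?Q (P \<cdot> m)" using ideal_prod_is_ideal[OF P(1) mi] by blast
  qed
  then have divP: "divisible P" using P(1) by (simp add: divisible_def)
  have PP: "P \<cdot> P = P" by (rule P(2)[OF divP])
  have le: "p \<in> m" if "p \<in> P" "max_ideal m" for p m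
    using Pm[OF that(2)] ideal_prod_inter[OF P(1) max_idealD(1)[OF that(2)]] that(1) by blast
  interpret P: ideal P R by (rule P(1))
  \<comment> \<open>As \<open>P = P P\<close>, an element annihilating all products of two elements
    of \<open>P\<close> annihilates \<open>P\<close>.\<close>
  have kill: "x = \<zero>" if l: "l \<in> carrier R" and z: "\<And>p q. p \<in> P \<Longrightarrow> q \<in> P \<Longrightarrow> l \<otimes> (p \<otimes> q) = \<zero>"
    and p: "p \<in> P" and x: "x = l \<otimes> p" for l p x
  proof -
    have "p' \<in> carrier R \<and> l \<otimes> p' = \<zero>" if "p' \<in> P \<cdot> P" for p'
      using that by induct (use z l P.Icarr in \<open>auto simp: r_distr\<close>)
    then show ?thesis using PP p x by auto
  qed
  have "P = {\<zero>}"
  proof (rule ccontr)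
    assume ne: "P \<noteq> {\<zero>}"
    \<comment> \<open>Take \<open>L\<close> minimal among the ideals not annihilated by
      \<open>P\<close>. If \<open>l\<close> in \<open>L\<close> has \<open>l P\<close> nonzero, then
      \<open>l P\<close> is again not annihilated, so \<open>l P = L\<close> and
      \<open>l = l q\<close> with \<open>q\<close> in \<open>P\<close>. As \<open>q\<close> lies in
      all maximal ideals, \<open>1 - q\<close> is invertible and \<open>l = 0\<close>.\<close>
    let ?C = "\<lambda>L. ideal L R \<and> (\<exists>l\<in>L. \<exists>p\<in>P. l \<otimes> p \<noteq> \<zero>)"
    have "?C P"
    proof (rule ccontr)
      assume "\<not> ?C P"
      then have "p \<otimes> q = \<zero>" if "p \<in> P" "q \<in> P" for p q using P(1) that by blast
      then have "x = \<zero>" if "x \<in> P" for x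
        using kill[of \<one> x x] that P.Icarr by auto
      then show False using ne P.zero_closed by blast
    qed
    from artinian_minimal_ideal[where P = ?C, OF artinian this] obtain L
      where L: "?C L" and minL: "\<And>L'. ?C L' \<Longrightarrow> L' \<subseteq> L \<Longrightarrow> L' = L" by blast
    then obtain l p where lp: "l \<in> L" "p \<in> P" "l \<otimes> p \<noteq> \<zero>" by blast
    interpret L: ideal L R using L by blast
    have lc: "l \<in> carrier R" using lp L.Icarr by blast
    interpret lm: linear_map R "regular R" "regular R" "\<lambda>x. l \<otimes> x"
      by unfold_locales (use lc in \<open>auto simp: r_distr m_ac\<close>)
    have "?C ((\<lambda>x. l \<otimes> x) ` P)"
    proof
      show "ideal ((\<lambda>x. l \<otimes> x) ` P) R"
        using lm.submodule_image[of P] P(1) by (simp add: ideal_iff_submodule)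
      show "\<exists>y\<in>(\<lambda>x. l \<otimes> x) ` P. \<exists>p\<in>P. y \<otimes> p \<noteq> \<zero>"
      proof (rule ccontr)
        assume "\<not> ?thesis"
        then have "l \<otimes> (p \<otimes> q) = \<zero>" if "p \<in> P" "q \<in> P" for p q
          using that lc P.Icarr by (auto simp: m_assoc)
        then show False using kill[OF lc _ lp(2) refl] lp(3) by blast
      qed
    qed
    then have "(\<lambda>x. l \<otimes> x) ` P = L"
      by (rule minL) (use lp(1) P.Icarr L.I_r_closed in auto)
    then obtain q where q: "q \<in> P" "l = l \<otimes> q" using lp(1) by auto
    have qc: "q \<in> carrier R" using q P.Icarr by blast
    let ?N = "cyclic R (regular R) (\<one> \<ominus> q)"
    have N: "submodule ?N R (regular R)" using qc by (simp add: reg.submodule_cyclic)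
    have "?N = carrier R"
    proof (rule ccontr)
      assume "?N \<noteq> carrier R"
      from max_ideal_above[OF N this] obtain m where m: "max_ideal m" "?N \<subseteq> m" by blast
      note D = max_idealD[OF m(1)]
      have "\<one> \<ominus> q \<in> m" using m(2) reg.cyclic_self[of "\<one> \<ominus> q"] qc by auto
      then have "(\<one> \<ominus>\<^bsub>regular R\<^esub> q) \<oplus>\<^bsub>regular R\<^esub> q \<in> m"
        using reg.submoduleD(4)[OF D(2)] le[OF q(1) m(1)] qc ring_axioms by simp
      then show False using D(3) reg.minus_add_cancel[of \<one> q] qc by simp
    qed
    then have "\<one> \<in> ?N" by simp
    then obtain u where u: "u \<in> carrier R" "\<one> = u \<otimes> (\<one> \<ominus> q)" by (auto simp: cyclic_def)
    have "l = l \<otimes> (u \<otimes> (\<one> \<ominus> q))" using u lc by simp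
    also have "\<dots> = u \<otimes> (l \<ominus> l \<otimes> q)"
      using u(1) lc qc by (simp add: minus_eq r_distr r_minus m_ac)
    also have "l \<ominus> l \<otimes> q = \<zero>" using q(2) lc by (simp add: minus_eq r_neg)
    finally have "l = \<zero>" using u(1) by simp
    then show False using lp P.Icarr by auto
  qed
  then show ?thesis using P(2)[OF assms] assms ideal_prod_zero[of X] by (simp add: divisible_def)
qed

text \<open>Some maximal ideal has \<open>X m \<noteq> X\<close>, so \<open>X / X m\<close> is a
  nonzero vector space over \<open>R / m\<close>, and a subspace maximal among those avoiding a
  vector \<open>w\<close> is a hyperplane. For \<open>y\<close> outside \<open>H\<close>, the
  relation \<open>w = h + r y\<close> has \<open>r\<close> outside \<open>m\<close>, and an inverse
  of \<open>r\<close> modulo \<open>m\<close> recovers \<open>y\<close>.\<close>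

lemma ex_covers_below_ideal:
  assumes X: "submodule X R (regular R)" "X \<noteq> {\<zero>}"
  shows "\<exists>H. covers R (regular R) H X"
proof -
  have "\<not> divisible X" using divisible_zero X(2) by blast
  then obtain m where m: "max_ideal m" "X \<cdot> m \<noteq> X"
    using X(1) by (auto simp: divisible_def ideal_iff_submodule)
  note D = max_idealD[OF m(1)]
  have Xi: "ideal X R" using X(1) by (simp add: ideal_iff_submodule)
  have "X \<cdot> m \<subseteq> X" using ideal_prod_inter[OF Xi D(1)] by blast
  then obtain w where w: "w \<in> X" "w \<notin> X \<cdot> m" using m(2) by blast
  interpret XM: left_module R "(regular R)\<lparr>carrier := X\<rparr>" by (rule reg.left_module_sub[OF X(1)])
  have "submodule (X \<cdot> m) R ((regular R)\<lparr>carrier := X\<rparr>)"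
    using ideal_prod_is_ideal[OF Xi D(1)] \<open>X \<cdot> m \<subseteq> X\<close>
    by (simp add: reg.submodule_sub_iff[OF X(1)] ideal_iff_submodule)
  from XM.maximal_avoiding[OF this w(2)] obtain H
    where H: "submodule H R (regular R)" "H \<subseteq> X" "X \<cdot> m \<subseteq> H" "w \<notin> H"
      "\<And>K. submodule K R (regular R) \<Longrightarrow> K \<subseteq> X \<Longrightarrow> H \<subset> K \<Longrightarrow> w \<in> K"
    unfolding reg.submodule_sub_iff[OF X(1)] by blast
  note HD = reg.submoduleD[OF H(1)] and XD = reg.submoduleD[OF X(1)]
  have "Z = X" if Z: "submodule Z R (regular R)" "H \<subset> Z" "Z \<subseteq> X" for Z
  proof -
    note ZD = reg.submoduleD[OF Z(1)]
    have wZ: "w \<in> Z" using H(5) Z by blast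
    have "y \<in> Z" if y: "y \<in> X" "y \<notin> H" for y
    proof -
      have yc: "y \<in> carrier (regular R)" using XD y by blast
      have C: "submodule (cyclic R (regular R) y) R (regular R)" by (rule reg.submodule_cyclic[OF yc])
      have "y \<in> H <+>\<^bsub>regular R\<^esub> cyclic R (regular R) y"
        using reg.set_add_upper(2)[OF H(1) C] reg.cyclic_self[OF yc] by blast
      then have "w \<in> H <+>\<^bsub>regular R\<^esub> cyclic R (regular R) y"
        using y(2) reg.set_add_upper(1)[OF H(1) C]
        by (intro H(5) reg.submodule_set_add H(1) C reg.set_add_least[OF X(1)] H(2)
            reg.cyclic_least[OF X(1) y(1)]) auto
      then obtain h r where hr: "h \<in> H" "r \<in> carrier R" "w = h \<oplus> r \<otimes> y"
        by (auto simp: cyclic_def elim!: reg.set_addE)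
      have c: "h \<in> carrier R" "y \<in> carrier R" using HD(2)[OF hr(1)] yc by simp_all
      have "r \<notin> m"
      proof
        assume "r \<in> m"
        from subsetD[OF H(3) ideal_prod.prod[OF y(1) this]] have "y \<otimes> r \<in> H" .
        then have "h \<oplus> r \<otimes> y \<in> H" using HD(4)[OF hr(1)] c hr(2) by (simp add: m_comm)
        then show False using hr(3) H(4) by simp
      qed
      then obtain s where s: "s \<in> carrier R" "\<one> \<ominus> s \<otimes> r \<in> m"
        using max_ideal_inverse[OF m(1) hr(2)] by blast
      have ry: "r \<otimes> y \<in> Z"
      proof -
        have "w \<ominus>\<^bsub>regular R\<^esub> h \<in> Z" using wZ hr(1) Z(2) by (intro reg.submodule_minus[OF Z(1)]) auto
        moreover have "w \<ominus>\<^bsub>regular R\<^esub> h = r \<otimes> y"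
          using reg.add_minus_cancel_right[of "r \<otimes> y" h] hr c by (simp add: a_comm)
        ultimately show ?thesis by simp
      qed
      have "y \<otimes> (\<one> \<ominus> s \<otimes> r) \<in> Z"
        using subsetD[OF H(3) ideal_prod.prod[OF y(1) s(2)]] Z(2) by blast
      moreover have "s \<otimes> (r \<otimes> y) \<in> Z" using ZD(5)[OF s(1) ry] by simp
      ultimately have "y \<otimes> (\<one> \<ominus> s \<otimes> r) \<oplus> s \<otimes> (r \<otimes> y) \<in> Z" using ZD(4) by simp
      moreover have "y \<otimes> (\<one> \<ominus> s \<otimes> r) \<oplus> s \<otimes> (r \<otimes> y) = y"
        using c s(1) hr(2) by (simp add: minus_eq r_distr r_minus a_assoc m_ac l_neg)
      ultimately show ?thesis by simp
    qed
    then show ?thesis using Z by blast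
  qed
  then show ?thesis using X(1) H w by (auto simp: covers_def)
qed

text \<open>\<open>?G K\<close> says that \<open>R / K\<close> has finite length. By the minimum
  condition there is a minimal such \<open>K\<close>; were it nonzero, a maximal subideal of it
  would again be of this kind.\<close>

theorem finite_length_regular: "finite_length R (regular R)"
proof -
  let ?G = "\<lambda>K. ideal K R \<and> (\<exists>r :: 'a set \<Rightarrow> nat. \<forall>N N'. submodule N R (regular R) \<longrightarrow>
    submodule N' R (regular R) \<longrightarrow> K \<subseteq> N \<longrightarrow> N \<subset> N' \<longrightarrow> r N < r N')"
  have "\<not> N \<subset> N'" if "submodule N' R (regular R)" "carrier R \<subseteq> N" for N N'
    using reg.submoduleD(1)[OF that(1)] that(2) by auto
  then have "?G (carrier R)" using oneideal by blast
  from artinian_minimal_ideal[where P = ?G, OF artinian this] obtain K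
    where K: "?G K" and min: "\<And>K'. ?G K' \<Longrightarrow> K' \<subseteq> K \<Longrightarrow> K' = K" by blast
  have Ks: "submodule K R (regular R)" using K by (simp add: ideal_iff_submodule)
  obtain r :: "'a set \<Rightarrow> nat" where r: "\<And>N N'. submodule N R (regular R) \<Longrightarrow>
    submodule N' R (regular R) \<Longrightarrow> K \<subseteq> N \<Longrightarrow> N \<subset> N' \<Longrightarrow> r N < r N'" using K by blast
  have "K = {\<zero>}"
  proof (rule ccontr)
    assume "K \<noteq> {\<zero>}"
    from ex_covers_below_ideal[OF Ks this] obtain H where H: "covers R (regular R) H K" by blast
    note c = coversD[OF H]
    \<comment> \<open>Extends the rank above \<open>K\<close> to ideals above \<open>H\<close>. The
      second term detects whether \<open>K\<close> is contained; it must jump whenever the sum with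
      \<open>K\<close> stays the same, because \<open>N' \<inter> K\<close> is \<open>H\<close> or
      \<open>K\<close>.\<close>
    define r' where "r' N = r (N <+>\<^bsub>regular R\<^esub> K) + (if K \<subseteq> N then 1 else 0)" for N
    have "r' N < r' N'"
      if N: "submodule N R (regular R)" "submodule N' R (regular R)" "H \<subseteq> N" "N \<subset> N'" for N N'
    proof (cases "N <+>\<^bsub>regular R\<^esub> K = N' <+>\<^bsub>regular R\<^esub> K")
      case False
      have "N <+>\<^bsub>regular R\<^esub> K \<subseteq> N' <+>\<^bsub>regular R\<^esub> K"
        using N(4) reg.set_add_upper[OF N(2) Ks]
        by (intro reg.set_add_least reg.submodule_set_add N(2) Ks) auto
      then have "r (N <+>\<^bsub>regular R\<^esub> K) < r (N' <+>\<^bsub>regular R\<^esub> K)"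
        using False by (intro r reg.submodule_set_add N Ks reg.set_add_upper) auto
      moreover have "K \<subseteq> N \<Longrightarrow> K \<subseteq> N'" using N(4) by blast
      ultimately show ?thesis by (auto simp: r'_def)
    next
      case True
      obtain y where y: "y \<in> N'" "y \<notin> N" using N(4) by blast
      have "y \<in> N <+>\<^bsub>regular R\<^esub> K"
        using True y(1) reg.set_add_upper(1)[OF N(2) Ks] by blast
      then obtain n k where nk: "n \<in> N" "k \<in> K" "y = n \<oplus>\<^bsub>regular R\<^esub> k" by (elim reg.set_addE)
      have kc: "k \<in> carrier (regular R)" "n \<in> carrier (regular R)"
        using nk reg.submoduleD(2) Ks N(1) by blast+
      have "k \<oplus>\<^bsub>regular R\<^esub> n \<in> N'" using y(1) nk kc by (simp add: a_comm)
      then have kN': "k \<in> N'" using reg.submodule_add_cancel[OF N(2) kc(1)] nk(1) N(4) by blast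
      have kN: "k \<notin> N" using y(2) nk reg.submoduleD(4)[OF N(1)] by blast
      have "N' \<inter> K = H \<or> N' \<inter> K = K"
        using N c(3) by (intro c(4) reg.submodule_Int Ks) auto
      then have "K \<subseteq> N'" using kN' kN nk(2) N(3) by auto
      then show ?thesis using kN nk(2) True by (auto simp: r'_def)
    qed
    then have "?G H" unfolding ideal_iff_submodule by (intro conjI c(1) exI[of _ r'] allI impI)
    from min[OF this] c(3) show False by blast
  qed
  then have "K \<subseteq> N" if "submodule N R (regular R)" for N
    using reg.submoduleD(3)[OF that] by simp
  with r show ?thesis unfolding finite_length_def by (intro exI[of _ r]) simp
qed

end

section \<open>Restriction of scalars along the structure map\<close>

lemma restrict_scalars_simps [simp]:
  "carrier (restrict_scalars \<phi> M) = carrier M" "\<zero>\<^bsub>restrict_scalars \<phi> M\<^esub> = \<zero>\<^bsub>M\<^esub>"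
  "(\<oplus>\<^bsub>restrict_scalars \<phi> M\<^esub>) = (\<oplus>\<^bsub>M\<^esub>)" "a \<odot>\<^bsub>restrict_scalars \<phi> M\<^esub> x = \<phi> a \<odot>\<^bsub>M\<^esub> x"
  by (simp_all add: restrict_scalars_def)

context artin_algebra
begin

lemma phi_closed [simp]: "r \<in> carrier R \<Longrightarrow> \<phi> r \<in> carrier A"
  using structure_map by (rule ring_hom_closed)

lemma left_module_restrict:
  assumes "left_module A M"
  shows "left_module R (restrict_scalars \<phi> M)"
proof -
  interpret M: left_module A M by fact
  have "abelian_group (restrict_scalars \<phi> M)"
  proof (rule abelian_groupI)
    fix x assume "x \<in> carrier (restrict_scalars \<phi> M)"
    then show "\<exists>y\<in>carrier (restrict_scalars \<phi> M). y \<oplus>\<^bsub>restrict_scalars \<phi> M\<^esub> x = \<zero>\<^bsub>restrict_scalars \<phi> M\<^esub>"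
      by (auto intro: bexI[of _ "\<ominus>\<^bsub>M\<^esub> x"] simp: M.M.l_neg)
  qed (auto simp: M.M.a_ac)
  then show ?thesis
    using ring_hom_add[OF structure_map] ring_hom_mult[OF structure_map] ring_hom_one[OF structure_map]
    by (intro left_moduleI R.ring_axioms)
      (auto simp: M.smult_l_distr M.smult_r_distr M.smult_assoc1)
qed

lemma submodule_restrict:
  assumes "left_module A M" "submodule N A M"
  shows "submodule N R (restrict_scalars \<phi> M)"
proof -
  interpret M: left_module A M by fact
  interpret r: left_module R "restrict_scalars \<phi> M" by (rule left_module_restrict[OF assms(1)])
  show ?thesis using M.submoduleD[OF assms(2)] by (intro r.submoduleI) auto
qed

text \<open>Every \<open>A\<close>-submodule is an \<open>R\<close>-submodule, so the same strictly
  monotone function serves.\<close>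

lemma finite_length_of_restrict:
  fixes M :: "('a, 'b) module"
  assumes "left_module A M" "finite_length R (restrict_scalars \<phi> M)"
  shows "finite_length A M"
proof -
  obtain r :: "'b set \<Rightarrow> nat" where
    "\<And>N N'. submodule N R (restrict_scalars \<phi> M) \<Longrightarrow> submodule N' R (restrict_scalars \<phi> M) \<Longrightarrow>
      N \<subset> N' \<Longrightarrow> r N < r N'"
    using assms(2) by (auto elim!: finite_lengthE)
  then show ?thesis
    unfolding finite_length_def using submodule_restrict[OF assms(1)] by (intro exI[of _ r]) simp
qed

lemma linear_map_restrict:
  assumes "linear_map A M N h"
  shows "linear_map R (restrict_scalars \<phi> M) (restrict_scalars \<phi> N) h"
proof -
  interpret linear_map A M N h by fact
  show ?thesis
    by (intro linear_mapI left_module_restrict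
        dom.left_module_axioms cod.left_module_axioms) simp_all
qed

lemma finite_length_R: "finite_length R (regular R)"
proof -
  interpret artinian_cring R by unfold_locales (rule artinian)
  show ?thesis by (rule finite_length_regular)
qed

lemma finite_length_A: "finite_length R (restrict_scalars \<phi> (regular A))"
  by (rule fin_gen_finite_length[OF left_module_restrict fin_gen finite_length_R])
    (rule left_module_regular[OF A.ring_axioms])

text \<open>As \<open>\<phi>\<close> has central values, left and right multiplication by
  \<open>\<phi> r\<close> agree; so \<open>A\<close> and its opposite have the same
  \<open>R\<close>-submodules and finite generation carries over. The second half of the theorem
  rests on this symmetry.\<close>

lemma artin_algebra_op: "artin_algebra R (op_ring A) \<phi>"
proof -
  have op: "ring (op_ring A)" by (rule ring_op_ring[OF A.ring_axioms])
  have hom: "\<phi> \<in> ring_hom R (op_ring A)"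
  proof (rule ring_hom_memI)
    fix x y assume xy: "x \<in> carrier R" "y \<in> carrier R"
    show "\<phi> (x \<otimes> y) = \<phi> x \<otimes>\<^bsub>op_ring A\<^esub> \<phi> y"
      using ring_hom_mult[OF structure_map xy] central[OF xy(1) phi_closed[OF xy(2)]] by simp
  qed (simp_all add: ring_hom_add[OF structure_map] ring_hom_one[OF structure_map])
  interpret l: left_module R "restrict_scalars \<phi> (regular A)"
    by (rule left_module_restrict[OF left_module_regular[OF A.ring_axioms]])
  have "left_module R (restrict_scalars \<phi> (regular (op_ring A)))"
  proof -
    have "abelian_group (restrict_scalars \<phi> (regular (op_ring A)))"
      using l.M.abelian_group_axioms
      unfolding abelian_group_def abelian_monoid_def abelian_group_axioms_def
      by (simp add: restrict_scalars_def regular_def op_ring_def)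
    then show ?thesis
      using l.smult_closed l.smult_l_distr l.smult_r_distr l.smult_assoc1 l.smult_one
      by (intro left_moduleI R.ring_axioms) (simp_all add: central[symmetric])
  qed
  then interpret r: left_module R "restrict_scalars \<phi> (regular (op_ring A))" .
  have "submodule N R (restrict_scalars \<phi> (regular (op_ring A))) \<longleftrightarrow>
      submodule N R (restrict_scalars \<phi> (regular A))" for N
    unfolding l.submodule_iff r.submodule_iff
    by (intro conj_cong refl ball_cong) (auto simp: central[symmetric] subset_iff)
  then have "fin_gen R (restrict_scalars \<phi> (regular (op_ring A)))"
    using fin_gen unfolding fin_gen_def by simp
  then show ?thesis
    using op hom artinian R.is_cring
    by (intro artin_algebra.intro artin_algebra_axioms.intro) (simp_all add: central[symmetric])
qed

lemma finite_length_ring: "finite_length_ring A"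
proof (intro finite_length_ring.intro finite_length_ring_axioms.intro A.ring_axioms)
  show "finite_length A (regular A)"
    by (rule finite_length_of_restrict[OF left_module_regular[OF A.ring_axioms] finite_length_A])
  interpret op: artin_algebra R "op_ring A" \<phi> by (rule artin_algebra_op)
  show "finite_length (op_ring A) (regular (op_ring A))"
    by (rule op.finite_length_of_restrict[OF left_module_regular[OF op.A.ring_axioms] op.finite_length_A])
qed

end

section \<open>Duals and projective covers\<close>

lemma Hom_module_simps [simp]:
  "carrier (Hom_module A M N act) = module_Hom A M N"
  "\<zero>\<^bsub>Hom_module A M N act\<^esub> = (\<lambda>x\<in>carrier M. \<zero>\<^bsub>N\<^esub>)"
  "h \<oplus>\<^bsub>Hom_module A M N act\<^esub> k = (\<lambda>x\<in>carrier M. h x \<oplus>\<^bsub>N\<^esub> k x)"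
  "(\<odot>\<^bsub>Hom_module A M N act\<^esub>) = act"
  by (simp_all add: Hom_module_def)

lemma module_HomD:
  assumes "h \<in> module_Hom A M N"
  shows "h \<in> extensional (carrier M)" "\<And>x. x \<in> carrier M \<Longrightarrow> h x \<in> carrier N"
    "\<And>x y. x \<in> carrier M \<Longrightarrow> y \<in> carrier M \<Longrightarrow> h (x \<oplus>\<^bsub>M\<^esub> y) = h x \<oplus>\<^bsub>N\<^esub> h y"
    "\<And>a x. a \<in> carrier A \<Longrightarrow> x \<in> carrier M \<Longrightarrow> h (a \<odot>\<^bsub>M\<^esub> x) = a \<odot>\<^bsub>N\<^esub> h x"
  using assms by (auto simp: module_Hom_def PiE_def)

lemma module_HomI:
  assumes "h \<in> extensional (carrier M)" "\<And>x. x \<in> carrier M \<Longrightarrow> h x \<in> carrier N"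
    "\<And>x y. x \<in> carrier M \<Longrightarrow> y \<in> carrier M \<Longrightarrow> h (x \<oplus>\<^bsub>M\<^esub> y) = h x \<oplus>\<^bsub>N\<^esub> h y"
    "\<And>a x. a \<in> carrier A \<Longrightarrow> x \<in> carrier M \<Longrightarrow> h (a \<odot>\<^bsub>M\<^esub> x) = a \<odot>\<^bsub>N\<^esub> h x"
  shows "h \<in> module_Hom A M N"
  using assms by (auto simp: module_Hom_def PiE_def)

lemma module_Hom_eqI:
  assumes "h \<in> module_Hom A M N" "k \<in> module_Hom A M N" "\<And>x. x \<in> carrier M \<Longrightarrow> h x = k x"
  shows "h = k"
  using extensionalityI[OF module_HomD(1)[OF assms(1)] module_HomD(1)[OF assms(2)] assms(3)] .

lemma linear_map_in_Hom: "linear_map A M N h \<Longrightarrow> restrict h (carrier M) \<in> module_Hom A M N"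
  by (rule linear_map.in_module_Hom)

lemma
  assumes M: "left_module A M" and N: "left_module A N"
  shows module_Hom_zero: "(\<lambda>x\<in>carrier M. \<zero>\<^bsub>N\<^esub>) \<in> module_Hom A M N"
    and module_Hom_add: "h \<in> module_Hom A M N \<Longrightarrow> k \<in> module_Hom A M N \<Longrightarrow>
      (\<lambda>x\<in>carrier M. h x \<oplus>\<^bsub>N\<^esub> k x) \<in> module_Hom A M N"
    and module_Hom_uminus: "h \<in> module_Hom A M N \<Longrightarrow> (\<lambda>x\<in>carrier M. \<ominus>\<^bsub>N\<^esub> h x) \<in> module_Hom A M N"
proof -
  interpret M: left_module A M by fact
  interpret N: left_module A N by fact
  show "(\<lambda>x\<in>carrier M. \<zero>\<^bsub>N\<^esub>) \<in> module_Hom A M N" by (rule module_HomI) simp_all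
  show "(\<lambda>x\<in>carrier M. h x \<oplus>\<^bsub>N\<^esub> k x) \<in> module_Hom A M N"
    if "h \<in> module_Hom A M N" "k \<in> module_Hom A M N"
    using module_HomD(2-4)[OF that(1)] module_HomD(2-4)[OF that(2)]
    by (intro module_HomI) (simp_all add: N.M.a_ac N.smult_r_distr)
  show "(\<lambda>x\<in>carrier M. \<ominus>\<^bsub>N\<^esub> h x) \<in> module_Hom A M N" if "h \<in> module_Hom A M N"
    using module_HomD(2-4)[OF that]
    by (intro module_HomI) (simp_all add: N.M.minus_add N.smult_r_minus)
qed

lemma abelian_group_Hom_module:
  assumes M: "left_module A M" and N: "left_module A N"
  shows "abelian_group (Hom_module A M N act)"
proof -
  interpret M: left_module A M by fact
  interpret N: left_module A N by fact
  note cl = module_Hom_zero[OF M N] module_Hom_add[OF M N]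
  show ?thesis
  proof (rule abelian_groupI)
    fix h assume h: "h \<in> carrier (Hom_module A M N act)"
    show "\<zero>\<^bsub>Hom_module A M N act\<^esub> \<oplus>\<^bsub>Hom_module A M N act\<^esub> h = h"
      using h module_HomD(1,2)[of h A M N] by (intro extensionalityI[of _ "carrier M"]) simp_all
    have "(\<lambda>x\<in>carrier M. \<ominus>\<^bsub>N\<^esub> h x) \<oplus>\<^bsub>Hom_module A M N act\<^esub> h = \<zero>\<^bsub>Hom_module A M N act\<^esub>"
      using h by (auto simp: module_HomD(2) N.M.l_neg intro!: restrict_ext)
    then show "\<exists>k\<in>carrier (Hom_module A M N act). k \<oplus>\<^bsub>Hom_module A M N act\<^esub> h = \<zero>\<^bsub>Hom_module A M N act\<^esub>"
      using module_Hom_uminus[OF M N, of h] h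
      by (intro bexI[of _ "\<lambda>x\<in>carrier M. \<ominus>\<^bsub>N\<^esub> h x"]) simp_all
  qed (use cl in \<open>auto simp: module_HomD(2) N.M.a_ac intro!: restrict_ext\<close>)
qed

lemma ring_dual_simps [simp]:
  "carrier (ring_dual A P) = module_Hom A P (regular A)"
  "\<zero>\<^bsub>ring_dual A P\<^esub> = (\<lambda>x\<in>carrier P. \<zero>\<^bsub>A\<^esub>)"
  "h \<oplus>\<^bsub>ring_dual A P\<^esub> k = (\<lambda>x\<in>carrier P. h x \<oplus>\<^bsub>A\<^esub> k x)"
  "a \<odot>\<^bsub>ring_dual A P\<^esub> h = (\<lambda>x\<in>carrier P. h x \<otimes>\<^bsub>A\<^esub> a)"
  by (simp_all add: ring_dual_def)

lemma left_module_ring_dual: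
  assumes P: "left_module A P"
  shows "left_module (op_ring A) (ring_dual A P)"
proof -
  interpret P: left_module A P by fact
  have reg: "left_module A (regular A)" by (rule left_module_regular[OF P.R.ring_axioms])
  have ag: "abelian_group (ring_dual A P)"
    unfolding ring_dual_def by (rule abelian_group_Hom_module[OF P reg])
  note D = module_HomD(2)[where N = "regular A", simplified]
  have act: "(\<lambda>x\<in>carrier P. h x \<otimes>\<^bsub>A\<^esub> a) \<in> module_Hom A P (regular A)"
    if "a \<in> carrier A" "h \<in> module_Hom A P (regular A)" for a h
    using module_HomD(2-4)[OF that(2)] that(1)
    by (intro module_HomI) (simp_all add: P.R.l_distr P.R.m_assoc)
  show ?thesis
  proof (rule left_moduleI[OF ring_op_ring[OF P.R.ring_axioms] ag])
    fix h assume "h \<in> carrier (ring_dual A P)"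
    then have h: "h \<in> module_Hom A P (regular A)" by simp
    have hc: "h x \<in> carrier A" if "x \<in> carrier P" for x using D[OF h that] .
    show "\<one>\<^bsub>op_ring A\<^esub> \<odot>\<^bsub>ring_dual A P\<^esub> h = h"
      using act[OF P.R.one_closed h] h hc
      by (intro module_Hom_eqI[where A = A and M = P and N = "regular A"]) simp_all
    fix a assume a: "a \<in> carrier (op_ring A)"
    show "a \<odot>\<^bsub>ring_dual A P\<^esub> h \<in> carrier (ring_dual A P)" using act a h by simp
    fix b assume b: "b \<in> carrier (op_ring A)"
    show "(a \<oplus>\<^bsub>op_ring A\<^esub> b) \<odot>\<^bsub>ring_dual A P\<^esub> h = a \<odot>\<^bsub>ring_dual A P\<^esub> h \<oplus>\<^bsub>ring_dual A P\<^esub> b \<odot>\<^bsub>ring_dual A P\<^esub> h"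
      using a b hc by (auto simp: P.R.r_distr intro!: restrict_ext)
    show "a \<otimes>\<^bsub>op_ring A\<^esub> b \<odot>\<^bsub>ring_dual A P\<^esub> h = a \<odot>\<^bsub>ring_dual A P\<^esub> (b \<odot>\<^bsub>ring_dual A P\<^esub> h)"
      using a b hc by (auto simp: P.R.m_assoc intro!: restrict_ext)
  next
    fix a h k
    assume "a \<in> carrier (op_ring A)" and hk: "h \<in> carrier (ring_dual A P)" "k \<in> carrier (ring_dual A P)"
    moreover have "h x \<in> carrier A" "k x \<in> carrier A" if "x \<in> carrier P" for x
      using D[of h A P x] D[of k A P x] hk that by simp_all
    ultimately show "a \<odot>\<^bsub>ring_dual A P\<^esub> (h \<oplus>\<^bsub>ring_dual A P\<^esub> k) = a \<odot>\<^bsub>ring_dual A P\<^esub> h \<oplus>\<^bsub>ring_dual A P\<^esub> a \<odot>\<^bsub>ring_dual A P\<^esub> k"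
      by (auto simp: P.R.l_distr intro!: restrict_ext)
  qed
qed

lemma D_dual_simps [simp]:
  "carrier (D_dual R \<phi> I M) = module_Hom R (restrict_scalars \<phi> M) I"
  "\<zero>\<^bsub>D_dual R \<phi> I M\<^esub> = (\<lambda>x\<in>carrier M. \<zero>\<^bsub>I\<^esub>)"
  "h \<oplus>\<^bsub>D_dual R \<phi> I M\<^esub> k = (\<lambda>x\<in>carrier M. h x \<oplus>\<^bsub>I\<^esub> k x)"
  "a \<odot>\<^bsub>D_dual R \<phi> I M\<^esub> h = (\<lambda>x\<in>carrier M. h (a \<odot>\<^bsub>M\<^esub> x))"
  by (simp_all add: D_dual_def)

lemma (in artin_algebra) left_module_D_dual:
  assumes M: "left_module A M" and I: "left_module R I"
  shows "left_module (op_ring A) (D_dual R \<phi> I M)"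
proof -
  interpret M: left_module A M by fact
  interpret I: left_module R I by fact
  note rM = left_module_restrict[OF M]
  have ag: "abelian_group (D_dual R \<phi> I M)"
    unfolding D_dual_def by (rule abelian_group_Hom_module[OF rM I])
  note D = module_HomD[where M = "restrict_scalars \<phi> M" and A = R and N = I, simplified]
  have act: "(\<lambda>x\<in>carrier M. h (a \<odot>\<^bsub>M\<^esub> x)) \<in> module_Hom R (restrict_scalars \<phi> M) I"
    if a: "a \<in> carrier A" and h: "h \<in> module_Hom R (restrict_scalars \<phi> M) I" for a h
  proof (rule module_HomI)
    fix r x assume r: "r \<in> carrier R" and x: "x \<in> carrier (restrict_scalars \<phi> M)"
    have "a \<odot>\<^bsub>M\<^esub> (\<phi> r \<odot>\<^bsub>M\<^esub> x) = \<phi> r \<odot>\<^bsub>M\<^esub> (a \<odot>\<^bsub>M\<^esub> x)"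
      using r a x central[OF r a] M.smult_assoc1[of a "\<phi> r" x] M.smult_assoc1[of "\<phi> r" a x] by simp
    then show "(\<lambda>x\<in>carrier M. h (a \<odot>\<^bsub>M\<^esub> x)) (r \<odot>\<^bsub>restrict_scalars \<phi> M\<^esub> x) =
        r \<odot>\<^bsub>I\<^esub> (\<lambda>x\<in>carrier M. h (a \<odot>\<^bsub>M\<^esub> x)) x"
      using r a x D(4)[OF h r] by simp
  qed (use a D(1-3)[OF h] M.smult_r_distr in simp_all)
  show ?thesis
  proof (rule left_moduleI[OF ring_op_ring[OF A.ring_axioms] ag])
    fix h assume "h \<in> carrier (D_dual R \<phi> I M)"
    then have h: "h \<in> module_Hom R (restrict_scalars \<phi> M) I" by simp
    note hD = D[OF h]
    show "\<one>\<^bsub>op_ring A\<^esub> \<odot>\<^bsub>D_dual R \<phi> I M\<^esub> h = h"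
      using extensionalityI[OF _ hD(1)] by simp
    fix a assume a: "a \<in> carrier (op_ring A)"
    show "a \<odot>\<^bsub>D_dual R \<phi> I M\<^esub> h \<in> carrier (D_dual R \<phi> I M)" using act a h by simp
    fix b assume b: "b \<in> carrier (op_ring A)"
    show "(a \<oplus>\<^bsub>op_ring A\<^esub> b) \<odot>\<^bsub>D_dual R \<phi> I M\<^esub> h =
        a \<odot>\<^bsub>D_dual R \<phi> I M\<^esub> h \<oplus>\<^bsub>D_dual R \<phi> I M\<^esub> b \<odot>\<^bsub>D_dual R \<phi> I M\<^esub> h"
      using a b hD(3) by (auto simp: M.smult_l_distr intro!: restrict_ext)
    show "a \<otimes>\<^bsub>op_ring A\<^esub> b \<odot>\<^bsub>D_dual R \<phi> I M\<^esub> h = a \<odot>\<^bsub>D_dual R \<phi> I M\<^esub> (b \<odot>\<^bsub>D_dual R \<phi> I M\<^esub> h)"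
      using a b by (auto simp: M.smult_assoc1 intro!: restrict_ext)
  next
    fix a h k
    assume "a \<in> carrier (op_ring A)"
    then show "a \<odot>\<^bsub>D_dual R \<phi> I M\<^esub> (h \<oplus>\<^bsub>D_dual R \<phi> I M\<^esub> k) =
        a \<odot>\<^bsub>D_dual R \<phi> I M\<^esub> h \<oplus>\<^bsub>D_dual R \<phi> I M\<^esub> a \<odot>\<^bsub>D_dual R \<phi> I M\<^esub> k"
      by (auto intro!: restrict_ext)
  qed
qed

section \<open>Coordinates on projective covers\<close>

lemma direct_sum_decomp:
  assumes K: "finite K" and A: "ring A" and M: "\<And>i. i \<in> K \<Longrightarrow> left_module A (M i)"
    and d: "d \<in> carrier (direct_sum K M)"
  shows "(\<Oplus>\<^bsub>direct_sum K M\<^esub>j\<in>K. (\<lambda>i\<in>K. if i = j then d i else \<zero>\<^bsub>M i\<^esub>)) = d"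
proof -
  interpret S: left_module A "direct_sum K M" by (rule left_module_direct_sum[OF A M])
  have z: "\<zero>\<^bsub>M i\<^esub> \<in> carrier (M i)" if "i \<in> K" for i
    using M[OF that] by (simp add: left_module_def abelian_group_def abelian_monoid.zero_closed)
  have mem: "(\<lambda>j. \<lambda>i\<in>K. if i = j then d i else \<zero>\<^bsub>M i\<^esub>) \<in> K \<rightarrow> carrier (direct_sum K M)"
    using d z by (auto simp: PiE_iff)
  have "(\<Oplus>\<^bsub>direct_sum K M\<^esub>j\<in>K. (\<lambda>i\<in>K. if i = j then d i else \<zero>\<^bsub>M i\<^esub>)) i = d i" if i: "i \<in> K" for i
  proof -
    interpret pr: linear_map A "direct_sum K M" "M i" "\<lambda>x. x i"
      by (rule linear_map_proj[OF A M i])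
    have di: "d i \<in> carrier (M i)" using d i by (auto simp: PiE_iff)
    have "(\<Oplus>\<^bsub>direct_sum K M\<^esub>j\<in>K. (\<lambda>i\<in>K. if i = j then d i else \<zero>\<^bsub>M i\<^esub>)) i =
        (\<Oplus>\<^bsub>M i\<^esub>j\<in>K. (\<lambda>i\<in>K. if i = j then d i else \<zero>\<^bsub>M i\<^esub>) i)"
      by (rule pr.finsum[OF K mem])
    also have "\<dots> = (\<Oplus>\<^bsub>M i\<^esub>j\<in>K. if j = i then d i else \<zero>\<^bsub>M i\<^esub>)"
      using i di by (intro pr.cod.M.finsum_cong') auto
    also have "\<dots> = d i" by (rule pr.cod.finsum_single[OF K i di])
    finally show ?thesis .
  qed
  moreover have "(\<Oplus>\<^bsub>direct_sum K M\<^esub>j\<in>K. (\<lambda>i\<in>K. if i = j then d i else \<zero>\<^bsub>M i\<^esub>)) \<in> extensional K"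
    using S.M.finsum_closed[OF mem] by (simp add: PiE_iff)
  ultimately show ?thesis using d by (intro extensionalityI) (auto simp: PiE_iff)
qed

text \<open>The last two conclusions say that \<open>\<kappa>\<close> are coordinates for an isomorphism \<open>P \<cong> \<Oplus> A \<epsilon>\<^sub>i\<close>.\<close>

lemma (in finite_length_ring) projective_cover_coordinates:
  assumes pc: "projective_cover A P f M" and M: "left_module A M" and K: "finite K"
    and idem: "\<And>i. i \<in> K \<Longrightarrow> idempotent_elt A (\<epsilon> i)"
    and m: "\<And>i. i \<in> K \<Longrightarrow> m i \<in> carrier M" "\<And>i. i \<in> K \<Longrightarrow> \<epsilon> i \<odot>\<^bsub>M\<^esub> m i = m i"
    and span: "\<And>x. x \<in> carrier M \<Longrightarrow> \<exists>t\<in>\<Pi>\<^sub>E i\<in>K. carrier A #> \<epsilon> i. x = (\<Oplus>\<^bsub>M\<^esub>i\<in>K. t i \<odot>\<^bsub>M\<^esub> m i)"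
    and rel: "\<And>t i. t \<in> (\<Pi>\<^sub>E i\<in>K. carrier A #> \<epsilon> i) \<Longrightarrow> (\<Oplus>\<^bsub>M\<^esub>i\<in>K. t i \<odot>\<^bsub>M\<^esub> m i) = \<zero>\<^bsub>M\<^esub> \<Longrightarrow>
      i \<in> K \<Longrightarrow> t i \<in> J"
  obtains p \<kappa> where "\<And>i. i \<in> K \<Longrightarrow> p i \<in> carrier P" "\<And>i. i \<in> K \<Longrightarrow> f (p i) = m i"
    "\<And>i. i \<in> K \<Longrightarrow> \<epsilon> i \<odot>\<^bsub>P\<^esub> p i = p i" "\<And>i. i \<in> K \<Longrightarrow> linear_map A P (regular A) (\<kappa> i)"
    "\<And>i z. i \<in> K \<Longrightarrow> z \<in> carrier P \<Longrightarrow> \<kappa> i z \<in> carrier A #> \<epsilon> i"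
    "\<And>z. z \<in> carrier P \<Longrightarrow> (\<Oplus>\<^bsub>P\<^esub>i\<in>K. \<kappa> i z \<odot>\<^bsub>P\<^esub> p i) = z"
    "\<And>i j. i \<in> K \<Longrightarrow> j \<in> K \<Longrightarrow> \<kappa> i (p j) = (if i = j then \<epsilon> i else \<zero>)"
proof -
  have proj: "projective A P" and fHom: "f \<in> module_Hom A P M" and fsurj: "f ` carrier P = carrier M"
    and small: "\<And>N. submodule N A P \<Longrightarrow> f ` N = carrier M \<Longrightarrow> N = carrier P"
    using pc by (auto simp: projective_cover_def)
  have P: "left_module A P" and fgP: "fg_module A P"
    using proj by (auto simp: projective_def fg_module_def)
  interpret P: left_module A P by (rule P)
  interpret M: left_module A M by (rule M)
  interpret f: linear_map A P M f by (rule linear_map_of_Hom[OF P M fHom])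
  have ec: "\<epsilon> i \<in> carrier A" "\<epsilon> i \<otimes> \<epsilon> i = \<epsilon> i" if "i \<in> K" for i
    using idem[OF that] by (auto simp: idempotent_elt_def)
  have "\<exists>q. q \<in> carrier P \<and> f q = m i" if "i \<in> K" for i
    using m(1)[OF that] fsurj by (metis imageE)
  then obtain q where q: "\<And>i. i \<in> K \<Longrightarrow> q i \<in> carrier P" "\<And>i. i \<in> K \<Longrightarrow> f (q i) = m i"
    by metis
  \<comment> \<open>The factor \<open>\<epsilon> i\<close> makes the lift satisfy
    \<open>\<epsilon> i p i = p i\<close> and keeps its image, because
    \<open>\<epsilon> i m i = m i\<close>.\<close>
  define p where "p i = \<epsilon> i \<odot>\<^bsub>P\<^esub> q i" for i
  have p: "p i \<in> carrier P" "f (p i) = m i" "\<epsilon> i \<odot>\<^bsub>P\<^esub> p i = p i" if "i \<in> K" for i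
    using q[OF that] ec[OF that] m(2)[OF that]
    by (simp_all add: p_def P.smult_assoc1[symmetric])
  define L where "L i = carrier A #> \<epsilon> i" for i
  have L: "submodule (L i) A (regular A)" if "i \<in> K" for i
    using submodule_left_coset[OF ec(1)[OF that] reg.submodule_carrier] by (simp add: L_def)
  have Lmem: "a \<in> L i \<longleftrightarrow> a \<in> carrier A \<and> a \<otimes> \<epsilon> i = a" if "i \<in> K" for a i
    unfolding L_def by (rule mem_left_coset_idem[OF idem[OF that]])
  define Q where "Q = direct_sum K (\<lambda>i. (regular A)\<lparr>carrier := L i\<rparr>)"
  have Lmod: "left_module A ((regular A)\<lparr>carrier := L i\<rparr>)" if "i \<in> K" for i
    by (rule reg.left_module_sub[OF L[OF that]])
  have Qmod: "left_module A Q"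
    unfolding Q_def by (rule left_module_direct_sum[OF ring_axioms Lmod])
  have Qfl: "finite_length A Q"
    unfolding Q_def by (rule finite_length_direct_sum[OF K ring_axioms Lmod reg.finite_length_sub[OF L]])
  interpret Q: finite_length_module A Q
    by (intro finite_length_moduleI Qmod Qfl)
  have Qc: "carrier Q = (\<Pi>\<^sub>E i\<in>K. L i)" by (simp add: Q_def)
  define v where "v t = (\<Oplus>\<^bsub>P\<^esub>i\<in>K. t i \<odot>\<^bsub>P\<^esub> p i)" for t
  have vlin: "linear_map A Q P v"
    unfolding Q_def v_def by (rule linear_map_finsum_smult[OF K P p(1) L])
  interpret v: linear_map A Q P v by (rule vlin)
  have cl: "(\<lambda>i. t i \<odot>\<^bsub>P\<^esub> p i) \<in> K \<rightarrow> carrier P" if "t \<in> carrier Q" for t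
    using that p(1) Lmem by (auto simp: Qc PiE_iff)
  have fv: "f (v t) = (\<Oplus>\<^bsub>M\<^esub>i\<in>K. t i \<odot>\<^bsub>M\<^esub> m i)" if t: "t \<in> carrier Q" for t
    unfolding v_def f.finsum[OF K cl[OF t]]
    using t p Lmem m(1) by (intro M.M.finsum_cong') (auto simp: Qc PiE_iff)
  have "f ` v ` carrier Q = carrier M"
  proof
    show "carrier M \<subseteq> f ` v ` carrier Q"
    proof
      fix x assume "x \<in> carrier M"
      then obtain t where "t \<in> carrier Q" "x = f (v t)"
        using span fv by (auto simp: Qc L_def)
      then show "x \<in> f ` v ` carrier Q" by blast
    qed
  qed auto
  \<comment> \<open>The image of \<open>v\<close> maps onto \<open>M\<close>, so it is all of
    \<open>P\<close> by minimality of the cover.\<close>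
  then have vsurj: "v ` carrier Q = carrier P"
    by (intro small v.submodule_image Q.submodule_carrier)
  \<comment> \<open>Projectivity splits \<open>v\<close>. The section \<open>k\<close> turns out to
    be onto as well, hence inverse to \<open>v\<close>, and its components are the
    coordinates.\<close>
  obtain k where k: "linear_map A P Q k" "\<And>z. z \<in> carrier P \<Longrightarrow> v (k z) = z"
    using projective_lift[OF proj Q.fg_module fgP vlin vsurj linear_map_id[OF P]] by blast
  interpret k: linear_map A P Q k by (rule k(1))
  define \<delta> where "\<delta> j = (\<lambda>i\<in>K. if i = j then \<epsilon> i else \<zero>)" for j
  have \<delta>: "\<delta> j \<in> carrier Q" if "j \<in> K" for j
    using that ec Lmem by (auto simp: \<delta>_def Qc)
  have decomp: "(\<Oplus>\<^bsub>Q\<^esub>j\<in>K. d j \<odot>\<^bsub>Q\<^esub> \<delta> j) = d" if d: "d \<in> carrier Q" for d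
  proof -
    have dc: "d i \<in> L i" "d i \<in> carrier A" "d i \<otimes> \<epsilon> i = d i" if "i \<in> K" for i
      using d that Lmem by (auto simp: Qc PiE_iff)
    have "d j \<odot>\<^bsub>Q\<^esub> \<delta> j = (\<lambda>i\<in>K. if i = j then d i else \<zero>)" if "j \<in> K" for j
      using dc[OF that] by (auto simp: Q_def \<delta>_def intro!: restrict_ext)
    moreover have "(\<lambda>i\<in>K. if i = j then d i else \<zero>) \<in> carrier Q" if "j \<in> K" for j
      using dc reg.submoduleD(3)[OF L] by (auto simp: Qc)
    ultimately have "(\<Oplus>\<^bsub>Q\<^esub>j\<in>K. d j \<odot>\<^bsub>Q\<^esub> \<delta> j) = (\<Oplus>\<^bsub>Q\<^esub>j\<in>K. (\<lambda>i\<in>K. if i = j then d i else \<zero>))"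
      by (intro Q.M.finsum_cong') auto
    also have "\<dots> = d"
    proof -
      have z: "\<zero>\<^bsub>(regular A)\<lparr>carrier := L i\<rparr>\<^esub> = \<zero>" for i by simp
      show ?thesis
        using direct_sum_decomp[where M = "\<lambda>i. (regular A)\<lparr>carrier := L i\<rparr>" and d = d,
            OF K ring_axioms Lmod] d
        unfolding z Q_def by blast
    qed
    finally show ?thesis .
  qed
  \<comment> \<open>The difference \<open>x - k (v x)\<close> is in the kernel of \<open>v\<close>,
    hence a relation among the \<open>m i\<close>. By \<open>rel\<close> its entries lie in
    \<open>J\<close>, so it is in every maximal submodule of \<open>Q\<close> and Nakayama
    applies.\<close>
  have "k ` carrier P = carrier Q"
  proof (rule Q.nakayama[OF k.submodule_image[OF P.submodule_carrier]])
    fix x assume x: "x \<in> carrier Q"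
    define d where "d = x \<ominus>\<^bsub>Q\<^esub> k (v x)"
    have d: "d \<in> carrier Q" using x by (simp add: d_def)
    have "v d = \<zero>\<^bsub>P\<^esub>" using x k(2) by (simp add: d_def v.minus P.minus_eq_zero_iff)
    then have "(\<Oplus>\<^bsub>M\<^esub>i\<in>K. d i \<odot>\<^bsub>M\<^esub> m i) = \<zero>\<^bsub>M\<^esub>" using fv[OF d] by simp
    then have dJ: "d i \<in> J" if "i \<in> K" for i
      using rel[OF _ _ that] d by (simp add: Qc L_def)
    have "d \<in> L'" if L': "maximal_submodule A Q L'" for L'
    proof -
      have "(\<Oplus>\<^bsub>Q\<^esub>j\<in>K. d j \<odot>\<^bsub>Q\<^esub> \<delta> j) \<in> L'"
        using L' K jacobson_radical_smult_maximal[OF Qmod L' \<delta> dJ]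
        by (intro Q.submodule_finsum) (auto simp: maximal_submodule_def)
      then show ?thesis using decomp[OF d] by simp
    qed
    then show "\<exists>n\<in>k ` carrier P. \<forall>L. maximal_submodule A Q L \<longrightarrow> x \<ominus>\<^bsub>Q\<^esub> n \<in> L"
      using x v.closed[OF x] unfolding d_def by blast
  qed
  have kv: "k (v t) = t" if "t \<in> carrier Q" for t
  proof -
    have "t \<in> k ` carrier P" using that \<open>k ` carrier P = carrier Q\<close> by simp
    then obtain z where "z \<in> carrier P" "t = k z" by blast
    then show ?thesis using k(2) by simp
  qed
  have v\<delta>: "v (\<delta> j) = p j" if j: "j \<in> K" for j
  proof -
    have "v (\<delta> j) = (\<Oplus>\<^bsub>P\<^esub>i\<in>K. if i = j then p j else \<zero>\<^bsub>P\<^esub>)"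
      unfolding v_def using p j by (intro P.M.finsum_cong') (auto simp: \<delta>_def)
    then show ?thesis using P.finsum_single[OF K j p(1)[OF j]] by simp
  qed
  show thesis
  proof (rule that[of p "\<lambda>i z. k z i"])
    fix i assume i: "i \<in> K"
    show "p i \<in> carrier P" "f (p i) = m i" "\<epsilon> i \<odot>\<^bsub>P\<^esub> p i = p i" using p[OF i] .
    have kz: "k z i \<in> L i" if "z \<in> carrier P" for z
      using k.closed[OF that] i by (auto simp: Qc PiE_iff)
    then show "k z i \<in> carrier A #> \<epsilon> i" if "z \<in> carrier P" for z using that by (simp add: L_def)
    show "linear_map A P (regular A) (\<lambda>z. k z i)"
      using i kz Lmem[OF i]
      by (intro linear_mapI P reg.left_module_axioms) (simp_all add: Q_def)
    show "k (p j) i = (if i = j then \<epsilon> i else \<zero>)" if j: "j \<in> K" for j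
    proof -
      have "k (p j) = \<delta> j" using kv[OF \<delta>[OF j]] unfolding v\<delta>[OF j] .
      then show ?thesis using i by (simp add: \<delta>_def)
    qed
  next
    fix z assume "z \<in> carrier P"
    then show "(\<Oplus>\<^bsub>P\<^esub>i\<in>K. k z i \<odot>\<^bsub>P\<^esub> p i) = z" using k(2) by (simp add: v_def)
  qed
qed

text \<open>The \<open>y i\<close> generate \<open>J e\<close> modulo \<open>J^2 e\<close>, hence
  outright by Nakayama. A combination that falls into \<open>J^2 e\<close> becomes zero in the
  direct sum, which puts each coefficient into \<open>J \<epsilon> i\<close>. The last conclusion
  allows values in \<open>J^2 e\<close> and not merely zero, since the nonvanishing of the radical
  layers depends on this.\<close>

lemma (in finite_length_ring) iso_generators:
  assumes e: "idempotent_elt A e" and idem: "\<And>i. i \<in> K \<Longrightarrow> idempotent_elt A (\<epsilon> i)" and K: "finite K"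
    and iso: "module_iso A (lquot A (J #> e) ((J \<cdot> J) #> e))
      (direct_sum K (\<lambda>i. lquot A (carrier A #> \<epsilon> i) (J #> \<epsilon> i)))"
  obtains y where "\<And>i. i \<in> K \<Longrightarrow> y i \<in> J #> e" "\<And>i. i \<in> K \<Longrightarrow> \<epsilon> i \<otimes> y i = y i"
    "\<And>x. x \<in> J #> e \<Longrightarrow>
      \<exists>t\<in>\<Pi>\<^sub>E i\<in>K. carrier A #> \<epsilon> i. x = (\<Oplus>\<^bsub>(regular A)\<lparr>carrier := J #> e\<rparr>\<^esub>i\<in>K. t i \<otimes> y i)"
    "\<And>t i. t \<in> (\<Pi>\<^sub>E i\<in>K. carrier A #> \<epsilon> i) \<Longrightarrow>
      (\<Oplus>\<^bsub>(regular A)\<lparr>carrier := J #> e\<rparr>\<^esub>i\<in>K. t i \<otimes> y i) \<in> (J \<cdot> J) #> e \<Longrightarrow> i \<in> K \<Longrightarrow> t i \<in> J"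
proof -
  have ec: "e \<in> carrier A" "e \<otimes> e = e" using e by (auto simp: idempotent_elt_def)
  have \<epsilon>c: "\<epsilon> i \<in> carrier A" "\<epsilon> i \<otimes> \<epsilon> i = \<epsilon> i" if "i \<in> K" for i
    using idem[OF that] by (auto simp: idempotent_elt_def)
  define X where "X = (regular A)\<lparr>carrier := J #> e\<rparr>"
  define N where "N = (J \<cdot> J) #> e"
  have X: "submodule (J #> e) A (regular A)" by (rule submodule_left_coset[OF ec(1) submodule_J])
  have idJJ: "ideal (J \<cdot> J) A" by (rule ideal_prod_is_ideal[OF ideal_J ideal_J])
  have JJ: "J \<cdot> J \<subseteq> J" using ideal_prod_inter[OF ideal_J ideal_J] by blast
  have subJJ: "submodule (J \<cdot> J) A (regular A)"
  proof -
    interpret JJ: ideal "J \<cdot> J" A by (rule idJJ)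
    show ?thesis by (rule reg.submoduleI) (use JJ.a_subset JJ.I_l_closed in auto)
  qed
  have NX: "N \<subseteq> J #> e" using JJ by (auto simp: N_def r_coset_def)
  interpret X: finite_length_module A X
    unfolding X_def by (rule reg.finite_length_module_sub[OF X])
  have NsubX: "submodule N A X"
    unfolding X_def reg.submodule_sub_iff[OF X] using submodule_left_coset[OF ec(1) subJJ] NX
    by (simp add: N_def)
  interpret q: quotient_module A X N by (rule quotient_moduleI[OF X.left_module_axioms NsubX])
  define Y where "Y i = (regular A)\<lparr>carrier := carrier A #> \<epsilon> i\<rparr>" for i
  define Z where "Z i = J #> \<epsilon> i" for i
  have AE: "submodule (carrier A #> \<epsilon> i) A (regular A)" if "i \<in> K" for i
    using submodule_left_coset[OF \<epsilon>c(1)[OF that] reg.submodule_carrier] by simp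
  have Zmem: "a \<in> Z i \<longleftrightarrow> a \<in> J \<and> a \<otimes> \<epsilon> i = a" if "i \<in> K" for a i
    unfolding Z_def by (rule mem_left_coset_idem_ideal[OF idem[OF that] ideal_J])
  have Ymem: "a \<in> carrier (Y i) \<longleftrightarrow> a \<in> carrier A \<and> a \<otimes> \<epsilon> i = a" if "i \<in> K" for a i
    using mem_left_coset_idem[OF idem[OF that]] by (simp add: Y_def)
  have YZ: "quotient_module A (Y i) (Z i)" if i: "i \<in> K" for i
  proof (rule quotient_moduleI)
    show "left_module A (Y i)" unfolding Y_def by (rule reg.left_module_sub[OF AE[OF i]])
    show "submodule (Z i) A (Y i)"
      unfolding Y_def reg.submodule_sub_iff[OF AE[OF i]] Z_def
      using submodule_left_coset[OF \<epsilon>c(1)[OF i] submodule_J] J_carrier by (auto simp: r_coset_def)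
  qed
  define D where "D = direct_sum K (\<lambda>i. quot_mod (Y i) (Z i))"
  have Qmod: "left_module A (quot_mod (Y i) (Z i))" if "i \<in> K" for i
    by (rule quotient_module.left_module_quot[OF YZ[OF that]])
  have Dmod: "left_module A D" unfolding D_def by (rule left_module_direct_sum[OF ring_axioms Qmod])
  obtain h where hH: "h \<in> module_Hom A (quot_mod X N) D"
    and bij: "bij_betw h (carrier (quot_mod X N)) (carrier D)"
    using iso by (auto simp: module_iso_def lquot_def X_def N_def D_def Y_def Z_def)
  interpret h: linear_map A "quot_mod X N" D h
    by (rule linear_map_of_Hom[OF q.left_module_quot Dmod hH])
  interpret c: linear_map A X "quot_mod X N" q.coset by (rule q.linear_map_coset)
  interpret hc: linear_map A X D "\<lambda>x. h (q.coset x)"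
    by (rule linear_map_comp[OF c.linear_map_axioms h.linear_map_axioms])
  have coset_in: "(Z i) +>\<^bsub>Y i\<^esub> a \<in> carrier (quot_mod (Y i) (Z i))" if "i \<in> K" "a \<in> carrier (Y i)" for i a
    using quotient_module.carrier_quot[OF YZ[OF that(1)]] that(2) by simp
  have zero_in: "Z i \<in> carrier (quot_mod (Y i) (Z i))" if "i \<in> K" for i
  proof -
    interpret quotient_module A "Y i" "Z i" by (rule YZ[OF that])
    interpret quo: left_module A "quot_mod (Y i) (Z i)" by (rule Qmod[OF that])
    show ?thesis using quo.M.zero_closed by (simp add: zero_quot)
  qed
  have zD: "\<zero>\<^bsub>D\<^esub> = (\<lambda>i\<in>K. Z i)"
    using quotient_module.zero_quot[OF YZ] by (auto simp: D_def intro!: restrict_ext)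
  define E where "E j = (\<lambda>i\<in>K. if i = j then (Z i) +>\<^bsub>Y i\<^esub> (\<epsilon> i) else Z i)" for j
  have E: "E j \<in> carrier D" if "j \<in> K" for j
    using coset_in zero_in \<epsilon>c Ymem by (auto simp: D_def E_def)
  have tE: "a \<odot>\<^bsub>D\<^esub> E j = (\<lambda>i\<in>K. if i = j then (Z i) +>\<^bsub>Y i\<^esub> a else Z i)"
    if j: "j \<in> K" and a: "a \<in> carrier (Y j)" for j a
  proof -
    have ac: "a \<in> carrier A" "a \<otimes> \<epsilon> j = a" using a Ymem[OF j] by auto
    have "a \<odot>\<^bsub>quot_mod (Y i) (Z i)\<^esub> (if i = j then (Z i) +>\<^bsub>Y i\<^esub> (\<epsilon> i) else Z i) =
        (if i = j then (Z i) +>\<^bsub>Y i\<^esub> a else Z i)" if i: "i \<in> K" for i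
    proof -
      interpret qi: quotient_module A "Y i" "Z i" by (rule YZ[OF i])
      interpret qu: left_module A "quot_mod (Y i) (Z i)" by (rule Qmod[OF i])
      have "a \<odot>\<^bsub>quot_mod (Y i) (Z i)\<^esub> Z i = Z i"
        using qu.smult_r_null[OF ac(1)] by (simp add: qi.zero_quot)
      moreover have "a \<odot>\<^bsub>Y i\<^esub> \<epsilon> i = a" if "i = j" using ac that by (simp add: Y_def)
      ultimately show ?thesis
        using qi.smult_quot[OF ac(1), of "\<epsilon> i"] \<epsilon>c[OF i] Ymem[OF i] by auto
    qed
    then show ?thesis by (auto simp: D_def E_def intro!: restrict_ext)
  qed
  have "\<exists>y'. y' \<in> carrier X \<and> h (q.coset y') = E i" if "i \<in> K" for i
  proof -
    have "E i \<in> h ` carrier (quot_mod X N)" using E[OF that] bij by (simp add: bij_betw_def)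
    then show ?thesis by (auto simp: q.carrier_quot)
  qed
  then obtain y' where y': "\<And>i. i \<in> K \<Longrightarrow> y' i \<in> carrier X" "\<And>i. i \<in> K \<Longrightarrow> h (q.coset (y' i)) = E i"
    by metis
  \<comment> \<open>The class of \<open>\<epsilon> i\<close> is fixed by
    \<open>\<epsilon> i\<close>, so this correction of the lift does not change its class.\<close>
  define y where "y i = \<epsilon> i \<otimes> y' i" for i
  have sm: "a \<odot>\<^bsub>X\<^esub> x = a \<otimes> x" for a x by (simp add: X_def)
  have Xc: "x \<in> carrier X \<Longrightarrow> x \<in> carrier A" for x
    using reg.submoduleD(2)[OF X, of x] by (simp add: X_def)
  have y: "y i \<in> carrier X" "\<epsilon> i \<otimes> y i = y i" "h (q.coset (y i)) = E i" if i: "i \<in> K" for i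
  proof -
    show "y i \<in> carrier X"
      using X.smult_closed[OF \<epsilon>c(1)[OF i] y'(1)[OF i]] by (simp add: sm y_def)
    show "\<epsilon> i \<otimes> y i = y i"
      using \<epsilon>c[OF i] Xc[OF y'(1)[OF i]] by (simp add: y_def m_assoc[symmetric])
    have "h (q.coset (y i)) = \<epsilon> i \<odot>\<^bsub>D\<^esub> E i"
      using hc.smult[OF \<epsilon>c(1)[OF i] y'(1)[OF i]] y'(2)[OF i] by (simp add: sm y_def)
    also have "\<dots> = E i"
      using tE[OF i, of "\<epsilon> i"] \<epsilon>c[OF i] Ymem[OF i] by (auto simp: E_def intro!: restrict_ext)
    finally show "h (q.coset (y i)) = E i" .
  qed
  have Tmem: "t i \<in> carrier (Y i)" "t i \<in> carrier A"
    if "t \<in> (\<Pi>\<^sub>E i\<in>K. carrier A #> \<epsilon> i)" "i \<in> K" for t i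
    using that Ymem[OF that(2)] by (auto simp: Y_def PiE_iff)
  have sumX: "(\<lambda>i. t i \<otimes> y i) \<in> K \<rightarrow> carrier X" if t: "t \<in> (\<Pi>\<^sub>E i\<in>K. carrier A #> \<epsilon> i)" for t
    using X.smult_closed[OF Tmem(2)[OF t] y(1)] by (auto simp: sm)
  have hsum: "h (q.coset (\<Oplus>\<^bsub>X\<^esub>i\<in>K. t i \<otimes> y i)) = (\<lambda>i\<in>K. (Z i) +>\<^bsub>Y i\<^esub> (t i))"
    if t: "t \<in> (\<Pi>\<^sub>E i\<in>K. carrier A #> \<epsilon> i)" for t
  proof -
    have "h (q.coset (\<Oplus>\<^bsub>X\<^esub>i\<in>K. t i \<otimes> y i)) = (\<Oplus>\<^bsub>D\<^esub>i\<in>K. h (q.coset (t i \<otimes> y i)))"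
      by (rule hc.finsum[OF K sumX[OF t]])
    also have "\<dots> = (\<Oplus>\<^bsub>D\<^esub>j\<in>K. (\<lambda>i\<in>K. if i = j then (\<lambda>i\<in>K. (Z i) +>\<^bsub>Y i\<^esub> (t i)) i else \<zero>\<^bsub>quot_mod (Y i) (Z i)\<^esub>))"
    proof (intro h.cod.M.finsum_cong' refl)
      fix j assume j: "j \<in> K"
      have "h (q.coset (t j \<otimes> y j)) = t j \<odot>\<^bsub>D\<^esub> E j"
        using hc.smult[OF Tmem(2)[OF t j] y(1)[OF j]] y(3)[OF j] by (simp add: sm)
      then show "h (q.coset (t j \<otimes> y j)) =
          (\<lambda>i\<in>K. if i = j then (\<lambda>i\<in>K. (Z i) +>\<^bsub>Y i\<^esub> (t i)) i else \<zero>\<^bsub>quot_mod (Y i) (Z i)\<^esub>)"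
        using tE[OF j Tmem(1)[OF t j]] quotient_module.zero_quot[OF YZ]
        by (auto intro!: restrict_ext)
    qed (use coset_in Tmem[OF t] zero_in quotient_module.zero_quot[OF YZ] in \<open>auto simp: D_def\<close>)
    also have "\<dots> = (\<lambda>i\<in>K. (Z i) +>\<^bsub>Y i\<^esub> (t i))"
      unfolding D_def using coset_in Tmem[OF t]
      by (intro direct_sum_decomp[OF K ring_axioms Qmod]) auto
    finally show ?thesis .
  qed
  have rel: "t i \<in> J" if t: "t \<in> (\<Pi>\<^sub>E i\<in>K. carrier A #> \<epsilon> i)"
    and 0: "(\<Oplus>\<^bsub>X\<^esub>i\<in>K. t i \<otimes> y i) \<in> N" and i: "i \<in> K" for t i
  proof -
    have "q.coset (\<Oplus>\<^bsub>X\<^esub>i\<in>K. t i \<otimes> y i) = \<zero>\<^bsub>quot_mod X N\<^esub>"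
      using 0 q.coset_eq_zero_iff[OF X.M.finsum_closed[OF sumX[OF t]]] by (simp add: q.zero_quot)
    then have "(\<lambda>i\<in>K. (Z i) +>\<^bsub>Y i\<^esub> (t i)) = (\<lambda>i\<in>K. Z i)" using hsum[OF t] zD by simp
    from fun_cong[OF this, of i] have "(Z i) +>\<^bsub>Y i\<^esub> (t i) = Z i" using i by simp
    then have "t i \<in> Z i"
      using quotient_module.coset_eq_zero_iff[OF YZ[OF i] Tmem(1)[OF t i]] by simp
    then show ?thesis using Zmem[OF i] by simp
  qed
  have modN: "\<exists>t\<in>\<Pi>\<^sub>E i\<in>K. carrier A #> \<epsilon> i. x \<ominus>\<^bsub>X\<^esub> (\<Oplus>\<^bsub>X\<^esub>i\<in>K. t i \<otimes> y i) \<in> N" if x: "x \<in> carrier X" for x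
  proof -
    have hx: "h (q.coset x) \<in> carrier D" by (rule hc.closed[OF x])
    have "\<exists>a. a \<in> carrier (Y i) \<and> h (q.coset x) i = (Z i) +>\<^bsub>Y i\<^esub> a" if i: "i \<in> K" for i
    proof -
      have "h (q.coset x) i \<in> carrier (quot_mod (Y i) (Z i))" using hx i by (auto simp: D_def)
      then show ?thesis unfolding quotient_module.carrier_quot[OF YZ[OF i]] by blast
    qed
    then obtain t0 where t0: "\<And>i. i \<in> K \<Longrightarrow> t0 i \<in> carrier (Y i)"
      "\<And>i. i \<in> K \<Longrightarrow> h (q.coset x) i = (Z i) +>\<^bsub>Y i\<^esub> (t0 i)" by metis
    define t where "t = restrict t0 K"
    have t: "t \<in> (\<Pi>\<^sub>E i\<in>K. carrier A #> \<epsilon> i)" using t0(1) by (auto simp: t_def Y_def)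
    have "h (q.coset x) = (\<lambda>i\<in>K. (Z i) +>\<^bsub>Y i\<^esub> (t i))"
      using hx t0(2) by (intro extensionalityI[of _ K]) (auto simp: t_def D_def PiE_iff)
    then have eq: "h (q.coset x) = h (q.coset (\<Oplus>\<^bsub>X\<^esub>i\<in>K. t i \<otimes> y i))" using hsum[OF t] by simp
    have sc: "(\<Oplus>\<^bsub>X\<^esub>i\<in>K. t i \<otimes> y i) \<in> carrier X" by (rule X.M.finsum_closed[OF sumX[OF t]])
    have "q.coset x = q.coset (\<Oplus>\<^bsub>X\<^esub>i\<in>K. t i \<otimes> y i)"
      using bij eq x sc by (intro inj_onD[of h "carrier (quot_mod X N)"])
        (auto simp: bij_betw_def q.carrier_quot)
    then show ?thesis using t q.coset_eq_iff[OF x sc] by blast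
  qed
  have span: "\<exists>t\<in>\<Pi>\<^sub>E i\<in>K. carrier A #> \<epsilon> i. x = (\<Oplus>\<^bsub>X\<^esub>i\<in>K. t i \<otimes> y i)" if x: "x \<in> carrier X" for x
  proof -
    interpret s: linear_map A "direct_sum K (\<lambda>i. (regular A)\<lparr>carrier := carrier A #> \<epsilon> i\<rparr>)" X
      "\<lambda>t. \<Oplus>\<^bsub>X\<^esub>i\<in>K. t i \<odot>\<^bsub>X\<^esub> y i"
      by (rule linear_map_finsum_smult[OF K X.left_module_axioms y(1) AE])
    let ?T = "carrier (direct_sum K (\<lambda>i. (regular A)\<lparr>carrier := carrier A #> \<epsilon> i\<rparr>))"
    \<comment> \<open>An element \<open>i j e\<close> with \<open>i\<close> and \<open>j\<close> in
      \<open>J\<close> is \<open>i\<close> applied to \<open>j e\<close> in \<open>J e\<close>, and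
      \<open>J\<close> carries every element into each maximal submodule.\<close>
    have NL: "N \<subseteq> L" if L: "maximal_submodule A X L" for L
    proof -
      have sL: "submodule L A X" using L by (simp add: maximal_submodule_def)
      have "z \<otimes> e \<in> L \<and> z \<in> carrier A" if "z \<in> J \<cdot> J" for z
        using that
      proof induct
        case (prod i j)
        have jX: "j \<otimes> e \<in> carrier X" using prod(2) by (auto simp: X_def r_coset_def)
        have c: "i \<in> carrier A" "j \<in> carrier A" using prod J_carrier by auto
        have "i \<odot>\<^bsub>X\<^esub> (j \<otimes> e) \<in> L"
          by (rule jacobson_radical_smult_maximal[OF X.left_module_axioms L jX prod(1)])
        then show ?case using c ec by (simp add: sm m_assoc)
      next
        case (sum s1 s2)
        then have "s1 \<otimes> e \<oplus>\<^bsub>X\<^esub> s2 \<otimes> e \<in> L" using X.submoduleD(4)[OF sL] by blast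
        then show ?case using sum ec by (simp add: X_def l_distr)
      qed
      then show ?thesis by (auto simp: N_def r_coset_def)
    qed
    have "(\<lambda>t. \<Oplus>\<^bsub>X\<^esub>i\<in>K. t i \<odot>\<^bsub>X\<^esub> y i) ` ?T = carrier X"
    proof (rule X.nakayama[OF s.submodule_image[OF s.dom.submodule_carrier]])
      fix x assume "x \<in> carrier X"
      then obtain t where "t \<in> ?T" "x \<ominus>\<^bsub>X\<^esub> (\<Oplus>\<^bsub>X\<^esub>i\<in>K. t i \<odot>\<^bsub>X\<^esub> y i) \<in> N"
        using modN by (auto simp: sm)
      then show "\<exists>n\<in>(\<lambda>t. \<Oplus>\<^bsub>X\<^esub>i\<in>K. t i \<odot>\<^bsub>X\<^esub> y i) ` ?T. \<forall>L. maximal_submodule A X L \<longrightarrow> x \<ominus>\<^bsub>X\<^esub> n \<in> L"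
        using NL by blast
    qed
    then have "x \<in> (\<lambda>t. \<Oplus>\<^bsub>X\<^esub>i\<in>K. t i \<odot>\<^bsub>X\<^esub> y i) ` ?T" using x by simp
    then show ?thesis by (auto simp: sm)
  qed
  show thesis
    by (rule that[of y]) (use y span rel in \<open>simp_all add: X_def N_def\<close>)
qed

section \<open>The transpose\<close>

lemma r_coset_op_ring: "X #>\<^bsub>op_ring A\<^esub> a = a <#\<^bsub>A\<^esub> X"
  by (auto simp: r_coset_def l_coset_def)

lemma idempotent_op_iff [simp]: "idempotent_elt (op_ring A) e \<longleftrightarrow> idempotent_elt A e"
  by (simp add: idempotent_elt_def)

lemma primitive_op_iff [simp]: "primitive_idempotent (op_ring A) e \<longleftrightarrow> primitive_idempotent A e"
  by (auto simp: primitive_idempotent_def)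

text \<open>\<open>p\<close> and \<open>\<kappa>\<close> form a dual basis of \<open>P\<close>, so
  that \<open>P\<close> behaves as the sum of the \<open>A \<epsilon> i\<close> without being
  replaced by it. Evaluation at the \<open>p i\<close> identifies the dual with the sum of the right
  modules \<open>\<epsilon> i A\<close>.\<close>

locale projective_coordinates = finite_length_ring A + P: left_module A P
  for A :: "('a, 'm) ring_scheme" (structure) and P :: "('a, 'b) module" +
  fixes K :: "nat set" and \<epsilon> :: "nat \<Rightarrow> 'a" and p :: "nat \<Rightarrow> 'b" and \<kappa> :: "nat \<Rightarrow> 'b \<Rightarrow> 'a"
  assumes finite_K: "finite K"
    and idem: "i \<in> K \<Longrightarrow> idempotent_elt A (\<epsilon> i)"
    and p_closed: "i \<in> K \<Longrightarrow> p i \<in> carrier P"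
    and idem_p: "i \<in> K \<Longrightarrow> \<epsilon> i \<odot>\<^bsub>P\<^esub> p i = p i"
    and linear_\<kappa>: "i \<in> K \<Longrightarrow> linear_map A P (regular A) (\<kappa> i)"
    and \<kappa>_mem: "i \<in> K \<Longrightarrow> z \<in> carrier P \<Longrightarrow> \<kappa> i z \<in> carrier A #> \<epsilon> i"
    and sum_\<kappa>: "z \<in> carrier P \<Longrightarrow> (\<Oplus>\<^bsub>P\<^esub>i\<in>K. \<kappa> i z \<odot>\<^bsub>P\<^esub> p i) = z"
    and \<kappa>_p: "i \<in> K \<Longrightarrow> j \<in> K \<Longrightarrow> \<kappa> i (p j) = (if i = j then \<epsilon> i else \<zero>)"
begin

interpretation op: finite_length_ring "op_ring A"
  by (rule finite_length_ring_op)

abbreviation "dual \<equiv> ring_dual A P"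

lemma \<epsilon>_closed: "i \<in> K \<Longrightarrow> \<epsilon> i \<in> carrier A" and \<epsilon>_idem: "i \<in> K \<Longrightarrow> \<epsilon> i \<otimes> \<epsilon> i = \<epsilon> i"
  using idem by (auto simp: idempotent_elt_def)

lemma left_module_dual: "left_module (op_ring A) dual"
  by (rule left_module_ring_dual[OF P.left_module_axioms])

interpretation D: left_module "op_ring A" dual
  by (rule left_module_dual)

lemma linear_eval: "x \<in> carrier P \<Longrightarrow> linear_map (op_ring A) dual (regular (op_ring A)) (\<lambda>h. h x)"
  by (intro linear_mapI left_module_dual op.reg.left_module_axioms)
    (auto simp: module_HomD(2)[where N = "regular A", simplified])

lemma dual_closed: "h \<in> carrier dual \<Longrightarrow> x \<in> carrier P \<Longrightarrow> h x \<in> carrier A"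
  using module_HomD(2)[of h A P "regular A" x] by simp

lemma idem_dual:
  assumes "h \<in> carrier dual" "i \<in> K"
  shows "\<epsilon> i \<otimes> h (p i) = h (p i)"
  using module_HomD(4)[of h A P "regular A" "\<epsilon> i" "p i"] assms \<epsilon>_closed p_closed
  by (simp add: idem_p)

lemma dual_eqI:
  assumes h: "h \<in> carrier dual" "k \<in> carrier dual" and eq: "\<And>i. i \<in> K \<Longrightarrow> h (p i) = k (p i)"
  shows "h = k"
proof (rule module_Hom_eqI[of h A P "regular A"])
  show hk: "h \<in> module_Hom A P (regular A)" "k \<in> module_Hom A P (regular A)" using h by simp_all
  fix z assume z: "z \<in> carrier P"
  interpret h: linear_map A P "regular A" h
    by (rule linear_map_of_Hom[OF P.left_module_axioms reg.left_module_axioms hk(1)])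
  interpret k: linear_map A P "regular A" k
    by (rule linear_map_of_Hom[OF P.left_module_axioms reg.left_module_axioms hk(2)])
  have \<kappa>c: "\<kappa> i z \<in> carrier A" if "i \<in> K" for i
    using linear_map.closed[OF linear_\<kappa>[OF that] z] by simp
  have mem: "(\<lambda>i. \<kappa> i z \<odot>\<^bsub>P\<^esub> p i) \<in> K \<rightarrow> carrier P" using \<kappa>c p_closed by auto
  have "h z = (\<Oplus>\<^bsub>regular A\<^esub>i\<in>K. h (\<kappa> i z \<odot>\<^bsub>P\<^esub> p i))"
    using h.finsum[OF finite_K mem] sum_\<kappa>[OF z] by simp
  also have "\<dots> = (\<Oplus>\<^bsub>regular A\<^esub>i\<in>K. k (\<kappa> i z \<odot>\<^bsub>P\<^esub> p i))"
    using \<kappa>c p_closed eq dual_closed[OF h(2)] by (intro reg.M.finsum_cong') auto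
  also have "\<dots> = k z" using k.finsum[OF finite_K mem] sum_\<kappa>[OF z] by simp
  finally show "h z = k z" .
qed

text \<open>The witness is \<open>z \<mapsto> (\<kappa> j z) b\<close>; at \<open>p j\<close> its
  value is \<open>\<epsilon> j b = b\<close>.\<close>

lemma dual_exists:
  assumes j: "j \<in> K" and b: "b \<in> carrier A" "\<epsilon> j \<otimes> b = b"
  shows "\<exists>h\<in>carrier dual. h (p j) = b \<and> (\<forall>i\<in>K. i \<noteq> j \<longrightarrow> h (p i) = \<zero>)"
proof -
  interpret \<kappa>: linear_map A P "regular A" "\<kappa> j" by (rule linear_\<kappa>[OF j])
  have \<kappa>c: "\<kappa> j z \<in> carrier A" if "z \<in> carrier P" for z using \<kappa>.closed[OF that] by simp
  have "linear_map A P (regular A) (\<lambda>z. \<kappa> j z \<otimes> b)"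
    using b(1) \<kappa>c \<kappa>.add \<kappa>.smult
    by (intro linear_mapI P.left_module_axioms reg.left_module_axioms)
      (simp_all add: l_distr m_assoc)
  from linear_map_in_Hom[OF this] show ?thesis
    using p_closed b j by (intro bexI[of _ "restrict (\<lambda>z. \<kappa> j z \<otimes> b) (carrier P)"]) (auto simp: \<kappa>_p)
qed

lemma finite_length_dual: "finite_length (op_ring A) dual"
proof -
  let ?S = "direct_sum K (\<lambda>_. regular (op_ring A))"
  interpret S: left_module "op_ring A" ?S
    by (rule left_module_direct_sum[OF op.ring_axioms op.reg.left_module_axioms])
  have "linear_map (op_ring A) dual ?S (\<lambda>h. \<lambda>i\<in>K. h (p i))"
    using p_closed dual_closed
    by (intro linear_mapI left_module_dual S.left_module_axioms)
      (auto intro!: restrict_ext)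
  moreover have "inj_on (\<lambda>h. \<lambda>i\<in>K. h (p i)) (carrier dual)"
  proof (rule inj_onI)
    fix h k assume hk: "h \<in> carrier dual" "k \<in> carrier dual" "(\<lambda>i\<in>K. h (p i)) = (\<lambda>i\<in>K. k (p i))"
    have "h (p i) = k (p i)" if "i \<in> K" for i
      using fun_cong[OF hk(3), of i] that by simp
    then show "h = k" by (rule dual_eqI[OF hk(1,2)])
  qed
  ultimately show ?thesis
    by (rule linear_map.finite_length_inj)
      (rule finite_length_direct_sum[OF finite_K op.ring_axioms op.reg.left_module_axioms op.reg.fl])
qed

lemma finite_length_module_dual: "finite_length_module (op_ring A) dual"
  by (intro finite_length_moduleI left_module_dual
      finite_length_dual)

interpretation D: finite_length_module "op_ring A" dual
  by (rule finite_length_module_dual)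

text \<open>The submodule of the dual that corresponds under evaluation to the sum of the
  \<open>Z i\<close>, for right ideals \<open>Z i\<close> inside
  \<open>\<epsilon> i A\<close>.\<close>

definition box :: "(nat \<Rightarrow> 'a set) \<Rightarrow> ('b \<Rightarrow> 'a) set" where
  "box Z = {h \<in> carrier dual. \<forall>i\<in>K. h (p i) \<in> Z i}"

lemma box_memD: "h \<in> box Z \<Longrightarrow> i \<in> K \<Longrightarrow> h (p i) \<in> Z i"
  by (simp add: box_def)

abbreviation "right_ideal Z \<equiv> submodule Z (op_ring A) (regular (op_ring A))"

lemma right_idealD:
  assumes "right_ideal Z"
  shows "\<zero> \<in> Z" "\<And>x. x \<in> Z \<Longrightarrow> x \<in> carrier A" "\<And>x y. x \<in> Z \<Longrightarrow> y \<in> Z \<Longrightarrow> x \<oplus> y \<in> Z"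
    "\<And>x a. x \<in> Z \<Longrightarrow> a \<in> carrier A \<Longrightarrow> x \<otimes> a \<in> Z" "\<And>x y. x \<in> Z \<Longrightarrow> y \<in> Z \<Longrightarrow> x \<ominus> y \<in> Z"
  using op.reg.submoduleD[OF assms] op.reg.submodule_minus[OF assms] op.ring_axioms by auto

lemma submodule_box:
  assumes "\<And>i. i \<in> K \<Longrightarrow> right_ideal (Z i)"
  shows "submodule (box Z) (op_ring A) dual"
proof (rule D.submoduleI)
  note Z = right_idealD[OF assms]
  show "box Z \<subseteq> carrier dual" by (auto simp: box_def)
  show "\<zero>\<^bsub>dual\<^esub> \<in> box Z" using D.M.zero_closed Z(1) p_closed by (auto simp: box_def)
  show "h \<oplus>\<^bsub>dual\<^esub> k \<in> box Z" if hk: "h \<in> box Z" "k \<in> box Z" for h k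
    using hk D.M.a_closed[of h k] Z(3) p_closed by (auto simp: box_def)
  show "a \<odot>\<^bsub>dual\<^esub> h \<in> box Z" if "a \<in> carrier (op_ring A)" "h \<in> box Z" for a h
    using that D.smult_closed[of a h] Z(4) p_closed by (auto simp: box_def)
qed

lemma dual_minus:
  "h \<in> carrier dual \<Longrightarrow> k \<in> carrier dual \<Longrightarrow> x \<in> carrier P \<Longrightarrow> (h \<ominus>\<^bsub>dual\<^esub> k) x = h x \<ominus> k x"
  using linear_map.minus[OF linear_eval, of x h k] dual_closed op.ring_axioms by simp

text \<open>Evaluation at \<open>p j\<close> reduces the claim to \<open>X\<close> and
  \<open>Y\<close>: two elements of the larger box with equal value at \<open>p j\<close> differ by
  an element of the smaller box, which \<open>N\<close> contains.\<close>

lemma covers_box: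
  assumes Z: "\<And>i. i \<in> K \<Longrightarrow> right_ideal (Z i)" and j: "j \<in> K"
    and cov: "covers (op_ring A) (regular (op_ring A)) X Y" and Y: "\<And>b. b \<in> Y \<Longrightarrow> \<epsilon> j \<otimes> b = b"
  shows "covers (op_ring A) dual (box (Z(j := X))) (box (Z(j := Y)))"
proof -
  note c = coversD[OF cov]
  interpret ev: linear_map "op_ring A" dual "regular (op_ring A)" "\<lambda>h. h (p j)"
    by (rule linear_eval[OF p_closed[OF j]])
  have sX: "submodule (box (Z(j := X))) (op_ring A) dual" and sY: "submodule (box (Z(j := Y))) (op_ring A) dual"
    by (rule submodule_box; use Z c in simp)+
  have ex: "\<exists>h\<in>box (Z(j := W)). h (p j) = b" if bW: "b \<in> W" "b \<in> Y" for b W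
  proof -
    have b: "b \<in> carrier A" using right_idealD(2)[OF c(2)] bW by blast
    obtain h where "h \<in> carrier dual" "h (p j) = b" "\<forall>i\<in>K. i \<noteq> j \<longrightarrow> h (p i) = \<zero>"
      using dual_exists[OF j b Y[OF bW(2)]] by blast
    then show ?thesis using bW right_idealD(1)[OF Z] by (auto simp: box_def)
  qed
  obtain b where b: "b \<in> Y" "b \<notin> X" using c(3) by blast
  have "box (Z(j := X)) \<subseteq> box (Z(j := Y))" using c(3) j by (auto simp: box_def)
  moreover have "box (Z(j := X)) \<noteq> box (Z(j := Y))"
  proof
    assume eq: "box (Z(j := X)) = box (Z(j := Y))"
    obtain h where "h \<in> box (Z(j := Y))" "h (p j) = b" using ex[of b Y] b by blast
    then show False unfolding eq[symmetric] using b(2) j by (auto simp: box_def)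
  qed
  moreover have "N = box (Z(j := X)) \<or> N = box (Z(j := Y))"
    if N: "submodule N (op_ring A) dual" "box (Z(j := X)) \<subseteq> N" "N \<subseteq> box (Z(j := Y))" for N
  proof -
    let ?N = "(\<lambda>h. h (p j)) ` N"
    have "X \<subseteq> ?N" using ex[of _ X] c(3) N(2) by blast
    moreover have "h (p j) \<in> Y" if "h \<in> N" for h
      using subsetD[OF N(3) that] j by (auto simp: box_def)
    then have "?N \<subseteq> Y" by blast
    ultimately have "?N = X \<or> ?N = Y" using c(4)[OF ev.submodule_image[OF N(1)]] by blast
    then show ?thesis
    proof
      assume eq: "?N = X"
      have "h \<in> box (Z(j := X))" if h: "h \<in> N" for h
      proof -
        have "h (p j) \<in> X" using eq h by blast
        moreover have "h \<in> box (Z(j := Y))" using h N(3) by blast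
        ultimately show ?thesis unfolding box_def fun_upd_apply by (auto split: if_splits)
      qed
      then show ?thesis using N(2) by blast
    next
      assume eq: "?N = Y"
      have "k \<in> N" if k: "k \<in> box (Z(j := Y))" for k
      proof -
        have "k (p j) \<in> ?N" using k j eq by (auto simp: box_def)
        then obtain h where h: "h \<in> N" "h (p j) = k (p j)" by auto
        have hb: "h \<in> box (Z(j := Y))" using h N(3) by blast
        then have hc: "h \<in> carrier dual" "k \<in> carrier dual" using k by (simp_all add: box_def)
        have "(k \<ominus>\<^bsub>dual\<^esub> h) (p i) \<in> (Z(j := X)) i" if i: "i \<in> K" for i
        proof (cases "i = j")
          case True
          then show ?thesis
            using dual_minus[OF hc(2,1) p_closed[OF i]] h(2) dual_closed[OF hc(2) p_closed[OF i]]
              right_idealD(1)[OF c(1)] by (simp add: minus_eq r_neg)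
        next
          case False
          then show ?thesis
            using dual_minus[OF hc(2,1) p_closed[OF i]] right_idealD(5)[OF Z[OF i]]
              box_memD[OF hb i] box_memD[OF k i] by simp
        qed
        then have "k \<ominus>\<^bsub>dual\<^esub> h \<in> N" using D.M.minus_closed[OF hc(2,1)] N(2) by (auto simp: box_def)
        then have "(k \<ominus>\<^bsub>dual\<^esub> h) \<oplus>\<^bsub>dual\<^esub> h \<in> N" by (rule D.submoduleD(4)[OF N(1) _ h(1)])
        then show ?thesis using D.minus_add_cancel[OF hc(2,1)] by simp
      qed
      then show ?thesis using N(3) by blast
    qed
  qed
  ultimately show ?thesis using sX sY by (auto simp: covers_def)
qed

text \<open>The coordinates are filled one at a time, starting from zero. Filling coordinate
  \<open>j\<close> along a chain of right ideals lifts each cover to a cover of boxes.\<close>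

lemma rank_box:
  assumes Z: "\<And>i. i \<in> K \<Longrightarrow> right_ideal (Z i)" and le: "\<And>i b. i \<in> K \<Longrightarrow> b \<in> Z i \<Longrightarrow> \<epsilon> i \<otimes> b = b"
  shows "rank (op_ring A) dual (box Z) = (\<Sum>i\<in>K. rank (op_ring A) (regular (op_ring A)) (Z i))"
proof -
  let ?r = "rank (op_ring A) (regular (op_ring A))"
  have one: "rank (op_ring A) dual (box (W(j := U))) = rank (op_ring A) dual (box (W(j := {\<zero>}))) + ?r U"
    if W: "\<And>i. i \<in> K \<Longrightarrow> right_ideal (W i)" and j: "j \<in> K" and U: "right_ideal U" "U \<subseteq> Z j" for W j U
    using U
  proof (induct rule: op.reg.submodule_induct)
    case zero
    then show ?case using op.reg.rank_zero by simp
  next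
    case (covers X Y)
    have "X \<subseteq> Z j" using covers(3) coversD(3)[OF covers(1)] by blast
    note IH = covers(2)[OF this]
    have "covers (op_ring A) dual (box (W(j := X))) (box (W(j := Y)))"
      using covers(3) le[OF j] by (intro covers_box[OF W j covers(1)]) auto
    from D.rank_covers[OF this] show ?case
      using op.reg.rank_covers[OF covers(1)] IH by presburger
  qed
  have zero: "right_ideal {\<zero>}" using op.reg.submodule_zero by simp
  have "rank (op_ring A) dual (box (\<lambda>i. if i \<in> F then Z i else {\<zero>})) = (\<Sum>i\<in>F. ?r (Z i))"
    if "finite F" "F \<subseteq> K" for F
    using that
  proof (induct F rule: finite_induct)
    case empty
    have "box (\<lambda>i. {\<zero>}) = {\<zero>\<^bsub>dual\<^esub>}"
    proof (intro subset_antisym subsetI)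
      fix h assume h: "h \<in> box (\<lambda>i. {\<zero>})"
      have "h = \<zero>\<^bsub>dual\<^esub>"
      proof (rule dual_eqI)
        show "h (p i) = \<zero>\<^bsub>dual\<^esub> (p i)" if "i \<in> K" for i
          using box_memD[OF h that] p_closed[OF that] by simp
      qed (use h D.M.zero_closed in \<open>simp_all only: box_def mem_Collect_eq\<close>)
      then show "h \<in> {\<zero>\<^bsub>dual\<^esub>}" by simp
    next
      fix h assume "h \<in> {\<zero>\<^bsub>dual\<^esub>}"
      then show "h \<in> box (\<lambda>i. {\<zero>})"
        using D.submoduleD(3)[OF submodule_box[OF zero]] by simp
    qed
    then show ?case using D.rank_zero by simp
  next
    case (insert j F)
    let ?W = "\<lambda>i. if i \<in> F then Z i else {\<zero>}"
    have W: "right_ideal (?W i)" if "i \<in> K" for i using Z[OF that] zero by simp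
    have "(\<lambda>i. if i \<in> insert j F then Z i else {\<zero>}) = ?W(j := Z j)" by (rule ext) simp
    moreover have "?W(j := {\<zero>}) = ?W" using insert(2) by (intro ext) simp
    moreover have "rank (op_ring A) dual (box (?W(j := Z j))) =
        rank (op_ring A) dual (box (?W(j := {\<zero>}))) + ?r (Z j)"
      using insert(4) Z by (intro one W) auto
    moreover have "rank (op_ring A) dual (box ?W) = (\<Sum>i\<in>F. ?r (Z i))" using insert(3,4) by blast
    ultimately show ?case using insert(1,2) by simp
  qed
  from this[OF finite_K subset_refl]
  have "rank (op_ring A) dual (box (\<lambda>i. if i \<in> K then Z i else {\<zero>})) = (\<Sum>i\<in>K. ?r (Z i))" .
  moreover have "box (\<lambda>i. if i \<in> K then Z i else {\<zero>}) = box Z" by (auto simp: box_def)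
  ultimately show ?thesis by simp
qed

end

section \<open>Radical layers and the length of the transpose\<close>

lemma (in left_module) finsum_singleton_index:
  "f i \<in> carrier M \<Longrightarrow> (\<Oplus>\<^bsub>M\<^esub>j\<in>{i}. f j) = f i"
  using M.finsum_insert[of "{}" i f] by simp

lemma (in ring) submodule_ideal: "ideal I R \<Longrightarrow> submodule I R (regular R)"
proof -
  assume "ideal I R"
  then interpret I: ideal I R .
  interpret reg: left_module R "regular R" by (rule left_module_regular[OF ring_axioms])
  show ?thesis by (rule reg.submoduleI) (use I.a_subset I.I_l_closed in auto)
qed

lemma (in finite_length_ring) ideal_JJ: "ideal (J \<cdot> J) A"
  by (rule ideal_prod_is_ideal[OF ideal_J ideal_J])

context finite_length_ring
begin

interpretation op: finite_length_ring "op_ring A"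
  by (rule finite_length_ring_op)

lemma ideal_op_J: "ideal J (op_ring A)" and ideal_op_JJ: "ideal (J \<cdot> J) (op_ring A)"
  using op.ideal_J op.ideal_JJ by (simp_all add: jacobson_radical_op ideal_prod_op)

lemma JJ_subset_J: "J \<cdot> J \<subseteq> J"
  using ideal_prod_inter[OF ideal_J ideal_J] by blast

lemma mem_right_coset_idem:
  "idempotent_elt A \<epsilon> \<Longrightarrow> b \<in> \<epsilon> <# carrier A \<longleftrightarrow> b \<in> carrier A \<and> \<epsilon> \<otimes> b = b"
  using op.mem_left_coset_idem[of \<epsilon> b] by (simp add: r_coset_op_ring)

lemma mem_right_coset_idem_ideal:
  "idempotent_elt A \<epsilon> \<Longrightarrow> ideal I (op_ring A) \<Longrightarrow> b \<in> \<epsilon> <# I \<longleftrightarrow> b \<in> I \<and> \<epsilon> \<otimes> b = b"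
  using op.mem_left_coset_idem_ideal[of \<epsilon> I b] by (simp add: r_coset_op_ring)

lemma right_ideal_right_coset:
  assumes "\<epsilon> \<in> carrier A"
  shows "submodule (\<epsilon> <# carrier A) (op_ring A) (regular (op_ring A))"
    and "ideal I (op_ring A) \<Longrightarrow> submodule (\<epsilon> <# I) (op_ring A) (regular (op_ring A))"
  using op.submodule_left_coset[of \<epsilon>] op.submodule_ideal op.reg.submodule_carrier assms
  by (simp_all add: r_coset_op_ring)

text \<open>The summand 1 is the simple top \<open>\<epsilon> A / \<epsilon> J\<close>; the middle
  term is the layer below it.\<close>

lemma rank_right_coset:
  assumes "primitive_idempotent A \<epsilon>"
  shows "rank (op_ring A) (regular (op_ring A)) (\<epsilon> <# carrier A) =
    rank (op_ring A) (regular (op_ring A)) (\<epsilon> <# (J \<cdot> J)) +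
      comp_length (op_ring A) (rquot A (\<epsilon> <# J) (\<epsilon> <# (J \<cdot> J))) + 1"
proof -
  have \<epsilon>: "\<epsilon> \<in> carrier A" using assms by (simp add: primitive_idempotent_def idempotent_elt_def)
  have "covers (op_ring A) (regular (op_ring A)) (\<epsilon> <# J) (\<epsilon> <# carrier A)"
    using op.covers_primitive[of \<epsilon>] assms by (simp add: r_coset_op_ring jacobson_radical_op)
  moreover have "\<epsilon> <# (J \<cdot> J) \<subseteq> \<epsilon> <# J" using JJ_subset_J by (auto simp: l_coset_def)
  ultimately show ?thesis
    using op.reg.rank_covers
      op.reg.comp_length_quot_sub(1)[OF right_ideal_right_coset(2)[OF \<epsilon> ideal_op_JJ]
        right_ideal_right_coset(2)[OF \<epsilon> ideal_op_J]]
    by (simp add: rquot_def)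
qed

theorem radical_layer_length_pos:
  assumes e: "primitive_idempotent A e" and prim: "\<And>i. i \<in> K \<Longrightarrow> primitive_idempotent A (\<epsilon> i)"
    and K: "finite K"
    and iso: "module_iso A (lquot A (J #> e) ((J \<cdot> J) #> e))
      (direct_sum K (\<lambda>i. lquot A (carrier A #> \<epsilon> i) (J #> \<epsilon> i)))"
    and j: "j \<in> K"
  shows "1 \<le> comp_length (op_ring A) (rquot A (\<epsilon> j <# J) (\<epsilon> j <# (J \<cdot> J)))"
proof (rule ccontr)
  assume neg: "\<not> ?thesis"
  have idem: "idempotent_elt A e" "\<And>i. i \<in> K \<Longrightarrow> idempotent_elt A (\<epsilon> i)"
    using e prim by (auto simp: primitive_idempotent_def)
  have \<epsilon>c: "\<epsilon> i \<in> carrier A" "\<epsilon> i \<otimes> \<epsilon> i = \<epsilon> i" if "i \<in> K" for i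
    using idem(2)[OF that] by (auto simp: idempotent_elt_def)
  obtain y where y: "\<And>i. i \<in> K \<Longrightarrow> y i \<in> J #> e" "\<And>i. i \<in> K \<Longrightarrow> \<epsilon> i \<otimes> y i = y i"
    and rel: "\<And>t i. t \<in> (\<Pi>\<^sub>E i\<in>K. carrier A #> \<epsilon> i) \<Longrightarrow>
      (\<Oplus>\<^bsub>(regular A)\<lparr>carrier := J #> e\<rparr>\<^esub>i\<in>K. t i \<otimes> y i) \<in> (J \<cdot> J) #> e \<Longrightarrow> i \<in> K \<Longrightarrow> t i \<in> J"
    by (rule iso_generators[OF idem K iso]) blast+
  note RI = right_ideal_right_coset(2)[OF \<epsilon>c(1)[OF j]]
  have sub: "\<epsilon> j <# (J \<cdot> J) \<subseteq> \<epsilon> j <# J" using JJ_subset_J by (auto simp: l_coset_def)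
  have "rank (op_ring A) (regular (op_ring A)) (\<epsilon> j <# J) =
      rank (op_ring A) (regular (op_ring A)) (\<epsilon> j <# (J \<cdot> J))"
    using op.reg.comp_length_quot_sub(1)[OF RI[OF ideal_op_JJ] RI[OF ideal_op_J] sub] neg
    by (simp add: rquot_def)
  then have eq: "\<epsilon> j <# J = \<epsilon> j <# (J \<cdot> J)"
    using op.reg.rank_strict_mono[OF RI[OF ideal_op_JJ] RI[OF ideal_op_J]] sub by (metis less_irrefl psubsetI)
  have yj: "y j \<in> J" "y j \<otimes> e = y j"
    using y(1)[OF j] mem_left_coset_idem_ideal[OF idem(1) ideal_J] by auto
  then have "y j \<in> \<epsilon> j <# J"
    using y(2)[OF j] mem_right_coset_idem_ideal[OF idem(2)[OF j] ideal_op_J] by simp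
  then have "y j \<in> J \<cdot> J"
    unfolding eq using mem_right_coset_idem_ideal[OF idem(2)[OF j] ideal_op_JJ] by simp
  then have yJJ: "y j \<in> (J \<cdot> J) #> e"
    using yj mem_left_coset_idem_ideal[OF idem(1) ideal_JJ] by simp
  have X: "submodule (J #> e) A (regular A)"
    using idem(1) by (intro submodule_left_coset submodule_J) (simp add: idempotent_elt_def)
  interpret X: left_module A "(regular A)\<lparr>carrier := J #> e\<rparr>" by (rule reg.left_module_sub[OF X])
  \<comment> \<open>The unit vector at \<open>j\<close> yields the combination \<open>y j\<close>.
    With this in \<open>J^2 e\<close>, its entry \<open>\<epsilon> j\<close> would be in
    \<open>J\<close>, impossible for a nonzero idempotent.\<close>
  let ?t = "\<lambda>i\<in>K. if i = j then \<epsilon> j else \<zero>"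
  have yc: "y i \<in> carrier A" if "i \<in> K" for i using reg.submoduleD(2)[OF X y(1)[OF that]] by simp
  have t: "?t \<in> (\<Pi>\<^sub>E i\<in>K. carrier A #> \<epsilon> i)"
    using \<epsilon>c mem_left_coset_idem[OF idem(2)] by auto
  have "(\<Oplus>\<^bsub>(regular A)\<lparr>carrier := J #> e\<rparr>\<^esub>i\<in>K. ?t i \<otimes> y i) =
      (\<Oplus>\<^bsub>(regular A)\<lparr>carrier := J #> e\<rparr>\<^esub>i\<in>K. if i = j then y j else \<zero>\<^bsub>(regular A)\<lparr>carrier := J #> e\<rparr>\<^esub>)"
    using y yc j X.M.zero_closed by (intro X.M.finsum_cong') auto
  also have "\<dots> = y j" using y(1)[OF j] by (intro X.finsum_single[OF K j]) simp
  finally have "\<epsilon> j \<in> J" using rel[OF t _ j] yJJ j by simp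
  then show False
    using idempotent_mem_J[OF idem(2)[OF j]] prim[OF j] by (simp add: primitive_idempotent_def)
qed

text \<open>With \<open>V\<close> the dual of \<open>P1\<close>, \<open>B\<close> the image of the
  dual of \<open>P0\<close> and \<open>W\<close> the part of \<open>V\<close> with values in
  \<open>J^2\<close>, the length of \<open>V / B\<close> is at least
  \<open>rank V - rank (B + W)\<close>, and \<open>rank (B + W)\<close> exceeds
  \<open>rank W\<close> by at most 1. Each index contributes a simple top and one radical layer to
  \<open>V / W\<close>.\<close>

theorem transpose_length:
  fixes K :: "nat set" and P0 :: "('a, 'p0) module"
  assumes e: "primitive_idempotent A e" and prim: "\<And>i. i \<in> K \<Longrightarrow> primitive_idempotent A (\<epsilon> i)"
    and K: "finite K"
    and iso: "module_iso A (lquot A (J #> e) ((J \<cdot> J) #> e))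
      (direct_sum K (\<lambda>i. lquot A (carrier A #> \<epsilon> i) (J #> \<epsilon> i)))"
    and M: "left_module A M" and m0: "m0 \<in> carrier M" "e \<odot>\<^bsub>M\<^esub> m0 = m0"
    and gen: "\<And>x. x \<in> carrier M \<Longrightarrow> \<exists>a\<in>carrier A. x = a \<odot>\<^bsub>M\<^esub> m0"
    and ann: "\<And>a. a \<in> carrier A #> e \<Longrightarrow> a \<odot>\<^bsub>M\<^esub> m0 = \<zero>\<^bsub>M\<^esub> \<longleftrightarrow> a \<in> J"
    and mpp: "minimal_projective_presentation A P1 f P0 p M"
  shows "left_module (op_ring A) (transpose_mod A P1 f P0)"
    and "finite_length (op_ring A) (transpose_mod A P1 f P0)"
    and "int (card K) - 1 + (\<Sum>i\<in>K. int (comp_length (op_ring A) (rquot A (\<epsilon> i <# J) (\<epsilon> i <# (J \<cdot> J)))))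
      \<le> int (comp_length (op_ring A) (transpose_mod A P1 f P0))"
proof -
  have idem: "idempotent_elt A e" "\<And>i. i \<in> K \<Longrightarrow> idempotent_elt A (\<epsilon> i)"
    using e prim by (auto simp: primitive_idempotent_def)
  have ec: "e \<in> carrier A" "e \<otimes> e = e" using idem(1) by (auto simp: idempotent_elt_def)
  have \<epsilon>c: "\<epsilon> i \<in> carrier A" "\<epsilon> i \<otimes> \<epsilon> i = \<epsilon> i" if "i \<in> K" for i
    using idem(2)[OF that] by (auto simp: idempotent_elt_def)
  obtain y where y: "\<And>i. i \<in> K \<Longrightarrow> y i \<in> J #> e" "\<And>i. i \<in> K \<Longrightarrow> \<epsilon> i \<otimes> y i = y i"
    and yspan: "\<And>x. x \<in> J #> e \<Longrightarrow>
      \<exists>t\<in>\<Pi>\<^sub>E i\<in>K. carrier A #> \<epsilon> i. x = (\<Oplus>\<^bsub>(regular A)\<lparr>carrier := J #> e\<rparr>\<^esub>i\<in>K. t i \<otimes> y i)"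
    and yrel: "\<And>t i. t \<in> (\<Pi>\<^sub>E i\<in>K. carrier A #> \<epsilon> i) \<Longrightarrow>
      (\<Oplus>\<^bsub>(regular A)\<lparr>carrier := J #> e\<rparr>\<^esub>i\<in>K. t i \<otimes> y i) \<in> (J \<cdot> J) #> e \<Longrightarrow> i \<in> K \<Longrightarrow> t i \<in> J"
    by (rule iso_generators[OF idem K iso]) blast+
  define X where "X = (regular A)\<lparr>carrier := J #> e\<rparr>"
  define T0 where "T0 = P0\<lparr>carrier := a_kernel P0 M p\<rparr>"
  have Xsub: "submodule (J #> e) A (regular A)" by (rule submodule_left_coset[OF ec(1) submodule_J])
  interpret X: left_module A X unfolding X_def by (rule reg.left_module_sub[OF Xsub])
  interpret M: left_module A M by (rule M)
  have pc0: "projective_cover A P0 p M" and pc1: "projective_cover A P1 f T0"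
    using mpp by (auto simp: minimal_projective_presentation_def T0_def)
  have P0: "left_module A P0" and P1: "left_module A P1"
    using pc0 pc1 by (auto simp: projective_cover_def projective_def fg_module_def)
  have pH: "p \<in> module_Hom A P0 M" using pc0 by (simp add: projective_cover_def)
  interpret p: linear_map A P0 M p by (rule linear_map_of_Hom[OF P0 M pH])
  have T0: "left_module A T0" unfolding T0_def by (rule p.dom.left_module_sub[OF p.submodule_kernel])
  have fH: "f \<in> module_Hom A P1 T0" using pc1 by (simp add: projective_cover_def)
  interpret f: linear_map A P1 T0 f by (rule linear_map_of_Hom[OF P1 T0 fH])
  have Xmem: "a \<in> J #> e \<longleftrightarrow> a \<in> J \<and> a \<otimes> e = a" for a
    by (rule mem_left_coset_idem_ideal[OF idem(1) ideal_J])
  have Amem: "a \<in> carrier A #> e \<longleftrightarrow> a \<in> carrier A \<and> a \<otimes> e = a" for a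
    by (rule mem_left_coset_idem[OF idem(1)])

  \<comment> \<open>\<open>P0\<close> has a single basis vector; the index set \<open>{0}\<close>
    fits it into the general form of the coordinates.\<close>
  obtain p0' \<kappa>0' where c0: "\<And>i. i \<in> {0::nat} \<Longrightarrow> p0' i \<in> carrier P0" "\<And>i. i \<in> {0} \<Longrightarrow> p (p0' i) = m0"
    "\<And>i. i \<in> {0} \<Longrightarrow> e \<odot>\<^bsub>P0\<^esub> p0' i = p0' i" "\<And>i. i \<in> {0} \<Longrightarrow> linear_map A P0 (regular A) (\<kappa>0' i)"
    "\<And>i z. i \<in> {0} \<Longrightarrow> z \<in> carrier P0 \<Longrightarrow> \<kappa>0' i z \<in> carrier A #> e"
    "\<And>z. z \<in> carrier P0 \<Longrightarrow> (\<Oplus>\<^bsub>P0\<^esub>i\<in>{0}. \<kappa>0' i z \<odot>\<^bsub>P0\<^esub> p0' i) = z"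
    "\<And>i j. i \<in> {0} \<Longrightarrow> j \<in> {0} \<Longrightarrow> \<kappa>0' i (p0' j) = (if i = j then e else \<zero>)"
  proof (rule projective_cover_coordinates[OF pc0 M, of "{0::nat}" "\<lambda>_. e" "\<lambda>_. m0"])
    show "\<exists>t\<in>\<Pi>\<^sub>E i\<in>{0::nat}. carrier A #> e. x = (\<Oplus>\<^bsub>M\<^esub>i\<in>{0}. t i \<odot>\<^bsub>M\<^esub> m0)" if x: "x \<in> carrier M" for x
    proof -
      obtain a where a: "a \<in> carrier A" "x = a \<odot>\<^bsub>M\<^esub> m0" using gen[OF x] by blast
      have "x = (a \<otimes> e) \<odot>\<^bsub>M\<^esub> m0" using a m0 ec by (simp add: M.smult_assoc1)
      moreover have "a \<otimes> e \<in> carrier A #> e" using a by (auto simp: r_coset_def)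
      ultimately show ?thesis
        using M.finsum_singleton_index[of "\<lambda>i. (\<lambda>i\<in>{0::nat}. a \<otimes> e) i \<odot>\<^bsub>M\<^esub> m0" 0] a(1) ec m0
        by (intro bexI[of _ "\<lambda>i\<in>{0}. a \<otimes> e"]) auto
    qed
    show "t i \<in> J" if t: "t \<in> (\<Pi>\<^sub>E i\<in>{0::nat}. carrier A #> e)"
      and 0: "(\<Oplus>\<^bsub>M\<^esub>i\<in>{0}. t i \<odot>\<^bsub>M\<^esub> m0) = \<zero>\<^bsub>M\<^esub>" and i: "i \<in> {0}" for t i
    proof -
      have t0: "t 0 \<in> carrier A #> e" using t by auto
      then have "(\<Oplus>\<^bsub>M\<^esub>i\<in>{0}. t i \<odot>\<^bsub>M\<^esub> m0) = t 0 \<odot>\<^bsub>M\<^esub> m0"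
        using m0 Amem by (intro M.finsum_singleton_index) simp
      then show ?thesis using 0 ann[OF t0] i by simp
    qed
  qed (use idem m0 in blast)+
  define p0 where "p0 = p0' 0"
  define \<kappa>0 where "\<kappa>0 = \<kappa>0' 0"
  have p0: "p0 \<in> carrier P0" "p p0 = m0" "e \<odot>\<^bsub>P0\<^esub> p0 = p0" "\<kappa>0 p0 = e"
    using c0(1-3,7) by (simp_all add: p0_def \<kappa>0_def)
  interpret \<kappa>0: linear_map A P0 "regular A" \<kappa>0 unfolding \<kappa>0_def by (rule c0(4)) simp
  have \<kappa>0mem: "\<kappa>0 z \<in> carrier A #> e" if "z \<in> carrier P0" for z
    using c0(5)[OF _ that] by (simp add: \<kappa>0_def)
  have \<kappa>0p0: "\<kappa>0 z \<odot>\<^bsub>P0\<^esub> p0 = z" if "z \<in> carrier P0" for z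
    using c0(6)[OF that] p.dom.finsum_singleton_index[of "\<lambda>i. \<kappa>0' i z \<odot>\<^bsub>P0\<^esub> p0' i" 0]
      \<kappa>0mem[OF that] p0(1) Amem by (simp add: \<kappa>0_def p0_def)

  \<comment> \<open>The map \<open>a \<mapsto> a p0\<close> carries \<open>J e\<close> into the
    kernel of \<open>p\<close>, so the generators \<open>y i\<close> of \<open>J e\<close> become
    the generators \<open>y i p0\<close> of the kernel that \<open>P1\<close> covers.\<close>
  have ker: "a \<odot>\<^bsub>P0\<^esub> p0 \<in> a_kernel P0 M p" if "a \<in> J #> e" for a
    using that ann[of a] p0 J_carrier Amem Xmem by (simp add: p.kernel_eq)
  have glin: "linear_map A X T0 (\<lambda>a. a \<odot>\<^bsub>P0\<^esub> p0)"
    unfolding X_def T0_def using ker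
    by (intro linear_map.restrict_cod linear_map.restrict_dom linear_map_smult_right P0 p0(1)
        Xsub p.submodule_kernel) auto
  interpret g: linear_map A X T0 "\<lambda>a. a \<odot>\<^bsub>P0\<^esub> p0" by (rule glin)
  have sm: "a \<odot>\<^bsub>X\<^esub> x = a \<otimes> x" for a x by (simp add: X_def)
  have T0s: "a \<odot>\<^bsub>T0\<^esub> x = a \<odot>\<^bsub>P0\<^esub> x" "\<zero>\<^bsub>T0\<^esub> = \<zero>\<^bsub>P0\<^esub>" for a x by (simp_all add: T0_def)
  have yX: "y i \<in> carrier X" if "i \<in> K" for i using y(1)[OF that] by (simp add: X_def)
  have yJ: "y i \<in> J" "y i \<otimes> e = y i" "y i \<in> carrier A" if "i \<in> K" for i
    using y(1)[OF that] Xmem J_carrier by auto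
  have tA: "t i \<in> carrier A" if "t \<in> (\<Pi>\<^sub>E i\<in>K. carrier A #> \<epsilon> i)" "i \<in> K" for t i
    using that mem_left_coset_idem[OF idem(2)[OF that(2)]] by (auto simp: PiE_iff)
  have sumX: "(\<lambda>i. t i \<otimes> y i) \<in> K \<rightarrow> carrier X" if t: "t \<in> (\<Pi>\<^sub>E i\<in>K. carrier A #> \<epsilon> i)" for t
    using X.smult_closed[OF tA[OF t] yX] by (auto simp: sm)
  have gsum: "(\<Oplus>\<^bsub>X\<^esub>i\<in>K. t i \<otimes> y i) \<odot>\<^bsub>P0\<^esub> p0 = (\<Oplus>\<^bsub>T0\<^esub>i\<in>K. t i \<odot>\<^bsub>T0\<^esub> (y i \<odot>\<^bsub>P0\<^esub> p0))"
    if t: "t \<in> (\<Pi>\<^sub>E i\<in>K. carrier A #> \<epsilon> i)" for t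
  proof -
    have "(\<Oplus>\<^bsub>X\<^esub>i\<in>K. t i \<otimes> y i) \<odot>\<^bsub>P0\<^esub> p0 = (\<Oplus>\<^bsub>T0\<^esub>i\<in>K. (t i \<otimes> y i) \<odot>\<^bsub>P0\<^esub> p0)"
      by (rule g.finsum[OF K sumX[OF t]])
    also have "\<dots> = (\<Oplus>\<^bsub>T0\<^esub>i\<in>K. t i \<odot>\<^bsub>T0\<^esub> (y i \<odot>\<^bsub>P0\<^esub> p0))"
    proof (rule f.cod.M.finsum_cong'[OF refl])
      show "(\<lambda>i. t i \<odot>\<^bsub>T0\<^esub> (y i \<odot>\<^bsub>P0\<^esub> p0)) \<in> K \<rightarrow> carrier T0"
        using f.cod.smult_closed[OF tA[OF t] g.closed[OF yX]] by auto
      show "(t i \<otimes> y i) \<odot>\<^bsub>P0\<^esub> p0 = t i \<odot>\<^bsub>T0\<^esub> (y i \<odot>\<^bsub>P0\<^esub> p0)" if "i \<in> K" for i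
        using tA[OF t that] yJ[OF that] p0(1) by (simp add: T0s p.dom.smult_assoc1)
    qed
    finally show ?thesis .
  qed
  obtain p1 \<kappa>1 where c1: "\<And>i. i \<in> K \<Longrightarrow> p1 i \<in> carrier P1" "\<And>i. i \<in> K \<Longrightarrow> f (p1 i) = y i \<odot>\<^bsub>P0\<^esub> p0"
    "\<And>i. i \<in> K \<Longrightarrow> \<epsilon> i \<odot>\<^bsub>P1\<^esub> p1 i = p1 i" "\<And>i. i \<in> K \<Longrightarrow> linear_map A P1 (regular A) (\<kappa>1 i)"
    "\<And>i z. i \<in> K \<Longrightarrow> z \<in> carrier P1 \<Longrightarrow> \<kappa>1 i z \<in> carrier A #> \<epsilon> i"
    "\<And>z. z \<in> carrier P1 \<Longrightarrow> (\<Oplus>\<^bsub>P1\<^esub>i\<in>K. \<kappa>1 i z \<odot>\<^bsub>P1\<^esub> p1 i) = z"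
    "\<And>i j. i \<in> K \<Longrightarrow> j \<in> K \<Longrightarrow> \<kappa>1 i (p1 j) = (if i = j then \<epsilon> i else \<zero>)"
  proof (rule projective_cover_coordinates[OF pc1 T0 K, of \<epsilon> "\<lambda>i. y i \<odot>\<^bsub>P0\<^esub> p0"])
    show "y i \<odot>\<^bsub>P0\<^esub> p0 \<in> carrier T0" if "i \<in> K" for i by (rule g.closed[OF yX[OF that]])
    show "\<epsilon> i \<odot>\<^bsub>T0\<^esub> (y i \<odot>\<^bsub>P0\<^esub> p0) = y i \<odot>\<^bsub>P0\<^esub> p0" if "i \<in> K" for i
      using p.dom.smult_assoc1[of "\<epsilon> i" "y i" p0] \<epsilon>c(1)[OF that] yJ(3)[OF that] y(2)[OF that] p0(1)
      by (simp add: T0s)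
    show "\<exists>t\<in>\<Pi>\<^sub>E i\<in>K. carrier A #> \<epsilon> i. x = (\<Oplus>\<^bsub>T0\<^esub>i\<in>K. t i \<odot>\<^bsub>T0\<^esub> (y i \<odot>\<^bsub>P0\<^esub> p0))"
      if x: "x \<in> carrier T0" for x
    proof -
      have xc: "x \<in> carrier P0" "p x = \<zero>\<^bsub>M\<^esub>" using x by (auto simp: T0_def p.kernel_eq)
      have a: "\<kappa>0 x \<in> carrier A" "\<kappa>0 x \<otimes> e = \<kappa>0 x" using \<kappa>0mem[OF xc(1)] Amem by auto
      have "\<kappa>0 x \<odot>\<^bsub>M\<^esub> m0 = p (\<kappa>0 x \<odot>\<^bsub>P0\<^esub> p0)" using p0 a by simp
      then have "\<kappa>0 x \<odot>\<^bsub>M\<^esub> m0 = \<zero>\<^bsub>M\<^esub>" using \<kappa>0p0[OF xc(1)] xc by simp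
      then have "\<kappa>0 x \<in> J #> e" using ann[OF \<kappa>0mem[OF xc(1)]] a Xmem by simp
      then obtain t where "t \<in> (\<Pi>\<^sub>E i\<in>K. carrier A #> \<epsilon> i)" "\<kappa>0 x = (\<Oplus>\<^bsub>X\<^esub>i\<in>K. t i \<otimes> y i)"
        using yspan unfolding X_def by blast
      then show ?thesis using gsum \<kappa>0p0[OF xc(1)] by metis
    qed
    show "t i \<in> J" if t: "t \<in> (\<Pi>\<^sub>E i\<in>K. carrier A #> \<epsilon> i)"
      and 0: "(\<Oplus>\<^bsub>T0\<^esub>i\<in>K. t i \<odot>\<^bsub>T0\<^esub> (y i \<odot>\<^bsub>P0\<^esub> p0)) = \<zero>\<^bsub>T0\<^esub>" and i: "i \<in> K" for t i
    proof -
      let ?a = "\<Oplus>\<^bsub>X\<^esub>i\<in>K. t i \<otimes> y i"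
      have a: "?a \<in> J #> e" using X.M.finsum_closed[OF sumX[OF t]] by (simp add: X_def)
      have "?a \<odot>\<^bsub>P0\<^esub> p0 = \<zero>\<^bsub>P0\<^esub>" using 0 gsum[OF t] by (simp add: T0s)
      \<comment> \<open>On \<open>A e\<close> the coordinate \<open>\<kappa>0\<close> undoes
        multiplication into \<open>p0\<close>, so a relation among the \<open>y i p0\<close> is
        already one among the \<open>y i\<close>.\<close>
      then have "\<kappa>0 (?a \<odot>\<^bsub>P0\<^esub> p0) = \<zero>" using \<kappa>0.zero by simp
      moreover have "\<kappa>0 (?a \<odot>\<^bsub>P0\<^esub> p0) = ?a \<otimes> e"
        using \<kappa>0.smult[of ?a p0] a J_carrier Xmem p0 by simp
      ultimately have "?a = \<zero>" using a Xmem by simp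
      moreover have "\<zero> \<in> (J \<cdot> J) #> e"
        using reg.submoduleD(3)[OF submodule_left_coset[OF ec(1) submodule_ideal[OF ideal_JJ]]] by simp
      ultimately show ?thesis using yrel[OF t _ i] by (simp add: X_def)
    qed
  qed (use idem in blast)+

  interpret D0: left_module "op_ring A" "ring_dual A P0" by (rule left_module_ring_dual[OF P0])
  have "projective_coordinates A P1 K \<epsilon> p1 \<kappa>1"
    using c1 idem K
    by (intro projective_coordinates.intro projective_coordinates_axioms.intro finite_length_ring_axioms P1)
  then interpret c: projective_coordinates A P1 K \<epsilon> p1 \<kappa>1 .
  interpret D: finite_length_module "op_ring A" "ring_dual A P1" by (rule c.finite_length_module_dual)
  define \<Phi> where "\<Phi> h = compose (carrier P1) h f" for h :: "'p0 \<Rightarrow> 'a"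
  have fP0: "f z \<in> carrier P0" if "z \<in> carrier P1" for z
    using f.closed[OF that] by (simp add: T0_def p.kernel_eq)
  have \<Phi>H: "\<Phi> h \<in> carrier (ring_dual A P1)" if "h \<in> carrier (ring_dual A P0)" for h
  proof -
    have h: "h \<in> module_Hom A P0 (regular A)" using that by simp
    show ?thesis
      unfolding ring_dual_simps
      using module_HomD(2-4)[OF h] f.add f.smult fP0
      by (intro module_HomI) (simp_all add: \<Phi>_def compose_def T0_def)
  qed
  interpret \<Phi>: linear_map "op_ring A" "ring_dual A P0" "ring_dual A P1" \<Phi>
    by (intro linear_mapI D0.left_module_axioms D.left_module_axioms)
      (use \<Phi>H fP0 in \<open>auto simp: \<Phi>_def compose_def intro!: restrict_ext\<close>)
  define B where "B = \<Phi> ` carrier (ring_dual A P0)"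
  have Bsub: "submodule B (op_ring A) (ring_dual A P1)"
    unfolding B_def by (rule \<Phi>.submodule_image[OF D0.submodule_carrier])
  have Tr: "transpose_mod A P1 f P0 = quot_mod (ring_dual A P1) B"
    by (simp add: transpose_mod_def B_def \<Phi>_def)
  show "left_module (op_ring A) (transpose_mod A P1 f P0)"
    unfolding Tr by (rule quotient_module.left_module_quot[OF quotient_moduleI[OF D.left_module_axioms Bsub]])
  show "finite_length (op_ring A) (transpose_mod A P1 f P0)"
    unfolding Tr by (rule D.comp_length_quot(2)[OF Bsub])
  let ?rk = "rank (op_ring A) (ring_dual A P1)"
  let ?r = "rank (op_ring A) (regular (op_ring A))"
  have rkTr: "?rk (carrier (ring_dual A P1)) = ?rk B + comp_length (op_ring A) (transpose_mod A P1 f P0)"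
    unfolding Tr by (rule D.comp_length_quot(1)[OF Bsub])
  have "carrier (ring_dual A P1) = c.box (\<lambda>i. \<epsilon> i <# carrier A)"
    using c.idem_dual c.dual_closed c1(1) mem_right_coset_idem[OF idem(2)]
    by (auto simp: c.box_def)
  then have rkV: "?rk (carrier (ring_dual A P1)) = (\<Sum>i\<in>K. ?r (\<epsilon> i <# carrier A))"
    using c.rank_box[of "\<lambda>i. \<epsilon> i <# carrier A"] right_ideal_right_coset(1)[OF \<epsilon>c(1)]
      mem_right_coset_idem[OF idem(2)] by simp
  define W where "W = c.box (\<lambda>i. \<epsilon> i <# (J \<cdot> J))"
  have Wsub: "submodule W (op_ring A) (ring_dual A P1)"
    unfolding W_def by (rule c.submodule_box[OF right_ideal_right_coset(2)[OF \<epsilon>c(1) ideal_op_JJ]])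
  have JJmem: "b \<in> \<epsilon> i <# (J \<cdot> J) \<longleftrightarrow> b \<in> J \<cdot> J \<and> \<epsilon> i \<otimes> b = b" if "i \<in> K" for i b
    by (rule mem_right_coset_idem_ideal[OF idem(2)[OF that] ideal_op_JJ])
  have rkW: "?rk W = (\<Sum>i\<in>K. ?r (\<epsilon> i <# (J \<cdot> J)))"
    unfolding W_def using right_ideal_right_coset(2)[OF \<epsilon>c(1) ideal_op_JJ] JJmem
    by (intro c.rank_box) simp_all
  \<comment> \<open>In coordinates \<open>\<Phi>\<close> multiplies the element \<open>h p0\<close>
    of \<open>e A\<close> from the left by the column of the \<open>y i\<close>. So an element of
    \<open>B\<close> is determined by the single value \<open>h p0\<close>.\<close>
  have \<Phi>p1: "\<Phi> h (p1 i) = y i \<otimes> h p0" if "h \<in> carrier (ring_dual A P0)" "i \<in> K" for h i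
    using module_HomD(4)[of h A P0 "regular A" "y i" p0] that c1(1,2) yJ(3) p0(1)
    by (simp add: \<Phi>_def compose_def)
  have hp0: "h p0 \<in> carrier A" "e \<otimes> h p0 = h p0" if "h \<in> carrier (ring_dual A P0)" for h
    using module_HomD(2)[of h A P0 "regular A" p0] module_HomD(4)[of h A P0 "regular A" e p0]
      that p0 ec by simp_all
  let ?BW = "B <+>\<^bsub>ring_dual A P1\<^esub> W"
  have BWsub: "submodule ?BW (op_ring A) (ring_dual A P1)" by (rule D.submodule_set_add[OF Bsub Wsub])
  \<comment> \<open>Shows \<open>(B + W) / W\<close> to be zero or simple. An \<open>N\<close>
    larger than \<open>W\<close> contains some \<open>b = \<Phi> h\<close> outside \<open>W\<close>,
    and such a \<open>b\<close> generates all of \<open>B\<close>.\<close>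
  have key: "N = W \<or> N = ?BW"
    if N: "submodule N (op_ring A) (ring_dual A P1)" "W \<subseteq> N" "N \<subseteq> ?BW" for N
  proof (rule disjCI)
    assume "N \<noteq> ?BW"
    show "N = W"
    proof (rule ccontr)
      assume "N \<noteq> W"
      then obtain n where n: "n \<in> N" "n \<notin> W" using N(2) by blast
      then obtain b w where bw: "b \<in> B" "w \<in> W" "n = b \<oplus>\<^bsub>ring_dual A P1\<^esub> w"
        using N(3) by (meson D.set_addE subsetD)
      have bc: "b \<in> carrier (ring_dual A P1)" by (rule D.submoduleD(2)[OF Bsub bw(1)])
      have bN: "b \<in> N" using D.submodule_add_cancel[OF N(1) bc] bw N(2) n(1) by blast
      have bW: "b \<notin> W" using D.submoduleD(4)[OF Wsub] bw n(2) by blast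
      obtain h where h: "h \<in> carrier (ring_dual A P0)" "b = \<Phi> h" using bw(1) by (auto simp: B_def)
      define c where "c = h p0"
      have cc: "c \<in> carrier A" "e \<otimes> c = c" using hp0[OF h(1)] by (simp_all add: c_def)
      \<comment> \<open>Otherwise all values \<open>y i c\<close> are in \<open>J^2\<close>, which
        puts \<open>b\<close> into \<open>W\<close>.\<close>
      have "c \<notin> J"
      proof
        assume cJ: "c \<in> J"
        have "b (p1 i) \<in> \<epsilon> i <# (J \<cdot> J)" if i: "i \<in> K" for i
        proof -
          have "y i \<otimes> c \<in> J \<cdot> J" by (rule ideal_prod.prod[OF yJ(1)[OF i] cJ])
          then show ?thesis
            using \<Phi>p1[OF h(1) i] c.idem_dual[OF bc i] JJmem[OF i] h(2) by (simp add: c_def)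
        qed
        then show False using bW bc by (simp add: W_def c.box_def)
      qed
      moreover have "c \<in> cyclic (op_ring A) (regular (op_ring A)) c"
        using op.reg.cyclic_self cc by simp
      moreover have "submodule (cyclic (op_ring A) (regular (op_ring A)) c) (op_ring A) (regular (op_ring A))"
        using op.reg.submodule_cyclic cc by simp
      moreover have "cyclic (op_ring A) (regular (op_ring A)) c \<subseteq> e <# carrier A"
        using cc ec by (auto simp: cyclic_def mem_right_coset_idem[OF idem(1)] m_assoc[symmetric])
      \<comment> \<open>A right submodule of \<open>e A\<close> not inside \<open>J\<close> is all
        of \<open>e A\<close>. So \<open>e = c d\<close>, and every value
        \<open>c' = c (d c')\<close> is reached from \<open>c\<close>.\<close>
      ultimately have "cyclic (op_ring A) (regular (op_ring A)) c = e <# carrier A"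
        using op.proper_submodule_le_J[of e "cyclic (op_ring A) (regular (op_ring A)) c"] e
        by (auto simp: r_coset_op_ring jacobson_radical_op)
      then have "e \<in> cyclic (op_ring A) (regular (op_ring A)) c"
        using ec mem_right_coset_idem[OF idem(1)] by simp
      then obtain d where d: "d \<in> carrier A" "e = c \<otimes> d" by (auto simp: cyclic_def)
      have "b' \<in> N" if b': "b' \<in> B" for b'
      proof -
        obtain h' where h': "h' \<in> carrier (ring_dual A P0)" "b' = \<Phi> h'" using b' by (auto simp: B_def)
        define c' where "c' = h' p0"
        have c': "c' \<in> carrier A" "e \<otimes> c' = c'" using hp0[OF h'(1)] by (simp_all add: c'_def)
        have b'c: "b' \<in> carrier (ring_dual A P1)" by (rule D.submoduleD(2)[OF Bsub b'])
        have act: "(d \<otimes> c') \<odot>\<^bsub>ring_dual A P1\<^esub> b \<in> N" using D.submoduleD(5)[OF N(1) _ bN] d c' by simp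
        have "b' = (d \<otimes> c') \<odot>\<^bsub>ring_dual A P1\<^esub> b"
        proof (rule c.dual_eqI[OF b'c D.submoduleD(2)[OF N(1) act]])
          fix i assume i: "i \<in> K"
          have "c' = c \<otimes> (d \<otimes> c')" using c' d cc by (simp add: m_assoc[symmetric])
          then have "y i \<otimes> c' = y i \<otimes> c \<otimes> (d \<otimes> c')"
            using yJ(3)[OF i] cc(1) d(1) c'(1) by (simp add: m_assoc)
          then show "b' (p1 i) = ((d \<otimes> c') \<odot>\<^bsub>ring_dual A P1\<^esub> b) (p1 i)"
            using \<Phi>p1[OF h(1) i] \<Phi>p1[OF h'(1) i] c1(1)[OF i] h(2) h'(2)
            by (simp add: c_def c'_def)
        qed
        then show ?thesis using act by simp
      qed
      then have "?BW \<subseteq> N" using N(2) by (intro D.set_add_least[OF N(1)]) auto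
      then show False using N(3) \<open>N \<noteq> ?BW\<close> by blast
    qed
  qed
  have WBW: "W \<subseteq> ?BW" by (rule D.set_add_upper(2)[OF Bsub Wsub])
  have "?rk ?BW \<le> ?rk W + 1"
  proof (cases "W = ?BW")
    case False
    then have "covers (op_ring A) (ring_dual A P1) W ?BW"
      using key WBW Wsub BWsub by (auto simp: covers_def)
    then show ?thesis using D.rank_covers by simp
  qed simp
  moreover have "?rk B \<le> ?rk ?BW"
    by (rule D.rank_mono[OF Bsub BWsub D.set_add_upper(1)[OF Bsub Wsub]])
  ultimately have "(\<Sum>i\<in>K. ?r (\<epsilon> i <# carrier A)) \<le>
      (\<Sum>i\<in>K. ?r (\<epsilon> i <# (J \<cdot> J))) + 1 + comp_length (op_ring A) (transpose_mod A P1 f P0)"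
    using rkTr rkV rkW by simp
  moreover have "(\<Sum>i\<in>K. ?r (\<epsilon> i <# carrier A)) = (\<Sum>i\<in>K. ?r (\<epsilon> i <# (J \<cdot> J))) +
      (\<Sum>i\<in>K. comp_length (op_ring A) (rquot A (\<epsilon> i <# J) (\<epsilon> i <# (J \<cdot> J)))) + card K"
    using rank_right_coset[OF prim] by (simp add: sum.distrib sum_Suc)
  ultimately show "int (card K) - 1 + (\<Sum>i\<in>K. int (comp_length (op_ring A) (rquot A (\<epsilon> i <# J) (\<epsilon> i <# (J \<cdot> J)))))
      \<le> int (comp_length (op_ring A) (transpose_mod A P1 f P0))"
    unfolding of_nat_sum[symmetric] by linarith
qed

end

section \<open>Duality\<close>

context artin_algebra
begin

text \<open>\<open>A\<close> has finite length over \<open>R\<close>, hence so has a finite power of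
  \<open>A\<close>, and \<open>M\<close> is a quotient of one.\<close>

lemma finite_length_restrict:
  assumes M: "left_module A M" and fl: "finite_length A M"
  shows "finite_length R (restrict_scalars \<phi> M)"
proof -
  interpret M: finite_length_module A M
    by (intro finite_length_moduleI M fl)
  note reg = left_module_regular[OF A.ring_axioms]
  obtain X where X: "finite X" "X \<subseteq> carrier M"
    "linear_map A (direct_sum X (\<lambda>_. regular A)) M (\<lambda>t. \<Oplus>\<^bsub>M\<^esub>x\<in>X. t x \<odot>\<^bsub>M\<^esub> x)"
    "(\<lambda>t. \<Oplus>\<^bsub>M\<^esub>x\<in>X. t x \<odot>\<^bsub>M\<^esub> x) ` carrier (direct_sum X (\<lambda>_. regular A)) = carrier M"
    by (rule fin_gen_span[OF M M.finite_length_fin_gen])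
  have eq: "restrict_scalars \<phi> (direct_sum X (\<lambda>_. regular A)) =
      direct_sum X (\<lambda>_. restrict_scalars \<phi> (regular A))"
    by (simp add: restrict_scalars_def direct_sum_def)
  have "finite_length R (direct_sum X (\<lambda>_. restrict_scalars \<phi> (regular A)))"
    by (rule finite_length_direct_sum[OF X(1) R.ring_axioms left_module_restrict[OF reg] finite_length_A])
  then show ?thesis
    using X(4) linear_map.finite_length_surj[OF linear_map_restrict[OF X(3)]] by (simp add: eq)
qed

text \<open>Evaluation at finitely many generators over \<open>R\<close> embeds the dual in a finite
  power of \<open>I\<close>, which has finite length.\<close>

lemma finite_length_D_dual:
  assumes N: "left_module A N" and fl: "finite_length A N" and I: "fg_module R I"
  shows "finite_length (op_ring A) (D_dual R \<phi> I N)"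
proof -
  have Imod: "left_module R I" and Ifg: "fin_gen R I" using I by (auto simp: fg_module_def)
  have Ifl: "finite_length R I" by (rule fin_gen_finite_length[OF Imod Ifg finite_length_R])
  let ?N = "restrict_scalars \<phi> N"
  interpret N: finite_length_module R ?N
    by (intro finite_length_moduleI left_module_restrict
        finite_length_restrict N fl)
  interpret op: artin_algebra R "op_ring A" \<phi> by (rule artin_algebra_op)
  note D = left_module_D_dual[OF N Imod]
  obtain X where X: "finite X" "X \<subseteq> carrier N"
    "\<And>K. submodule K R ?N \<Longrightarrow> X \<subseteq> K \<Longrightarrow> K = carrier N"
    using N.finite_length_fin_gen unfolding fin_gen_def by auto
  let ?D = "restrict_scalars \<phi> (D_dual R \<phi> I N)"
  let ?S = "direct_sum X (\<lambda>_. I)"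
  interpret S: left_module R ?S by (rule left_module_direct_sum[OF R.ring_axioms Imod])
  interpret Dr: left_module R ?D by (rule op.left_module_restrict[OF D])
  note HD = module_HomD[where M = ?N and A = R and N = I, simplified]
  have "linear_map R ?D ?S (\<lambda>h. \<lambda>x\<in>X. h x)"
    using X(2) HD
    by (intro linear_mapI Dr.left_module_axioms S.left_module_axioms)
      (auto intro!: restrict_ext)
  moreover have "inj_on (\<lambda>h. \<lambda>x\<in>X. h x) (carrier ?D)"
  proof (rule inj_onI)
    fix h k assume hk: "h \<in> carrier ?D" "k \<in> carrier ?D" "(\<lambda>x\<in>X. h x) = (\<lambda>x\<in>X. k x)"
    then have H: "h \<in> module_Hom R ?N I" "k \<in> module_Hom R ?N I" by simp_all
    interpret h: linear_map R ?N I h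
      by (rule linear_map_of_Hom[OF N.left_module_axioms Imod H(1)])
    interpret k: linear_map R ?N I k
      by (rule linear_map_of_Hom[OF N.left_module_axioms Imod H(2)])
    have eqX: "h x = k x" if "x \<in> X" for x using fun_cong[OF hk(3), of x] that by simp
    have "submodule {x \<in> carrier ?N. h x = k x} R ?N"
      by (rule N.submoduleI)
        (use h.add k.add h.smult k.smult h.zero k.zero N.M.zero_closed N.M.a_closed N.smult_closed in auto)
    from X(3)[OF this] have "{x \<in> carrier ?N. h x = k x} = carrier N" using X(2) eqX by auto
    then show "h = k" by (intro module_Hom_eqI[OF H]) auto
  qed
  ultimately have "finite_length R ?D"
    by (rule linear_map.finite_length_inj)
      (rule finite_length_direct_sum[OF X(1) R.ring_axioms Imod Ifl])
  then show ?thesis by (rule op.finite_length_of_restrict[OF D])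
qed

text \<open>A chain of submodules of \<open>N\<close> gives a chain of annihilators in the dual, in
  reverse order and still strict, so each cover in \<open>N\<close> costs at least one unit of rank
  in the dual.\<close>

theorem comp_length_D_dual_ge:
  assumes N: "left_module A N" and fl: "finite_length A N" and I: "cogenerator R I"
  shows "comp_length A N \<le> comp_length (op_ring A) (D_dual R \<phi> I N)"
proof -
  have Ifg: "fg_module R I" and Imod: "left_module R I"
    using I by (auto simp: cogenerator_def fg_module_def)
  interpret N: finite_length_module A N
    by (intro finite_length_moduleI N fl)
  let ?D = "D_dual R \<phi> I N"
  let ?N = "restrict_scalars \<phi> N"
  interpret D: finite_length_module "op_ring A" ?D
    by (intro finite_length_moduleI
        left_module_D_dual[OF N Imod] finite_length_D_dual[OF N fl Ifg])
  interpret r: finite_length_module R ?N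
    by (intro finite_length_moduleI left_module_restrict
        finite_length_restrict N fl)
  interpret I: left_module R I by (rule Imod)
  define perp where "perp Y = {h \<in> carrier ?D. \<forall>x\<in>Y. h x = \<zero>\<^bsub>I\<^esub>}" for Y
  note HD = module_HomD[where M = ?N and A = R and N = I, simplified]
  have perp: "submodule (perp Y) (op_ring A) ?D" if Y: "submodule Y A N" for Y
  proof (rule D.submoduleI)
    note YD = N.submoduleD[OF Y]
    show "perp Y \<subseteq> carrier ?D" by (auto simp: perp_def)
    show "\<zero>\<^bsub>?D\<^esub> \<in> perp Y" using D.M.zero_closed YD(2) by (auto simp: perp_def)
    show "h \<oplus>\<^bsub>?D\<^esub> k \<in> perp Y" if "h \<in> perp Y" "k \<in> perp Y" for h k
      using that D.M.a_closed[of h k] YD(2) by (auto simp: perp_def)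
    show "a \<odot>\<^bsub>?D\<^esub> h \<in> perp Y" if "a \<in> carrier (op_ring A)" "h \<in> perp Y" for a h
      using that D.smult_closed[of a h] YD(2,5) by (auto simp: perp_def)
  qed
  \<comment> \<open>For \<open>y\<close> in \<open>Y\<close> outside \<open>X\<close>, the
    cogenerator admits an \<open>R\<close>-linear map on \<open>N / X\<close> that is nonzero at the
    class of \<open>y\<close>. Composed with the projection it kills \<open>X\<close> but not
    \<open>Y\<close>.\<close>
  have strict: "perp Y \<subset> perp X" if XY: "submodule X A N" "submodule Y A N" "X \<subset> Y" for X Y
  proof -
    obtain y where y: "y \<in> Y" "y \<notin> X" using XY(3) by blast
    have yc: "y \<in> carrier ?N" using N.submoduleD(2)[OF XY(2) y(1)] by simp
    have Xr: "submodule X R ?N" by (rule submodule_restrict[OF N XY(1)])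
    interpret q: quotient_module R ?N X by (rule quotient_moduleI[OF r.left_module_axioms Xr])
    interpret Q: finite_length_module R "quot_mod ?N X"
      by (intro finite_length_moduleI q.left_module_quot
          r.comp_length_quot(2) Xr)
    have "q.coset y \<in> carrier (quot_mod ?N X)" "q.coset y \<noteq> \<zero>\<^bsub>quot_mod ?N X\<^esub>"
      using yc y(2) q.coset_eq_zero_iff[OF yc] by (simp_all only: q.carrier_quot q.zero_quot imageI not_False_eq_True)
    then obtain g where g: "linear_map R (quot_mod ?N X) I g" "g (q.coset y) \<noteq> \<zero>\<^bsub>I\<^esub>"
      using cogenerator_separates[OF I Q.fg_module] by blast
    interpret g: linear_map R "quot_mod ?N X" I g by (rule g(1))
    let ?h = "restrict (\<lambda>x. g (q.coset x)) (carrier ?N)"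
    have hH: "?h \<in> carrier ?D"
      using linear_map_in_Hom[OF linear_map_comp[OF q.linear_map_coset g(1)]] by simp
    have "?h x = \<zero>\<^bsub>I\<^esub>" if x: "x \<in> X" for x
    proof -
      have xc: "x \<in> carrier ?N" by (rule r.submoduleD(2)[OF Xr x])
      then have "q.coset x = \<zero>\<^bsub>quot_mod ?N X\<^esub>"
        using q.coset_eq_zero_iff[OF xc] x q.zero_quot by blast
      then show ?thesis using xc g.zero by simp
    qed
    then have "?h \<in> perp X" using hH unfolding perp_def by blast
    moreover have "?h \<notin> perp Y"
    proof
      assume "?h \<in> perp Y"
      then have "?h y = \<zero>\<^bsub>I\<^esub>" using y(1) unfolding perp_def by blast
      then show False using g(2) yc by simp
    qed
    moreover have "perp Y \<subseteq> perp X" using XY(3) unfolding perp_def by blast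
    ultimately show ?thesis by blast
  qed
  have "rank (op_ring A) ?D (perp Y) + rank A N Y \<le> rank (op_ring A) ?D (carrier ?D)"
    if "submodule Y A N" for Y
    using that
  proof (induct rule: N.submodule_induct)
    case zero
    show ?case
      using D.rank_mono[OF perp[OF N.submodule_zero] D.submodule_carrier] by (simp add: perp_def)
  next
    case (covers X Y)
    note c = coversD[OF covers(1)]
    have "rank (op_ring A) ?D (perp Y) < rank (op_ring A) ?D (perp X)"
      by (rule D.rank_strict_mono[OF perp[OF c(2)] perp[OF c(1)] strict[OF c(1-3)]])
    then show ?case using covers(2) N.rank_covers[OF covers(1)] by linarith
  qed
  from this[OF N.submodule_carrier] show ?thesis by (simp add: N.comp_length_eq D.comp_length_eq)
qed

end

section \<open>Socle of a minimal injective cogenerator\<close>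

context artinian_cring
begin

text \<open>
  If the \<open>m\<close>-socle of \<open>I\<close> contained independent \<open>x\<close> and \<open>y\<close>, a submodule \<open>C\<close> containing \<open>y\<close> and
  maximal with \<open>x \<notin> C\<close> would be a proper direct summand that is still a cogenerator.
\<close>

theorem socle_cyclic:
  assumes mic: "minimal_injective_cogenerator R I" and m: "max_ideal m"
    and x: "x \<in> carrier I" "x \<noteq> \<zero>\<^bsub>I\<^esub>" "\<And>r. r \<in> m \<Longrightarrow> r \<odot>\<^bsub>I\<^esub> x = \<zero>\<^bsub>I\<^esub>"
    and y: "y \<in> carrier I" "\<And>r. r \<in> m \<Longrightarrow> r \<odot>\<^bsub>I\<^esub> y = \<zero>\<^bsub>I\<^esub>"
  shows "\<exists>r\<in>carrier R. y = r \<odot>\<^bsub>I\<^esub> x"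
proof (rule ccontr)
  assume neg: "\<not> ?thesis"
  have inj: "injective R I" and cog: "cogenerator R I"
    and min: "\<And>N. submodule N R I \<Longrightarrow> injective R (I\<lparr>carrier := N\<rparr>) \<Longrightarrow>
      cogenerator R (I\<lparr>carrier := N\<rparr>) \<Longrightarrow> N = carrier I"
    using mic by (auto simp: minimal_injective_cogenerator_def)
  have fgI: "fg_module R I" using inj by (simp add: injective_def)
  have Imod: "left_module R I" and Ifg: "fin_gen R I" using fgI by (auto simp: fg_module_def)
  interpret I: finite_length_module R I
    by (intro finite_length_moduleI Imod
        fin_gen_finite_length[OF Imod Ifg finite_length_regular])
  note mD = max_idealD[OF m]
  \<comment> \<open>On elements killed by \<open>m\<close>, an \<open>r\<close> outside
    \<open>m\<close> acts invertibly, since \<open>s r\<close> is 1 modulo \<open>m\<close> for some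
    \<open>s\<close>. So \<open>z\<close> is regained from \<open>r z\<close>.\<close>
  have recover: "z \<in> N" if N: "submodule N R I" and r: "r \<in> carrier R" "r \<notin> m"
    and z: "z \<in> carrier I" "\<And>r. r \<in> m \<Longrightarrow> r \<odot>\<^bsub>I\<^esub> z = \<zero>\<^bsub>I\<^esub>" and rz: "r \<odot>\<^bsub>I\<^esub> z \<in> N" for N r z
  proof -
    obtain s where s: "s \<in> carrier R" "\<one> \<ominus> s \<otimes> r \<in> m" using max_ideal_inverse[OF m r] by blast
    have "(\<one> \<ominus> s \<otimes> r) \<odot>\<^bsub>I\<^esub> z = z \<ominus>\<^bsub>I\<^esub> s \<odot>\<^bsub>I\<^esub> (r \<odot>\<^bsub>I\<^esub> z)"
      using s(1) r(1) z(1) by (simp add: I.smult_minus_distr I.smult_assoc1)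
    then have "z = s \<odot>\<^bsub>I\<^esub> (r \<odot>\<^bsub>I\<^esub> z)"
      using z(2)[OF s(2)] I.minus_eq_zero_iff[of z "s \<odot>\<^bsub>I\<^esub> (r \<odot>\<^bsub>I\<^esub> z)"] s(1) r(1) z(1) by simp
    then show ?thesis using I.submoduleD(5)[OF N s(1) rz] by simp
  qed
  have xcyc: "x \<notin> cyclic R I y"
  proof
    assume "x \<in> cyclic R I y"
    then obtain r where r: "r \<in> carrier R" "x = r \<odot>\<^bsub>I\<^esub> y" by (auto simp: cyclic_def)
    have "r \<notin> m" using y(2) x(2) r(2) by auto
    from recover[OF I.submodule_cyclic[OF x(1)] r(1) this y] r I.cyclic_self[OF x(1)]
    have "y \<in> cyclic R I x" by simp
    then show False using neg by (auto simp: cyclic_def)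
  qed
  obtain C where C: "submodule C R I" "cyclic R I y \<subseteq> C" "x \<notin> C"
    "\<And>K. submodule K R I \<Longrightarrow> C \<subset> K \<Longrightarrow> x \<in> K"
    using I.maximal_avoiding[OF I.submodule_cyclic[OF y(1)] xcyc] by blast
  have yC: "y \<in> C" using C(2) I.cyclic_self[OF y(1)] by blast
  note CD = I.submoduleD[OF C(1)]
  \<comment> \<open>A partner for \<open>C\<close>: of greatest rank among the submodules that
    contain \<open>x\<close> and meet \<open>C\<close> in zero. It will be the kernel side of a
    projection onto \<open>C\<close>.\<close>
  let ?P = "\<lambda>K. submodule K R I \<and> cyclic R I x \<subseteq> K \<and> K \<inter> C = {\<zero>\<^bsub>I\<^esub>}"
  have P0: "?P (cyclic R I x)"
  proof -
    have "z = \<zero>\<^bsub>I\<^esub>" if "z \<in> cyclic R I x" "z \<in> C" for z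
    proof -
      obtain r where r: "r \<in> carrier R" "z = r \<odot>\<^bsub>I\<^esub> x" using \<open>z \<in> cyclic R I x\<close> by (auto simp: cyclic_def)
      show ?thesis using recover[OF C(1) r(1) _ x(1,3)] x(3) C(3) r(2) that(2) by blast
    qed
    then show ?thesis using I.submodule_cyclic[OF x(1)] I.submoduleD(3) CD(3) by blast
  qed
  have "\<exists>K. ?P K \<and> (\<forall>K'. ?P K' \<longrightarrow> rank R I K' \<le> rank R I K)"
  proof (rule ex_has_greatest_nat[of ?P, OF P0])
    show "\<forall>K'. ?P K' \<longrightarrow> rank R I K' < Suc (rank R I (carrier I))"
      using I.rank_mono[OF _ I.submodule_carrier I.submoduleD(1)] by (meson le_imp_less_Suc)
  qed
  then obtain K where K: "submodule K R I" "cyclic R I x \<subseteq> K" "K \<inter> C = {\<zero>\<^bsub>I\<^esub>}"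
    and Kmax: "\<And>K'. ?P K' \<Longrightarrow> rank R I K' \<le> rank R I K" by blast
  have xK: "x \<in> K" using K(2) I.cyclic_self[OF x(1)] by blast
  note KD = I.submoduleD[OF K(1)]
  have Kgrow: "\<exists>c\<in>K' \<inter> C. c \<noteq> \<zero>\<^bsub>I\<^esub>" if "submodule K' R I" "K \<subset> K'" for K'
  proof (rule ccontr)
    assume "\<not> ?thesis"
    then have "K' \<inter> C = {\<zero>\<^bsub>I\<^esub>}" using I.submoduleD(3)[OF that(1)] CD(3) by blast
    then have "rank R I K' \<le> rank R I K" using that K(2) by (intro Kmax) auto
    then show False using I.rank_strict_mono[OF K(1) that] by simp
  qed
  let ?U = "K <+>\<^bsub>I\<^esub> C"
  have U: "submodule ?U R I" by (rule I.submodule_set_add[OF K(1) C(1)])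
  \<comment> \<open>The projection of \<open>K + C\<close> onto \<open>C\<close> along
    \<open>K\<close>. Injectivity of \<open>I\<close> extends it to an endomorphism \<open>g\<close>
    of \<open>I\<close>.\<close>
  define g0 where "g0 u = (THE c. c \<in> C \<and> u \<ominus>\<^bsub>I\<^esub> c \<in> K)" for u
  have uniq: "c = c'" if c: "c \<in> C" "c' \<in> C" "u \<ominus>\<^bsub>I\<^esub> c \<in> K" "u \<ominus>\<^bsub>I\<^esub> c' \<in> K" and u: "u \<in> carrier I" for c c' u
  proof -
    have cc: "c \<in> carrier I" "c' \<in> carrier I" using CD(2) c by blast+
    have "(u \<ominus>\<^bsub>I\<^esub> c') \<ominus>\<^bsub>I\<^esub> (u \<ominus>\<^bsub>I\<^esub> c) \<in> K" by (rule I.submodule_minus[OF K(1) c(4,3)])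
    moreover have "(u \<ominus>\<^bsub>I\<^esub> c') \<ominus>\<^bsub>I\<^esub> (u \<ominus>\<^bsub>I\<^esub> c) = c \<ominus>\<^bsub>I\<^esub> c'"
      using cc u I.M.a_lcomm[of u "\<ominus>\<^bsub>I\<^esub> c'" "\<ominus>\<^bsub>I\<^esub> u"]
      by (simp add: I.M.minus_eq I.M.minus_add I.M.a_ac I.M.r_neg2 I.M.r_neg1 I.M.r_neg)
    ultimately have "c \<ominus>\<^bsub>I\<^esub> c' \<in> K \<inter> C" using I.submodule_minus[OF C(1) c(1,2)] by simp
    then show ?thesis using K(3) cc by (simp add: I.minus_eq_zero_iff)
  qed
  have g0: "g0 (k \<oplus>\<^bsub>I\<^esub> c) = c" if "k \<in> K" "c \<in> C" for k c
  proof -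
    have kc: "k \<in> carrier I" "c \<in> carrier I" using KD(2) CD(2) that by blast+
    have "(k \<oplus>\<^bsub>I\<^esub> c) \<ominus>\<^bsub>I\<^esub> c = k" using kc by simp
    then show ?thesis
      unfolding g0_def using that kc uniq[of _ c "k \<oplus>\<^bsub>I\<^esub> c"] by (intro the_equality) auto
  qed
  have "linear_map R (I\<lparr>carrier := ?U\<rparr>) I g0"
  proof (intro linear_mapI I.left_module_sub U Imod)
    fix u assume "u \<in> carrier (I\<lparr>carrier := ?U\<rparr>)"
    then obtain k c where u: "k \<in> K" "c \<in> C" "u = k \<oplus>\<^bsub>I\<^esub> c" by (auto elim: I.set_addE)
    then have kc: "k \<in> carrier I" "c \<in> carrier I" using KD(2) CD(2) by blast+
    show "g0 u \<in> carrier I" using g0 u kc by simp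
    show "g0 (u \<oplus>\<^bsub>I\<lparr>carrier := ?U\<rparr>\<^esub> v) = g0 u \<oplus>\<^bsub>I\<^esub> g0 v" if vU: "v \<in> carrier (I\<lparr>carrier := ?U\<rparr>)" for v
    proof -
      obtain k' c' where v: "k' \<in> K" "c' \<in> C" "v = k' \<oplus>\<^bsub>I\<^esub> c'" using vU by (auto elim: I.set_addE)
      then have kc': "k' \<in> carrier I" "c' \<in> carrier I" using KD(2) CD(2) by blast+
      have "u \<oplus>\<^bsub>I\<^esub> v = (k \<oplus>\<^bsub>I\<^esub> k') \<oplus>\<^bsub>I\<^esub> (c \<oplus>\<^bsub>I\<^esub> c')" using u v kc kc' by (simp add: I.M.a_ac)
      then show ?thesis using g0[OF KD(4)[OF u(1) v(1)] CD(4)[OF u(2) v(2)]] g0 u v by simp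
    qed
    show "g0 (a \<odot>\<^bsub>I\<lparr>carrier := ?U\<rparr>\<^esub> u) = a \<odot>\<^bsub>I\<^esub> g0 u" if a: "a \<in> carrier R" for a
    proof -
      have "a \<odot>\<^bsub>I\<^esub> u = a \<odot>\<^bsub>I\<^esub> k \<oplus>\<^bsub>I\<^esub> a \<odot>\<^bsub>I\<^esub> c" using u kc a by (simp add: I.smult_r_distr)
      then show ?thesis using g0[OF KD(5)[OF a u(1)] CD(5)[OF a u(2)]] g0 u by simp
    qed
  qed
  moreover have "linear_map R (I\<lparr>carrier := ?U\<rparr>) I (\<lambda>u. u)"
    by (rule linear_map.restrict_dom[OF linear_map_id[OF Imod] U])
  moreover have "fg_module R (I\<lparr>carrier := ?U\<rparr>)"
    by (rule finite_length_module.fg_module[OF I.finite_length_module_sub[OF U]])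
  ultimately obtain g where g: "linear_map R I I g" "\<And>u. u \<in> ?U \<Longrightarrow> g u = g0 u"
    using injective_extend[OF inj _ fgI, of "I\<lparr>carrier := ?U\<rparr>" "\<lambda>u. u" g0] by auto
  interpret g: linear_map R I I g by (rule g(1))
  have gC: "g c = c" if c: "c \<in> C" for c
    using g(2)[OF I.set_addI[OF KD(3) c]] g0[OF KD(3) c] CD(2)[OF c] by simp
  have gK: "g k = \<zero>\<^bsub>I\<^esub>" if k: "k \<in> K" for k
    using g(2)[OF I.set_addI[OF k CD(3)]] g0[OF k CD(3)] KD(2)[OF k] by simp
  \<comment> \<open>If \<open>x = g w\<close>, then \<open>w\<close> is not in \<open>K\<close>, so
    \<open>K + R w\<close> meets \<open>C\<close> in some nonzero \<open>c\<close>. Applying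
    \<open>g\<close> gives \<open>c = r x\<close>, and regaining \<open>x\<close> from it
    contradicts \<open>x \<notin> C\<close>.\<close>
  have xg: "x \<notin> g ` carrier I"
  proof
    assume "x \<in> g ` carrier I"
    then obtain w where w: "w \<in> carrier I" "x = g w" by blast
    have "w \<notin> K" using gK w x(2) by auto
    note W = I.submodule_cyclic[OF w(1)]
    have "K \<subset> K <+>\<^bsub>I\<^esub> cyclic R I w"
      using I.set_add_upper[OF K(1) W] I.cyclic_self[OF w(1)] \<open>w \<notin> K\<close> by blast
    from Kgrow[OF I.submodule_set_add[OF K(1) W] this]
    obtain c where c: "c \<in> K <+>\<^bsub>I\<^esub> cyclic R I w" "c \<in> C" "c \<noteq> \<zero>\<^bsub>I\<^esub>" by blast
    then obtain k r where kr: "k \<in> K" "r \<in> carrier R" "c = k \<oplus>\<^bsub>I\<^esub> r \<odot>\<^bsub>I\<^esub> w"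
      by (auto simp: cyclic_def elim!: I.set_addE)
    have "g c = r \<odot>\<^bsub>I\<^esub> x" using kr gK[OF kr(1)] KD(2)[OF kr(1)] w x(1) by simp
    then have rx: "c = r \<odot>\<^bsub>I\<^esub> x" using gC[OF c(2)] by simp
    then have "r \<notin> m" using x(3) c(3) by auto
    from recover[OF C(1) kr(2) this x(1,3)] rx c(2) C(3) show False by simp
  qed
  \<comment> \<open>The image of \<open>g\<close> contains \<open>C\<close> and avoids
    \<open>x\<close>, so maximality of \<open>C\<close> gives equality. Thus \<open>C\<close> is a
    retract of \<open>I\<close> and inherits injectivity.\<close>
  have gI: "g ` carrier I = C"
  proof -
    have "C \<subseteq> g ` carrier I"
    proof
      fix c assume c: "c \<in> C"
      have "c = g c" using gC[OF c] by simp
      then show "c \<in> g ` carrier I" using CD(2)[OF c] by (rule image_eqI)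
    qed
    then show ?thesis using C(4)[OF g.submodule_image[OF I.submodule_carrier]] xg by blast
  qed
  have gCcl: "g z \<in> C" if "z \<in> carrier I" for z using gI that by blast
  have fgC: "fg_module R (I\<lparr>carrier := C\<rparr>)"
    by (rule finite_length_module.fg_module[OF I.finite_length_module_sub[OF C(1)]])
  have gcod: "linear_map R I (I\<lparr>carrier := C\<rparr>) g"
    by (rule g.restrict_cod[OF C(1)]) (use gI in simp)
  have incl: "linear_map R (I\<lparr>carrier := C\<rparr>) I (\<lambda>z. z)"
    by (rule linear_map.restrict_dom[OF linear_map_id[OF Imod] C(1)])
  have "injective R (I\<lparr>carrier := C\<rparr>)"
    unfolding injective_def
  proof (intro conjI fgC allI impI, elim conjE)
    fix X Y :: "'a test_module" and g' h
    assume *: "fg_module R X" "fg_module R Y" "g' \<in> module_Hom R X Y" "inj_on g' (carrier X)"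
      "h \<in> module_Hom R X (I\<lparr>carrier := C\<rparr>)"
    have XY: "left_module R X" "left_module R Y" using *(1,2) by (auto simp: fg_module_def)
    have hl: "linear_map R X (I\<lparr>carrier := C\<rparr>) h"
      by (rule linear_map_of_Hom[OF XY(1) I.left_module_sub[OF C(1)] *(5)])
    obtain k where k: "linear_map R Y I k" "\<And>x. x \<in> carrier X \<Longrightarrow> k (g' x) = h x"
      using injective_extend[OF inj *(1,2) linear_map_of_Hom[OF XY *(3)] *(4) linear_map_comp[OF hl incl]]
      by blast
    show "\<exists>k\<in>module_Hom R Y (I\<lparr>carrier := C\<rparr>). \<forall>x\<in>carrier X. k (g' x) = h x"
    proof (rule bexI[OF _ linear_map_in_Hom[OF linear_map_comp[OF k(1) gcod]]], intro ballI)
      fix x assume x: "x \<in> carrier X"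
      have "h x \<in> C" using linear_map.closed[OF hl x] by simp
      then show "restrict (\<lambda>x. g (k x)) (carrier Y) (g' x) = h x"
        using k(2)[OF x] gC linear_map.closed[OF linear_map_of_Hom[OF XY *(3)] x] by simp
    qed
  qed
  moreover have "cogenerator R (I\<lparr>carrier := C\<rparr>)"
    unfolding cogenerator_def
  proof (intro conjI fgC allI impI ballI)
    fix X :: "'a test_module" and u
    assume X: "fg_module R X" and u: "u \<in> carrier X" "u \<noteq> \<zero>\<^bsub>X\<^esub>"
    have Xmod: "left_module R X" and Xfg: "fin_gen R X" using X by (auto simp: fg_module_def)
    interpret X: finite_length_module R X
      by (intro finite_length_moduleI Xmod
          fin_gen_finite_length[OF Xmod Xfg finite_length_regular])
    let ?ann = "{a \<in> carrier R. a \<odot>\<^bsub>X\<^esub> u \<in> {\<zero>\<^bsub>X\<^esub>}}"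
    have "submodule ?ann R (regular R)" by (rule X.quotient_ideal[OF X.submodule_zero u(1)])
    moreover have "?ann \<noteq> carrier R"
    proof
      assume "?ann = carrier R"
      then have "\<one> \<in> ?ann" by simp
      then show False using u by simp
    qed
    ultimately obtain n where n: "max_ideal n" "?ann \<subseteq> n" using max_ideal_above by blast
    note nD = max_idealD[OF n(1)]
    have nc: "r \<in> carrier R" if "r \<in> n" for r using reg.submoduleD(2)[OF nD(2) that] by simp
    \<comment> \<open>\<open>C\<close> still has a nonzero element killed by any given maximal ideal
      \<open>n\<close>. For \<open>n = m\<close> this is the purpose of \<open>y\<close>; for the
      others, the element that \<open>I\<close> provides is shown to lie in
      \<open>C\<close>.\<close>
    obtain c where c: "c \<in> C" "c \<noteq> \<zero>\<^bsub>I\<^esub>" "\<And>r. r \<in> n \<Longrightarrow> r \<odot>\<^bsub>I\<^esub> c = \<zero>\<^bsub>I\<^esub>"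
    proof (cases "n = m")
      case True
      have "y \<noteq> \<zero>\<^bsub>I\<^esub>" using neg I.smult_l_null[OF x(1)] zero_closed by metis
      then show ?thesis using that[of y] yC y(2) True by blast
    next
      case False
      interpret q: quotient_module R "regular R" n
        by (rule quotient_moduleI[OF reg.left_module_axioms nD(2)])
      interpret rg: finite_length_module R "regular R"
        by (intro finite_length_moduleI
            reg.left_module_axioms finite_length_regular)
      interpret Q: finite_length_module R "quot_mod (regular R) n"
        by (intro finite_length_moduleI q.left_module_quot
            rg.comp_length_quot(2) nD(2))
      have one: "\<one> \<in> carrier (regular R)" by simp
      have "q.coset \<one> \<in> carrier (quot_mod (regular R) n)" "q.coset \<one> \<noteq> \<zero>\<^bsub>quot_mod (regular R) n\<^esub>"
        using one nD(3) q.coset_eq_zero_iff[OF one] by (simp_all only: q.carrier_quot q.zero_quot imageI not_False_eq_True)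
      then obtain h where h: "linear_map R (quot_mod (regular R) n) I h" "h (q.coset \<one>) \<noteq> \<zero>\<^bsub>I\<^esub>"
        using cogenerator_separates[OF cog Q.fg_module] by blast
      interpret h: linear_map R "regular R" I "\<lambda>r. h (q.coset r)"
        by (rule linear_map_comp[OF q.linear_map_coset h(1)])
      define z where "z = h (q.coset \<one>)"
      have zc: "z \<in> carrier I" using h.closed[OF one] by (simp add: z_def)
      have rz: "r \<odot>\<^bsub>I\<^esub> z = \<zero>\<^bsub>I\<^esub>" if r: "r \<in> n" for r
      proof -
        have rc: "r \<in> carrier (regular R)" using nc[OF r] by simp
        have "r \<odot>\<^bsub>I\<^esub> z = h (q.coset (r \<odot>\<^bsub>regular R\<^esub> \<one>))"
          using h.smult[OF nc[OF r] one] by (simp add: z_def)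
        also have "r \<odot>\<^bsub>regular R\<^esub> \<one> = r" using nc[OF r] by simp
        also have "q.coset r = \<zero>\<^bsub>quot_mod (regular R) n\<^esub>"
          using q.coset_eq_zero_iff[OF rc] r q.zero_quot by blast
        also have "h (\<zero>\<^bsub>quot_mod (regular R) n\<^esub>) = \<zero>\<^bsub>I\<^esub>" by (rule linear_map.zero[OF h(1)])
        finally show ?thesis .
      qed
      have "z \<in> C"
      proof (rule ccontr)
        assume zC: "z \<notin> C"
        note Z = I.submodule_cyclic[OF zc]
        have "C \<subset> C <+>\<^bsub>I\<^esub> cyclic R I z"
          using I.set_add_upper[OF C(1) Z] I.cyclic_self[OF zc] zC by blast
        then have "x \<in> C <+>\<^bsub>I\<^esub> cyclic R I z" by (rule C(4)[OF I.submodule_set_add[OF C(1) Z]])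
        then obtain c r where cr: "c \<in> C" "r \<in> carrier R" "x = c \<oplus>\<^bsub>I\<^esub> r \<odot>\<^bsub>I\<^esub> z"
          by (auto simp: cyclic_def elim!: I.set_addE)
        have "\<not> n \<subseteq> m"
        proof
          assume "n \<subseteq> m"
          then have "m = carrier R" using nD(4)[OF mD(2)] False by blast
          then show False using mD(3) by simp
        qed
        \<comment> \<open>\<open>v\<close> kills \<open>z\<close> but acts invertibly on
          \<open>x\<close>; so \<open>v x = v c\<close> is in \<open>C\<close>, and with it
          \<open>x\<close>.\<close>
        then obtain v where v: "v \<in> n" "v \<notin> m" by blast
        have vc: "v \<in> carrier R" by (rule nc[OF v(1)])
        have "v \<odot>\<^bsub>I\<^esub> (r \<odot>\<^bsub>I\<^esub> z) = r \<odot>\<^bsub>I\<^esub> (v \<odot>\<^bsub>I\<^esub> z)"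
          using vc cr(2) zc by (simp add: I.smult_assoc1[symmetric] m_comm)
        then have "v \<odot>\<^bsub>I\<^esub> x = v \<odot>\<^bsub>I\<^esub> c"
          using cr vc zc CD(2)[OF cr(1)] rz[OF v(1)] by (simp add: I.smult_r_distr)
        then have "v \<odot>\<^bsub>I\<^esub> x \<in> C" using CD(5)[OF vc cr(1)] by simp
        from recover[OF C(1) vc v(2) x(1,3) this] C(3) show False by simp
      qed
      then show ?thesis using that[of z] rz h(2) by (simp add: z_def)
    qed
    have cc: "c \<in> carrier I" by (rule CD(2)[OF c(1)])
    have wd: "a \<odot>\<^bsub>I\<^esub> c = b \<odot>\<^bsub>I\<^esub> c" if ab: "a \<in> carrier R" "b \<in> carrier R" "a \<odot>\<^bsub>X\<^esub> u = b \<odot>\<^bsub>X\<^esub> u" for a b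
    proof -
      have "(a \<ominus> b) \<odot>\<^bsub>X\<^esub> u = \<zero>\<^bsub>X\<^esub>" using ab u(1) by (simp add: X.smult_minus_distr X.minus_eq_zero_iff)
      then have "a \<ominus> b \<in> n" using n(2) ab by auto
      from c(3)[OF this] show ?thesis using ab cc by (simp add: I.smult_minus_distr I.minus_eq_zero_iff)
    qed
    \<comment> \<open>The map \<open>a u \<mapsto> a c\<close> on the cyclic submodule of
      \<open>u\<close>, well defined since the annihilator of \<open>u\<close> lies in
      \<open>n\<close>, which kills \<open>c\<close>. Extended to \<open>X\<close> and followed by
      \<open>g\<close>, it takes values in \<open>C\<close> and is nonzero at
      \<open>u\<close>.\<close>
    define h0 where "h0 v = (SOME a. a \<in> carrier R \<and> a \<odot>\<^bsub>X\<^esub> u = v) \<odot>\<^bsub>I\<^esub> c" for v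
    have h0: "h0 (a \<odot>\<^bsub>X\<^esub> u) = a \<odot>\<^bsub>I\<^esub> c" if a: "a \<in> carrier R" for a
    proof -
      have "\<exists>b. b \<in> carrier R \<and> b \<odot>\<^bsub>X\<^esub> u = a \<odot>\<^bsub>X\<^esub> u" using a by blast
      from someI_ex[OF this] show ?thesis unfolding h0_def using wd a by blast
    qed
    have V: "submodule (cyclic R X u) R X" by (rule X.submodule_cyclic[OF u(1)])
    have "linear_map R (X\<lparr>carrier := cyclic R X u\<rparr>) I h0"
    proof (intro linear_mapI X.left_module_sub V Imod)
      fix v assume "v \<in> carrier (X\<lparr>carrier := cyclic R X u\<rparr>)"
      then obtain a where a: "a \<in> carrier R" "v = a \<odot>\<^bsub>X\<^esub> u" by (auto simp: cyclic_def)
      show "h0 v \<in> carrier I" using a h0 cc by simp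
      show "h0 (v \<oplus>\<^bsub>X\<lparr>carrier := cyclic R X u\<rparr>\<^esub> w) = h0 v \<oplus>\<^bsub>I\<^esub> h0 w"
        if wU: "w \<in> carrier (X\<lparr>carrier := cyclic R X u\<rparr>)" for w
      proof -
        obtain b where b: "b \<in> carrier R" "w = b \<odot>\<^bsub>X\<^esub> u" using wU by (auto simp: cyclic_def)
        have "v \<oplus>\<^bsub>X\<^esub> w = (a \<oplus> b) \<odot>\<^bsub>X\<^esub> u" using a b u(1) by (simp add: X.smult_l_distr)
        then show ?thesis using h0[of "a \<oplus> b"] h0 a b cc by (simp add: I.smult_l_distr)
      qed
      show "h0 (b \<odot>\<^bsub>X\<lparr>carrier := cyclic R X u\<rparr>\<^esub> v) = b \<odot>\<^bsub>I\<^esub> h0 v" if b: "b \<in> carrier R" for b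
      proof -
        have "b \<odot>\<^bsub>X\<^esub> v = (b \<otimes> a) \<odot>\<^bsub>X\<^esub> u" using a b u(1) by (simp add: X.smult_assoc1)
        then show ?thesis using h0[of "b \<otimes> a"] h0 a b cc by (simp add: I.smult_assoc1)
      qed
    qed
    moreover have "linear_map R (X\<lparr>carrier := cyclic R X u\<rparr>) X (\<lambda>v. v)"
      by (rule linear_map.restrict_dom[OF linear_map_id[OF Xmod] V])
    moreover have "fg_module R (X\<lparr>carrier := cyclic R X u\<rparr>)"
      by (rule finite_length_module.fg_module[OF X.finite_length_module_sub[OF V]])
    ultimately obtain k where k: "linear_map R X I k" "\<And>v. v \<in> cyclic R X u \<Longrightarrow> k v = h0 v"
      using injective_extend[OF inj _ X, of "X\<lparr>carrier := cyclic R X u\<rparr>" "\<lambda>v. v" h0] by auto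
    have "k u = c"
      using k(2)[OF X.cyclic_self[OF u(1)]] h0[OF one_closed] u(1) cc by simp
    then have "g (k u) \<noteq> \<zero>\<^bsub>I\<^esub>" using gC c by simp
    then show "\<exists>h\<in>module_Hom R X (I\<lparr>carrier := C\<rparr>). h u \<noteq> \<zero>\<^bsub>I\<lparr>carrier := C\<rparr>\<^esub>"
      using linear_map_in_Hom[OF linear_map_comp[OF k(1) gcod]] u(1)
      by (intro bexI[of _ "restrict (\<lambda>x. g (k x)) (carrier X)"]) simp_all
  qed
  ultimately have "C = carrier I" by (rule min[OF C(1)])
  then show False using C(3) x(1) by simp
qed

end

text \<open>The elements of \<open>A e\<close> that carry \<open>s\<close> into \<open>A w\<close>
  form a submodule not contained in \<open>J\<close>, hence all of \<open>A e\<close>; so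
  \<open>s = e s\<close> lies in \<open>A w\<close>. This is simplicity of \<open>S\<close> in the
  form used for its dual.\<close>

lemma (in finite_length_ring) cyclic_top_generated:
  assumes e: "primitive_idempotent A e" and S: "left_module A S" and s: "s \<in> carrier S" "e \<odot>\<^bsub>S\<^esub> s = s"
    and gen: "\<And>x. x \<in> carrier S \<Longrightarrow> \<exists>a\<in>carrier A. x = a \<odot>\<^bsub>S\<^esub> s"
    and ann: "\<And>a. a \<in> carrier A #> e \<Longrightarrow> a \<odot>\<^bsub>S\<^esub> s = \<zero>\<^bsub>S\<^esub> \<longleftrightarrow> a \<in> J"
    and w: "w \<in> carrier S" "w \<noteq> \<zero>\<^bsub>S\<^esub>"
  shows "\<exists>a\<in>carrier A. a \<odot>\<^bsub>S\<^esub> w = s"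
proof -
  interpret S: left_module A S by (rule S)
  have idem: "idempotent_elt A e" using e by (simp add: primitive_idempotent_def)
  have ec: "e \<in> carrier A" "e \<otimes> e = e" using idem by (auto simp: idempotent_elt_def)
  define N where "N = (carrier A #> e) \<inter> {a \<in> carrier A. a \<odot>\<^bsub>S\<^esub> s \<in> cyclic A S w}"
  have N: "submodule N A (regular A)"
    unfolding N_def
    using submodule_left_coset[OF ec(1) reg.submodule_carrier] S.quotient_ideal[OF S.submodule_cyclic[OF w(1)] s(1)]
    by (intro reg.submodule_Int) simp_all
  obtain b where b: "b \<in> carrier A" "w = b \<odot>\<^bsub>S\<^esub> s" using gen[OF w(1)] by blast
  have be: "b \<otimes> e \<in> carrier A #> e" "(b \<otimes> e) \<odot>\<^bsub>S\<^esub> s = w"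
    using b s ec by (auto simp: r_coset_def S.smult_assoc1)
  then have "b \<otimes> e \<in> N" using S.cyclic_self[OF w(1)] b ec by (simp add: N_def)
  moreover have "b \<otimes> e \<notin> J" using ann[OF be(1)] be(2) w(2) by simp
  ultimately have "N = carrier A #> e"
    using proper_submodule_le_J[OF e N] by (auto simp: N_def)
  then have "e \<in> N" using ec mem_left_coset_idem[OF idem] by simp
  then show ?thesis using s(2) by (auto simp: N_def cyclic_def)
qed

section \<open>The dual of a simple module\<close>

context artin_algebra
begin

interpretation A: finite_length_ring A
  by (rule finite_length_ring)

interpretation R: artinian_cring R
  by unfold_locales (rule artinian)

text \<open>Take a maximal \<open>R\<close>-submodule \<open>L\<close> and \<open>x\<close> outside
  it, and let \<open>m\<close> consist of the scalars that carry \<open>x\<close> into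
  \<open>L\<close>. Then \<open>m\<close> sends all of \<open>S\<close> into \<open>L\<close>; as
  scalars are central, a nonzero \<open>r z\<close> with \<open>r\<close> in \<open>m\<close> would
  put everything it generates, that is \<open>S\<close>, into \<open>L\<close>.\<close>

lemma annihilated_by_max_ideal:
  assumes S: "left_module A S" and fl: "finite_length A S" and s: "s \<in> carrier S" "s \<noteq> \<zero>\<^bsub>S\<^esub>"
    and simple: "\<And>w x. w \<in> carrier S \<Longrightarrow> w \<noteq> \<zero>\<^bsub>S\<^esub> \<Longrightarrow> x \<in> carrier S \<Longrightarrow> \<exists>a\<in>carrier A. x = a \<odot>\<^bsub>S\<^esub> w"
  shows "\<exists>m. R.max_ideal m \<and> (\<forall>r\<in>m. \<forall>x\<in>carrier S. \<phi> r \<odot>\<^bsub>S\<^esub> x = \<zero>\<^bsub>S\<^esub>)"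
proof -
  interpret S: left_module A S by (rule S)
  let ?S = "restrict_scalars \<phi> S"
  interpret r: finite_length_module R ?S
    by (intro finite_length_moduleI left_module_restrict
        finite_length_restrict S fl)
  have "{\<zero>\<^bsub>?S\<^esub>} \<noteq> carrier ?S" using s by auto
  then obtain L where L: "maximal_submodule R ?S L"
    using r.maximal_above[OF r.submodule_zero] by blast
  have sL: "submodule L R ?S" and neL: "L \<noteq> carrier ?S"
    and maxL: "\<And>N. submodule N R ?S \<Longrightarrow> L \<subseteq> N \<Longrightarrow> N = L \<or> N = carrier ?S"
    using L by (auto simp: maximal_submodule_def)
  obtain x where x: "x \<in> carrier ?S" "x \<notin> L" using neL r.submoduleD(1)[OF sL] by blast
  define m where "m = {a \<in> carrier R. a \<odot>\<^bsub>?S\<^esub> x \<in> L}"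
  have m: "R.max_ideal m"
    unfolding m_def by (rule maximal_submodule_quotient_ideal[OF r.left_module_axioms L x])
  have C: "submodule (cyclic R ?S x) R ?S" by (rule r.submodule_cyclic[OF x(1)])
  have top: "L <+>\<^bsub>?S\<^esub> cyclic R ?S x = carrier ?S"
    using maxL[OF r.submodule_set_add[OF sL C] r.set_add_upper(1)[OF sL C]]
      r.set_add_upper(2)[OF sL C] r.cyclic_self[OF x(1)] x(2) by blast
  have mL: "\<phi> r \<odot>\<^bsub>S\<^esub> z \<in> L" if r: "r \<in> m" and z: "z \<in> carrier S" for r z
  proof -
    have rc: "r \<in> carrier R" "r \<odot>\<^bsub>?S\<^esub> x \<in> L" using r by (auto simp: m_def)
    have "z \<in> L <+>\<^bsub>?S\<^esub> cyclic R ?S x" using z top by simp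
    then obtain l a where la: "l \<in> L" "a \<in> carrier R" "z = l \<oplus>\<^bsub>?S\<^esub> a \<odot>\<^bsub>?S\<^esub> x"
      by (auto simp: cyclic_def elim!: r.set_addE)
    have lc: "l \<in> carrier ?S" by (rule r.submoduleD(2)[OF sL la(1)])
    have "r \<odot>\<^bsub>?S\<^esub> (a \<odot>\<^bsub>?S\<^esub> x) = a \<odot>\<^bsub>?S\<^esub> (r \<odot>\<^bsub>?S\<^esub> x)"
      using r.smult_assoc1[OF rc(1) la(2) x(1)] r.smult_assoc1[OF la(2) rc(1) x(1)]
        R.m_comm[OF rc(1) la(2)] by simp
    then have "r \<odot>\<^bsub>?S\<^esub> z = r \<odot>\<^bsub>?S\<^esub> l \<oplus>\<^bsub>?S\<^esub> a \<odot>\<^bsub>?S\<^esub> (r \<odot>\<^bsub>?S\<^esub> x)"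
      using r.smult_r_distr[OF rc(1) lc r.smult_closed[OF la(2) x(1)]] la(3) by simp
    then have "r \<odot>\<^bsub>?S\<^esub> z \<in> L"
      using r.submoduleD(4)[OF sL r.submoduleD(5)[OF sL rc(1) la(1)] r.submoduleD(5)[OF sL la(2) rc(2)]]
      by simp
    then show ?thesis by simp
  qed
  have "\<phi> r \<odot>\<^bsub>S\<^esub> z = \<zero>\<^bsub>S\<^esub>" if r: "r \<in> m" and z: "z \<in> carrier S" for r z
  proof (rule ccontr)
    assume ne: "\<phi> r \<odot>\<^bsub>S\<^esub> z \<noteq> \<zero>\<^bsub>S\<^esub>"
    have rc: "r \<in> carrier R" using r by (simp add: m_def)
    have "x' \<in> L" if x': "x' \<in> carrier S" for x'
    proof -
      obtain a where a: "a \<in> carrier A" "x' = a \<odot>\<^bsub>S\<^esub> (\<phi> r \<odot>\<^bsub>S\<^esub> z)"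
        using simple[OF _ ne x'] z rc by auto
      have "x' = \<phi> r \<odot>\<^bsub>S\<^esub> (a \<odot>\<^bsub>S\<^esub> z)"
        using a rc z S.smult_assoc1[of a "\<phi> r" z] S.smult_assoc1[of "\<phi> r" a z] central[OF rc a(1)]
        by simp
      then show ?thesis using mL[OF r] a(1) z by simp
    qed
    then show False using x by auto
  qed
  then show ?thesis using m by blast
qed

text \<open>Gives \<open>D S\<close> the shape that \<open>transpose_length\<close> requires over
  the opposite ring. The generator \<open>t\<close> is a functional nonzero at \<open>s\<close>,
  multiplied by \<open>e\<close>; since \<open>e s = s\<close>, it stays nonzero there.\<close>

theorem D_dual_simple:
  assumes e: "primitive_idempotent A e" and mic: "minimal_injective_cogenerator R I"
    and S: "left_module A S" and fl: "finite_length A S"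
    and s: "s \<in> carrier S" "e \<odot>\<^bsub>S\<^esub> s = s"
    and gen: "\<And>x. x \<in> carrier S \<Longrightarrow> \<exists>a\<in>carrier A. x = a \<odot>\<^bsub>S\<^esub> s"
    and ann: "\<And>a. a \<in> carrier A #>\<^bsub>A\<^esub> e \<Longrightarrow> a \<odot>\<^bsub>S\<^esub> s = \<zero>\<^bsub>S\<^esub> \<longleftrightarrow> a \<in> A.J"
  obtains t where "t \<in> carrier (D_dual R \<phi> I S)" "e \<odot>\<^bsub>D_dual R \<phi> I S\<^esub> t = t"
    "\<And>h. h \<in> carrier (D_dual R \<phi> I S) \<Longrightarrow> \<exists>a\<in>carrier A. h = a \<odot>\<^bsub>D_dual R \<phi> I S\<^esub> t"
    "\<And>a. a \<in> e <#\<^bsub>A\<^esub> carrier A \<Longrightarrow> a \<odot>\<^bsub>D_dual R \<phi> I S\<^esub> t = \<zero>\<^bsub>D_dual R \<phi> I S\<^esub> \<longleftrightarrow> a \<in> A.J"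
proof -
  interpret S: left_module A S by (rule S)
  interpret op: finite_length_ring "op_ring A" by (rule A.finite_length_ring_op)
  have idem: "idempotent_elt A e" and e0: "e \<noteq> \<zero>\<^bsub>A\<^esub>" using e by (auto simp: primitive_idempotent_def)
  have ec: "e \<in> carrier A" "e \<otimes>\<^bsub>A\<^esub> e = e" using idem by (auto simp: idempotent_elt_def)
  have eJ: "e \<notin> A.J" using A.idempotent_mem_J[OF idem] e0 by blast
  have s0: "s \<noteq> \<zero>\<^bsub>S\<^esub>"
    using ann[of e] s eJ ec A.mem_left_coset_idem[OF idem] by auto
  have reach: "\<exists>a\<in>carrier A. a \<odot>\<^bsub>S\<^esub> w = s" if "w \<in> carrier S" "w \<noteq> \<zero>\<^bsub>S\<^esub>" for w
    by (rule A.cyclic_top_generated[OF e S s gen ann that])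
  have simple: "\<exists>a\<in>carrier A. x = a \<odot>\<^bsub>S\<^esub> w" if w: "w \<in> carrier S" "w \<noteq> \<zero>\<^bsub>S\<^esub>" and x: "x \<in> carrier S" for w x
  proof -
    obtain a b where "a \<in> carrier A" "a \<odot>\<^bsub>S\<^esub> w = s" "b \<in> carrier A" "x = b \<odot>\<^bsub>S\<^esub> s"
      using reach[OF w] gen[OF x] by blast
    then show ?thesis using w by (intro bexI[of _ "b \<otimes>\<^bsub>A\<^esub> a"]) (simp_all add: S.smult_assoc1)
  qed
  obtain m where m: "R.max_ideal m" "\<And>r x. r \<in> m \<Longrightarrow> x \<in> carrier S \<Longrightarrow> \<phi> r \<odot>\<^bsub>S\<^esub> x = \<zero>\<^bsub>S\<^esub>"
    using annihilated_by_max_ideal[OF S fl s(1) s0 simple] by blast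
  have cog: "cogenerator R I" using mic by (simp add: minimal_injective_cogenerator_def)
  have Imod: "left_module R I" using cog by (simp add: cogenerator_def fg_module_def)
  interpret I: left_module R I by (rule Imod)
  let ?S = "restrict_scalars \<phi> S"
  let ?D = "D_dual R \<phi> I S"
  interpret r: finite_length_module R ?S
    by (intro finite_length_moduleI left_module_restrict
        finite_length_restrict S fl)
  interpret D: left_module "op_ring A" ?D by (rule left_module_D_dual[OF S Imod])
  have lin: "linear_map R ?S I h" if "h \<in> carrier ?D" for h
    using that linear_map_of_Hom[OF r.left_module_axioms Imod] by simp
  obtain h0 where h0: "linear_map R ?S I h0" "h0 s \<noteq> \<zero>\<^bsub>I\<^esub>"
    using cogenerator_separates[OF cog r.fg_module, of s] s(1) s0 by auto
  define h1 where "h1 = restrict h0 (carrier S)"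
  have h1: "h1 \<in> carrier ?D" using linear_map_in_Hom[OF h0(1)] by (simp add: h1_def)
  define t where "t = e \<odot>\<^bsub>?D\<^esub> h1"
  have t: "t \<in> carrier ?D" unfolding t_def using D.smult_closed[of e h1] ec h1 by simp
  have et: "e \<odot>\<^bsub>?D\<^esub> t = t"
  proof -
    have "e \<in> carrier (op_ring A)" "e \<otimes>\<^bsub>op_ring A\<^esub> e = e" using ec by simp_all
    then show ?thesis unfolding t_def using D.smult_assoc1[of e e h1] h1 by metis
  qed
  have ts: "t s \<noteq> \<zero>\<^bsub>I\<^esub>" using h0(2) s by (simp add: t_def h1_def)
  have act: "(a \<odot>\<^bsub>?D\<^esub> h) x = h (a \<odot>\<^bsub>S\<^esub> x)" if "x \<in> carrier S" for a h x using that by simp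
  have killed: "r \<odot>\<^bsub>I\<^esub> h x = \<zero>\<^bsub>I\<^esub>" if "h \<in> carrier ?D" "r \<in> m" "x \<in> carrier S" for h r x
  proof -
    interpret h: linear_map R ?S I h by (rule lin[OF that(1)])
    have "r \<in> carrier R" using R.reg.submoduleD(2)[OF R.max_idealD(2)[OF m(1)] that(2)] by simp
    then have "r \<odot>\<^bsub>I\<^esub> h x = h (\<phi> r \<odot>\<^bsub>S\<^esub> x)" using h.smult[of r x] that(3) by simp
    then show ?thesis using m(2)[OF that(2,3)] h.zero by simp
  qed
  define T where "T = cyclic (op_ring A) ?D t"
  have T: "submodule T (op_ring A) ?D" unfolding T_def by (rule D.submodule_cyclic[OF t])
  \<comment> \<open>If \<open>a w = s\<close>, the multiple of \<open>t\<close> by \<open>a\<close>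
    takes the value \<open>t s\<close> at \<open>w\<close>.\<close>
  have sep: "\<exists>k\<in>T. k w \<noteq> \<zero>\<^bsub>I\<^esub>" if w: "w \<in> carrier S" "w \<noteq> \<zero>\<^bsub>S\<^esub>" for w
  proof -
    obtain a where a: "a \<in> carrier A" "a \<odot>\<^bsub>S\<^esub> w = s" using reach[OF w] by blast
    have "(a \<odot>\<^bsub>?D\<^esub> t) w = t s" using act[OF w(1)] a by simp
    moreover have "a \<odot>\<^bsub>?D\<^esub> t \<in> T" unfolding T_def cyclic_def using a(1) by (intro imageI) simp
    ultimately show ?thesis using ts by metis
  qed
  text \<open>
    Descend from \<open>W = S\<close> to \<open>W = 0\<close> by cutting with kernels of elements of \<open>T\<close>. As the socle of \<open>I\<close> is
    one-dimensional, subtracting a multiple of such an element makes a functional vanish on the larger \<open>W\<close>.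
  \<close>
  let ?G = "\<lambda>W. submodule W R ?S \<and> (\<forall>h\<in>carrier ?D. (\<forall>x\<in>W. h x = \<zero>\<^bsub>I\<^esub>) \<longrightarrow> h \<in> T)"
  have "?G (carrier ?S)"
  proof (intro conjI r.submodule_carrier ballI impI)
    fix h assume h: "h \<in> carrier ?D" "\<forall>x\<in>carrier ?S. h x = \<zero>\<^bsub>I\<^esub>"
    have "h = \<zero>\<^bsub>?D\<^esub>"
      using h D.M.zero_closed by (intro module_Hom_eqI[of h R ?S I]) auto
    then show "h \<in> T" using D.submoduleD(3)[OF T] by simp
  qed
  then obtain W where W: "?G W" and minW: "\<And>W'. ?G W' \<Longrightarrow> rank R ?S W \<le> rank R ?S W'"
    using ex_has_least_nat[of ?G "carrier ?S" "rank R ?S"] by blast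
  have Ws: "submodule W R ?S" using W by blast
  note WD = r.submoduleD[OF Ws]
  have "W = {\<zero>\<^bsub>S\<^esub>}"
  proof (rule ccontr)
    assume "W \<noteq> {\<zero>\<^bsub>S\<^esub>}"
    then obtain w0 where w0: "w0 \<in> W" "w0 \<noteq> \<zero>\<^bsub>S\<^esub>" using WD(3) by auto
    then obtain k where k: "k \<in> T" "k w0 \<noteq> \<zero>\<^bsub>I\<^esub>" using sep WD(2) by auto
    have kD: "k \<in> carrier ?D" by (rule D.submoduleD(2)[OF T k(1)])
    interpret k: linear_map R ?S I k by (rule lin[OF kD])
    let ?W' = "W \<inter> a_kernel ?S I k"
    have W': "submodule ?W' R ?S" by (rule r.submodule_Int[OF Ws k.submodule_kernel])
    have "h \<in> T" if h: "h \<in> carrier ?D" "\<forall>x\<in>?W'. h x = \<zero>\<^bsub>I\<^esub>" for h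
    proof -
      interpret h: linear_map R ?S I h by (rule lin[OF h(1)])
      have w0c: "w0 \<in> carrier S" using WD(2)[OF w0(1)] by simp
      have vals: "k w \<in> carrier I" "h w \<in> carrier I" if "w \<in> carrier S" for w
        using k.closed h.closed that by simp_all
      obtain a where a: "a \<in> carrier R" "h w0 = a \<odot>\<^bsub>I\<^esub> k w0"
        using R.socle_cyclic[OF mic m(1) vals(1)[OF w0c] k(2) _ vals(2)[OF w0c]]
          killed[OF kD _ w0c] killed[OF h(1) _ w0c] by blast
      define d where "d = h \<ominus>\<^bsub>?D\<^esub> \<phi> a \<odot>\<^bsub>?D\<^esub> k"
      have akT: "\<phi> a \<odot>\<^bsub>?D\<^esub> k \<in> T" using D.submoduleD(5)[OF T _ k(1)] a(1) by simp
      have akD: "\<phi> a \<odot>\<^bsub>?D\<^esub> k \<in> carrier ?D" by (rule D.submoduleD(2)[OF T akT])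
      have dD: "d \<in> carrier ?D" unfolding d_def by (rule D.M.minus_closed[OF h(1) akD])
      have hd: "h = d \<oplus>\<^bsub>?D\<^esub> \<phi> a \<odot>\<^bsub>?D\<^esub> k" unfolding d_def using D.minus_add_cancel[OF h(1) akD] by simp
      interpret d: linear_map R ?S I d by (rule lin[OF dD])
      have dval: "h x = d x \<oplus>\<^bsub>I\<^esub> a \<odot>\<^bsub>I\<^esub> k x" if x: "x \<in> carrier S" for x
      proof -
        have "h x = d x \<oplus>\<^bsub>I\<^esub> (\<phi> a \<odot>\<^bsub>?D\<^esub> k) x" using fun_cong[OF hd, of x] x by simp
        moreover have "(\<phi> a \<odot>\<^bsub>?D\<^esub> k) x = a \<odot>\<^bsub>I\<^esub> k x" using act[OF x] k.smult[OF a(1), of x] x by simp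
        ultimately show ?thesis by simp
      qed
      have dw0: "d w0 = \<zero>\<^bsub>I\<^esub>"
        using dval[OF w0c] a vals[OF w0c] d.closed[of w0] w0c
          I.M.add.r_cancel_one[of "a \<odot>\<^bsub>I\<^esub> k w0" "d w0"] by simp
      have "d x = \<zero>\<^bsub>I\<^esub>" if x: "x \<in> W" for x
      proof -
        have xc: "x \<in> carrier S" using WD(2)[OF x] by simp
        \<comment> \<open>The values of \<open>k\<close> are multiples of \<open>k w0\<close>, so
          \<open>x - b w0\<close> lies in the kernel of \<open>k\<close>. There \<open>h\<close>
          vanishes, hence \<open>d\<close> does, and \<open>d w0 = 0\<close> gives
          \<open>d x = 0\<close>.\<close>
        obtain b where b: "b \<in> carrier R" "k x = b \<odot>\<^bsub>I\<^esub> k w0"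
          using R.socle_cyclic[OF mic m(1) vals(1)[OF w0c] k(2) _ vals(1)[OF xc]]
            killed[OF kD _ w0c] killed[OF kD _ xc] by blast
        define z where "z = x \<ominus>\<^bsub>?S\<^esub> b \<odot>\<^bsub>?S\<^esub> w0"
        have zW: "z \<in> W" unfolding z_def by (rule r.submodule_minus[OF Ws x WD(5)[OF b(1) w0(1)]])
        have zc: "z \<in> carrier S" using WD(2)[OF zW] by simp
        have bw: "b \<odot>\<^bsub>?S\<^esub> w0 \<in> carrier ?S" by (rule WD(2)[OF WD(5)[OF b(1) w0(1)]])
        have xz: "x = z \<oplus>\<^bsub>?S\<^esub> b \<odot>\<^bsub>?S\<^esub> w0"
          unfolding z_def using r.minus_add_cancel[OF _ bw, of x] xc by simp
        have "k z = k x \<ominus>\<^bsub>I\<^esub> b \<odot>\<^bsub>I\<^esub> k w0"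
          unfolding z_def using k.minus[OF _ bw, of x] k.smult[OF b(1), of w0] xc w0c by simp
        then have kz: "k z = \<zero>\<^bsub>I\<^esub>" using b vals[OF w0c] vals[OF xc] I.minus_eq_zero_iff by simp
        then have "z \<in> ?W'" using zW zc by (simp add: k.kernel_eq)
        then have "h z = \<zero>\<^bsub>I\<^esub>" using h(2) by blast
        then have "d z = \<zero>\<^bsub>I\<^esub>" using dval[OF zc] kz a(1) d.closed[of z] zc by simp
        then show ?thesis
          using xz d.add[of z "b \<odot>\<^bsub>?S\<^esub> w0"] d.smult[OF b(1), of w0] dw0 b(1) bw zc w0c by simp
      qed
      then have "d \<in> T" using W dD by blast
      then have "d \<oplus>\<^bsub>?D\<^esub> \<phi> a \<odot>\<^bsub>?D\<^esub> k \<in> T" by (rule D.submoduleD(4)[OF T _ akT])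
      then show ?thesis using hd by (rule ssubst[of h, rotated])
    qed
    then have "rank R ?S W \<le> rank R ?S ?W'" using W' by (intro minW) blast
    moreover have "rank R ?S ?W' < rank R ?S W"
    proof (rule r.rank_strict_mono[OF W' Ws])
      have "w0 \<notin> ?W'" using k(2) by (simp add: k.kernel_eq)
      then show "?W' \<subset> W" using w0(1) by blast
    qed
    ultimately show False by simp
  qed
  then have all: "h \<in> T" if h: "h \<in> carrier ?D" for h
    using W h linear_map.zero[OF lin[OF h]] by simp
  show thesis
  proof (rule that[OF t et])
    show "\<exists>a\<in>carrier A. h = a \<odot>\<^bsub>?D\<^esub> t" if "h \<in> carrier ?D" for h
      using all[OF that] unfolding T_def cyclic_def op_ring_simps by blast
    show "a \<odot>\<^bsub>?D\<^esub> t = \<zero>\<^bsub>?D\<^esub> \<longleftrightarrow> a \<in> A.J" if a: "a \<in> e <#\<^bsub>A\<^esub> carrier A" for a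
    proof
      have ac: "a \<in> carrier A" "e \<otimes>\<^bsub>A\<^esub> a = a" using a A.mem_right_coset_idem[OF idem] by auto
      assume J: "a \<in> A.J"
      have aS: "a \<odot>\<^bsub>S\<^esub> x = \<zero>\<^bsub>S\<^esub>" if x: "x \<in> carrier S" for x
      proof -
        obtain b where b: "b \<in> carrier A" "x = b \<odot>\<^bsub>S\<^esub> s" using gen[OF x] by blast
        have "a \<odot>\<^bsub>S\<^esub> x = (a \<otimes>\<^bsub>A\<^esub> b \<otimes>\<^bsub>A\<^esub> e) \<odot>\<^bsub>S\<^esub> s"
          using b ac ec s by (simp add: S.smult_assoc1)
        moreover have "a \<otimes>\<^bsub>A\<^esub> b \<otimes>\<^bsub>A\<^esub> e \<in> A.J" using J b(1) ec(1) by (intro A.J_mult_r)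
        moreover have "a \<otimes>\<^bsub>A\<^esub> b \<otimes>\<^bsub>A\<^esub> e \<in> carrier A #>\<^bsub>A\<^esub> e" using ac(1) b(1) by (auto simp: r_coset_def)
        ultimately show ?thesis using ann by simp
      qed
      show "a \<odot>\<^bsub>?D\<^esub> t = \<zero>\<^bsub>?D\<^esub>"
        using aS linear_map.zero[OF lin[OF t]] by (auto intro!: restrict_ext)
    next
      assume 0: "a \<odot>\<^bsub>?D\<^esub> t = \<zero>\<^bsub>?D\<^esub>"
      \<comment> \<open>The annihilator of \<open>t\<close> in \<open>e A\<close>. It misses
        \<open>e\<close> because \<open>e t = t\<close> is nonzero, so it is proper and thus inside
        \<open>J\<close>.\<close>
      let ?N = "(e <#\<^bsub>A\<^esub> carrier A) \<inter> {b \<in> carrier (op_ring A). b \<odot>\<^bsub>?D\<^esub> t \<in> {\<zero>\<^bsub>?D\<^esub>}}"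
      have N: "submodule ?N (op_ring A) (regular (op_ring A))"
        by (intro op.reg.submodule_Int A.right_ideal_right_coset(1) ec(1) D.quotient_ideal
            D.submodule_zero t)
      have "e \<notin> ?N" using et ts s(1) by (auto simp: fun_eq_iff)
      moreover have "e \<in> e <#\<^bsub>A\<^esub> carrier A" using ec A.mem_right_coset_idem[OF idem] by simp
      ultimately have "?N \<noteq> e <#\<^bsub>A\<^esub> carrier A" by blast
      then have "?N \<subseteq> A.J"
        using op.proper_submodule_le_J[of e ?N] N e by (simp add: r_coset_op_ring A.jacobson_radical_op)
      then show "a \<in> A.J" using a 0 A.mem_right_coset_idem[OF idem] by auto
    qed
  qed
qed

end

section \<open>The main inequality\<close>

lemma lquot_op_ring: "lquot (op_ring A) X Y = rquot A X Y"
  by (simp add: lquot_def rquot_def)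

lemma rquot_op_ring: "rquot (op_ring A) X Y = lquot A X Y"
  by (simp add: lquot_def rquot_def)

lemma l_coset_op_ring: "a <#\<^bsub>op_ring A\<^esub> X = X #>\<^bsub>A\<^esub> a"
  by (auto simp: r_coset_def l_coset_def)

text \<open>The generator is the coset of \<open>e\<close>, and \<open>J e = J \<inter> A e\<close>
  determines its annihilator.\<close>

lemma (in finite_length_ring) top_of_primitive:
  assumes e: "primitive_idempotent A e"
  obtains s where "left_module A (lquot A (carrier A #> e) (J #> e))"
    "finite_length A (lquot A (carrier A #> e) (J #> e))"
    "s \<in> carrier (lquot A (carrier A #> e) (J #> e))"
    "e \<odot>\<^bsub>lquot A (carrier A #> e) (J #> e)\<^esub> s = s"
    "\<And>x. x \<in> carrier (lquot A (carrier A #> e) (J #> e)) \<Longrightarrow>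
      \<exists>a\<in>carrier A. x = a \<odot>\<^bsub>lquot A (carrier A #> e) (J #> e)\<^esub> s"
    "\<And>a. a \<in> carrier A #> e \<Longrightarrow> a \<odot>\<^bsub>lquot A (carrier A #> e) (J #> e)\<^esub> s =
      \<zero>\<^bsub>lquot A (carrier A #> e) (J #> e)\<^esub> \<longleftrightarrow> a \<in> J"
proof -
  have idem: "idempotent_elt A e" using e by (simp add: primitive_idempotent_def)
  have ec: "e \<in> carrier A" "e \<otimes> e = e" using idem by (auto simp: idempotent_elt_def)
  let ?X = "(regular A)\<lparr>carrier := carrier A #> e\<rparr>"
  note Amem = mem_left_coset_idem[OF idem] and Jmem = mem_left_coset_idem_ideal[OF idem ideal_J]
  have Ae: "submodule (carrier A #> e) A (regular A)"
    using submodule_left_coset[OF ec(1) reg.submodule_carrier] by simp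
  have Je: "submodule (J #> e) A (regular A)" by (rule submodule_left_coset[OF ec(1) submodule_J])
  have le: "J #> e \<subseteq> carrier A #> e" using J_carrier by (auto simp: Amem Jmem)
  interpret X: left_module A ?X by (rule reg.left_module_sub[OF Ae])
  interpret q: quotient_module A ?X "J #> e"
    using Je le by (intro quotient_moduleI X.left_module_axioms) (simp add: reg.submodule_sub_iff[OF Ae])
  have S: "lquot A (carrier A #> e) (J #> e) = quot_mod ?X (J #> e)" by (simp add: lquot_def)
  have eX: "e \<in> carrier ?X" using ec Amem by simp
  have act: "a \<odot>\<^bsub>quot_mod ?X (J #> e)\<^esub> q.coset e = q.coset (a \<otimes> e)" if "a \<in> carrier A" for a
    using q.smult_quot[OF that eX] by simp
  show thesis
  proof (rule that[of "q.coset e"]; unfold S)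
    show "left_module A (quot_mod ?X (J #> e))" by (rule q.left_module_quot)
    show "finite_length A (quot_mod ?X (J #> e))" by (rule reg.comp_length_quot_sub(2)[OF Je Ae le])
    show "q.coset e \<in> carrier (quot_mod ?X (J #> e))" unfolding q.carrier_quot using eX by (rule imageI)
    show "e \<odot>\<^bsub>quot_mod ?X (J #> e)\<^esub> q.coset e = q.coset e" using act[OF ec(1)] ec(2) by simp
    show "\<exists>a\<in>carrier A. x = a \<odot>\<^bsub>quot_mod ?X (J #> e)\<^esub> q.coset e"
      if "x \<in> carrier (quot_mod ?X (J #> e))" for x
    proof -
      have "x \<in> q.coset ` carrier ?X" using that by (simp only: q.carrier_quot)
      then obtain a where a: "a \<in> carrier A #> e" "x = q.coset a" by auto
      then show ?thesis using act[of a] Amem[of a] by (intro bexI[of _ a]) simp_all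
    qed
    show "a \<odot>\<^bsub>quot_mod ?X (J #> e)\<^esub> q.coset e = \<zero>\<^bsub>quot_mod ?X (J #> e)\<^esub> \<longleftrightarrow> a \<in> J"
      if a: "a \<in> carrier A #> e" for a
      using act[of a] a Amem[of a] Jmem[of a] q.coset_eq_zero_iff[of a] by (simp add: q.zero_quot)
  qed
qed

theorem proposition5p1p1:
  fixes R :: "('r, 'k) ring_scheme" and A :: "('a, 'l) ring_scheme" and \<phi> :: "'r \<Rightarrow> 'a"
    and I :: "('r, 'i) module" and e :: 'a and J J2 :: "'a set" and S :: "('a, 'a set) module"
  assumes artin: "artin_algebra R A \<phi>"
    and I: "minimal_injective_cogenerator R I"
    and e: "primitive_idempotent A e"
  defines "J \<equiv> jacobson_radical A"
    and "J2 \<equiv> J \<cdot>\<^bsub>A\<^esub> J"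
    and "S \<equiv> lquot A (carrier A #>\<^bsub>A\<^esub> e) (J #>\<^bsub>A\<^esub> e)"
  shows
    "(\<forall>(s::nat) (\<epsilon> :: nat \<Rightarrow> 'a).
        (\<forall>i\<in>{1..s}. primitive_idempotent A (\<epsilon> i)) \<and>
        module_iso A (lquot A (J #>\<^bsub>A\<^esub> e) (J2 #>\<^bsub>A\<^esub> e))
          (direct_sum {1..s} (\<lambda>i. lquot A (carrier A #>\<^bsub>A\<^esub> \<epsilon> i) (J #>\<^bsub>A\<^esub> \<epsilon> i)))
        \<longrightarrow>
        (\<forall>(P1 :: ('a, 'p1) module) (f :: 'p1 \<Rightarrow> 'p0) (P0 :: ('a, 'p0) module) (p :: 'p0 \<Rightarrow> 'a set).
           minimal_projective_presentation A P1 f P0 p S \<longrightarrow>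
           int (comp_length A (D_dual R \<phi> I (transpose_mod A P1 f P0)))
             \<ge> (int s - 1) + (\<Sum>i=1..s. int (comp_length (op_ring A)
                                             (rquot A (\<epsilon> i <#\<^bsub>A\<^esub> J) (\<epsilon> i <#\<^bsub>A\<^esub> J2))))) \<and>
        (int s - 1) + (\<Sum>i=1..s. int (comp_length (op_ring A)
                                       (rquot A (\<epsilon> i <#\<^bsub>A\<^esub> J) (\<epsilon> i <#\<^bsub>A\<^esub> J2))))
          \<ge> 2 * int s - 1)
     \<and>
     (\<forall>(t::nat) (\<epsilon> :: nat \<Rightarrow> 'a).
        (\<forall>i\<in>{1..t}. primitive_idempotent A (\<epsilon> i)) \<and>
        module_iso (op_ring A) (rquot A (e <#\<^bsub>A\<^esub> J) (e <#\<^bsub>A\<^esub> J2))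
          (direct_sum {1..t} (\<lambda>i. rquot A (\<epsilon> i <#\<^bsub>A\<^esub> carrier A) (\<epsilon> i <#\<^bsub>A\<^esub> J)))
        \<longrightarrow>
        (\<forall>(Q1 :: ('a, 'q1) module) (g :: 'q1 \<Rightarrow> 'q0) (Q0 :: ('a, 'q0) module)
           (q :: 'q0 \<Rightarrow> 'a set \<Rightarrow> 'i).
           minimal_projective_presentation (op_ring A) Q1 g Q0 q (D_dual R \<phi> I S) \<longrightarrow>
           int (comp_length A (transpose_mod (op_ring A) Q1 g Q0))
             \<ge> (int t - 1) + (\<Sum>i=1..t. int (comp_length A
                                             (lquot A (J #>\<^bsub>A\<^esub> \<epsilon> i) (J2 #>\<^bsub>A\<^esub> \<epsilon> i))))) \<and>
        (int t - 1) + (\<Sum>i=1..t. int (comp_length A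
                                       (lquot A (J #>\<^bsub>A\<^esub> \<epsilon> i) (J2 #>\<^bsub>A\<^esub> \<epsilon> i))))
          \<ge> 2 * int t - 1)"
proof -
  interpret artin_algebra R A \<phi> by (rule artin)
  interpret fl: finite_length_ring A by (rule finite_length_ring)
  interpret op: finite_length_ring "op_ring A" by (rule fl.finite_length_ring_op)
  interpret opa: artin_algebra R "op_ring A" \<phi> by (rule artin_algebra_op)
  have cog: "cogenerator R I" using I by (simp add: minimal_injective_cogenerator_def)
  obtain s0 where S: "left_module A S" "finite_length A S" and s0: "s0 \<in> carrier S" "e \<odot>\<^bsub>S\<^esub> s0 = s0"
    and gen: "\<And>x. x \<in> carrier S \<Longrightarrow> \<exists>a\<in>carrier A. x = a \<odot>\<^bsub>S\<^esub> s0"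
    and ann: "\<And>a. a \<in> carrier A #>\<^bsub>A\<^esub> e \<Longrightarrow> a \<odot>\<^bsub>S\<^esub> s0 = \<zero>\<^bsub>S\<^esub> \<longleftrightarrow> a \<in> J"
    unfolding S_def J_def by (rule fl.top_of_primitive[OF e]) blast
  obtain t0 where t0: "t0 \<in> carrier (D_dual R \<phi> I S)" "e \<odot>\<^bsub>D_dual R \<phi> I S\<^esub> t0 = t0"
    and tgen: "\<And>h. h \<in> carrier (D_dual R \<phi> I S) \<Longrightarrow> \<exists>a\<in>carrier A. h = a \<odot>\<^bsub>D_dual R \<phi> I S\<^esub> t0"
    and tann: "\<And>a. a \<in> e <#\<^bsub>A\<^esub> carrier A \<Longrightarrow> a \<odot>\<^bsub>D_dual R \<phi> I S\<^esub> t0 = \<zero>\<^bsub>D_dual R \<phi> I S\<^esub> \<longleftrightarrow> a \<in> J"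
    unfolding J_def
    by (rule D_dual_simple[OF e I S s0 gen ann[unfolded J_def]]) (assumption, assumption, blast)
  have Imod: "left_module R I" using cog by (simp add: cogenerator_def fg_module_def)
  have T: "left_module (op_ring A) (D_dual R \<phi> I S)" by (rule left_module_D_dual[OF S(1) Imod])
  have Jop: "jacobson_radical (op_ring A) = J" by (simp add: J_def fl.jacobson_radical_op)
  have eop: "primitive_idempotent (op_ring A) e" using e by simp
  note J2' = J2_def[unfolded J_def]

  \<comment> \<open>Every radical layer contributes at least 1, and \<open>(n - 1) + n\<close> is
    \<open>2 n - 1\<close>. Subtraction is that of the integers, so \<open>n = 0\<close> gives
    \<open>-1\<close> and not a truncated 0.\<close>
  have pos: "2 * int n - 1 \<le> (int n - 1) + (\<Sum>i=1..n. int (l i))"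
    if "\<And>i. i \<in> {1..n} \<Longrightarrow> 1 \<le> l i" for n and l :: "nat \<Rightarrow> nat"
  proof -
    have "(\<Sum>i=1..n. 1) \<le> (\<Sum>i=1..n. int (l i))" by (rule sum_mono) (use that in force)
    then show ?thesis by simp
  qed

  show ?thesis
  proof (intro conjI allI impI; elim conjE)
    fix s :: nat and \<epsilon> :: "nat \<Rightarrow> 'a"
    assume prim: "\<forall>i\<in>{1..s}. primitive_idempotent A (\<epsilon> i)"
      and iso: "module_iso A (lquot A (J #>\<^bsub>A\<^esub> e) (J2 #>\<^bsub>A\<^esub> e))
          (direct_sum {1..s} (\<lambda>i. lquot A (carrier A #>\<^bsub>A\<^esub> \<epsilon> i) (J #>\<^bsub>A\<^esub> \<epsilon> i)))"
    note prim' = bspec[OF prim] and iso' = iso[unfolded J2' J_def]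
    show "(int s - 1) + (\<Sum>i=1..s. int (comp_length (op_ring A) (rquot A (\<epsilon> i <#\<^bsub>A\<^esub> J) (\<epsilon> i <#\<^bsub>A\<^esub> J2))))
        \<ge> 2 * int s - 1"
      unfolding J2' J_def
      by (intro pos fl.radical_layer_length_pos[OF e prim' _ iso']) simp_all
    fix P1 :: "('a, 'p1) module" and f :: "'p1 \<Rightarrow> 'p0" and P0 :: "('a, 'p0) module" and p :: "'p0 \<Rightarrow> 'a set"
    assume mpp: "minimal_projective_presentation A P1 f P0 p S"
    note tr = fl.transpose_length[OF e prim' finite_atLeastAtMost iso' S(1) s0 gen ann[unfolded J_def] mpp]
    \<comment> \<open>The transpose is a module over \<open>op_ring A\<close>, so taking its dual is
      an instance for the opposite algebra and leads back to
      \<open>op_ring (op_ring A) = A\<close>.\<close>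
    have "comp_length (op_ring A) (transpose_mod A P1 f P0) \<le>
        comp_length (op_ring (op_ring A)) (D_dual R \<phi> I (transpose_mod A P1 f P0))"
      by (rule opa.comp_length_D_dual_ge[OF tr(1,2) cog])
    then show "int (comp_length A (D_dual R \<phi> I (transpose_mod A P1 f P0)))
      \<ge> (int s - 1) + (\<Sum>i=1..s. int (comp_length (op_ring A) (rquot A (\<epsilon> i <#\<^bsub>A\<^esub> J) (\<epsilon> i <#\<^bsub>A\<^esub> J2))))"
      using tr(3) by (simp add: J2' J_def)
  next
    fix t :: nat and \<epsilon> :: "nat \<Rightarrow> 'a"
    assume prim: "\<forall>i\<in>{1..t}. primitive_idempotent A (\<epsilon> i)"
      and iso: "module_iso (op_ring A) (rquot A (e <#\<^bsub>A\<^esub> J) (e <#\<^bsub>A\<^esub> J2))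
          (direct_sum {1..t} (\<lambda>i. rquot A (\<epsilon> i <#\<^bsub>A\<^esub> carrier A) (\<epsilon> i <#\<^bsub>A\<^esub> J)))"
    \<comment> \<open>Passing to the opposite ring exchanges left and right cosets and quotients and
      reverses products of ideals, while \<open>J\<close> and \<open>J2\<close> stay the same
      sets.\<close>
    note op_simps = Jop ideal_prod_op r_coset_op_ring l_coset_op_ring lquot_op_ring rquot_op_ring
      op_ring_simps(1) op_ring_op_ring
    have prim': "primitive_idempotent (op_ring A) (\<epsilon> i)" if "i \<in> {1..t}" for i
      using prim that by simp
    have iso': "module_iso (op_ring A)
        (lquot (op_ring A) (jacobson_radical (op_ring A) #>\<^bsub>op_ring A\<^esub> e)
          ((jacobson_radical (op_ring A) \<cdot>\<^bsub>op_ring A\<^esub> jacobson_radical (op_ring A)) #>\<^bsub>op_ring A\<^esub> e))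
        (direct_sum {1..t} (\<lambda>i. lquot (op_ring A) (carrier (op_ring A) #>\<^bsub>op_ring A\<^esub> \<epsilon> i)
          (jacobson_radical (op_ring A) #>\<^bsub>op_ring A\<^esub> \<epsilon> i)))"
      using iso unfolding op_simps J2_def .
    have pos': "1 \<le> comp_length A (lquot A (J #>\<^bsub>A\<^esub> \<epsilon> i) (J2 #>\<^bsub>A\<^esub> \<epsilon> i))" if "i \<in> {1..t}" for i
      using op.radical_layer_length_pos[OF eop prim' finite_atLeastAtMost iso' that]
      unfolding op_simps J2_def .
    show "(int t - 1) + (\<Sum>i=1..t. int (comp_length A (lquot A (J #>\<^bsub>A\<^esub> \<epsilon> i) (J2 #>\<^bsub>A\<^esub> \<epsilon> i))))
        \<ge> 2 * int t - 1"
      by (rule pos[OF pos'])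
    fix Q1 :: "('a, 'q1) module" and g :: "'q1 \<Rightarrow> 'q0" and Q0 :: "('a, 'q0) module"
      and q :: "'q0 \<Rightarrow> 'a set \<Rightarrow> 'i"
    assume mpp: "minimal_projective_presentation (op_ring A) Q1 g Q0 q (D_dual R \<phi> I S)"
    \<comment> \<open>Over the opposite ring \<open>D S\<close> with generator \<open>t0\<close>
      plays the part of \<open>S\<close>. The transpose is now a left \<open>A\<close>-module, and
      its length is bounded without a further dual.\<close>
    have "int (card {1..t}) - 1 + (\<Sum>i=1..t. int (comp_length (op_ring (op_ring A))
          (rquot (op_ring A) (\<epsilon> i <#\<^bsub>op_ring A\<^esub> jacobson_radical (op_ring A))
            (\<epsilon> i <#\<^bsub>op_ring A\<^esub> (jacobson_radical (op_ring A) \<cdot>\<^bsub>op_ring A\<^esub> jacobson_radical (op_ring A))))))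
        \<le> int (comp_length (op_ring (op_ring A)) (transpose_mod (op_ring A) Q1 g Q0))"
      by (rule op.transpose_length(3)[OF eop prim' finite_atLeastAtMost iso' T t0 _ _ mpp])
        (use tgen tann in \<open>simp_all only: op_simps\<close>)
    then show "int (comp_length A (transpose_mod (op_ring A) Q1 g Q0))
      \<ge> (int t - 1) + (\<Sum>i=1..t. int (comp_length A (lquot A (J #>\<^bsub>A\<^esub> \<epsilon> i) (J2 #>\<^bsub>A\<^esub> \<epsilon> i))))"
      unfolding op_simps J2_def by simp
  qed
qed

end
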